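(* Fix $0<\gamma<\tfrac12$. For every $\epsilon>0$ there exist $K(\epsilon)$ and $\rho=\rho(\epsilon)>0$ such that for every fixed $K=2^k\ge K(\epsilon)$, the FPP metric $d_\gamma$ and the measure $\mu_\gamma$ associated with the $K$-coarse MBRW satisfy $$\lim_{n\to\infty}\mathbb P\Big(\mu_\gamma\times\mu_\gamma\big(\{(u,v)\in V_N\times V_N:\ N^{1-\epsilon}\le d_\gamma(u,v)\le N^{1+\epsilon}\}\big)\ge 1-N^{-\rho}\Big)=1,$$ where $N=2^n$.
   Context: Let $k\ge1$ be an integer, $K=2^k$, $n\ge1$, $N=2^n$, $m=\lfloor n/k\rfloor$, and $V_N=\{0,1,\dots,N-1\}^2\subset\mathbb Z^2$. For $u=(u_1,u_2),v=(v_1,v_2)$, $|u-v|=\max(|u_1-v_1|,|u_2-v_2|)$ ($\ell_\infty$-distance); $\log$ is the natural logarithm. For $j\ge0$ let $\mathcal B_j$ be the set of boxes $x+\{0,\dots,2^j-1\}^2$ with $x\in\mathbb Z^2$, and $\mathcal B_j(z)$ the set of those containing $z$. Let $\{b_{j,B}: j\ge0, B\in\mathcal B_j\}$ be independent centered Gaussians with $\mathrm{Var}(b_{j,B})=2^{-2j}$. Set $\psi_{j,z}=\sum_{B\in\mathcal B_{jk}(z)}\sqrt k\,b_{jk,B}$ and define the $K$-coarse modified branching random walk (MBRW) $\varphi_{N,z}=\sum_{j=0}^{m-1}\psi_{j,z}$. A path is a finite sequence of vertices of $V_N$ in which consecutive vertices are nearest neighbours in $\mathbb Z^2$. For $\gamma>0$,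 $\mu_\gamma$ is the random probability measure on $V_N$ with $\mu_\gamma(v)=e^{\gamma\varphi_{N,v}}/\sum_{w\in V_N}e^{\gamma\varphi_{N,w}}$, and $d_\gamma(u,v)=\min_P\sum_{w\in P}e^{\gamma\varphi_{N,w}}$, the minimum over all paths $P$ in $V_N$ connecting $u$ and $v$. *)

theory Defs
  imports "HOL-Probability.Probability"
begin

type_synonym vtx = "int \<times> int"
type_synonym sample = "nat \<times> int \<times> int \<Rightarrow> real"
  \<comment> \<open>omega (j, x1, x2) = b_{j,B} for the box B = (x1,x2) + {0..2^j-1}^2\<close>

definition VN :: "nat \<Rightarrow> vtx set" where
  "VN n = {0..<2^n} \<times> {0..<2^n}"

definition boxes_containing :: "nat \<Rightarrow> vtx \<Rightarrow> vtx set" where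
  "boxes_containing j z =
     {x. fst x \<le> fst z \<and> fst z \<le> fst x + 2^j - 1 \<and> snd x \<le> snd z \<and> snd z \<le> snd x + 2^j - 1}"

definition gauss_space :: "sample measure" where
  "gauss_space = (\<Pi>\<^sub>M i\<in>UNIV. density lborel (normal_density 0 (2 powr (- real (fst i)))))"

definition psi :: "nat \<Rightarrow> sample \<Rightarrow> nat \<Rightarrow> vtx \<Rightarrow> real" where
  "psi k \<omega> j z = (\<Sum>x\<in>boxes_containing (j*k) z. sqrt (real k) * \<omega> (j*k, fst x, snd x))"

definition phi :: "nat \<Rightarrow> nat \<Rightarrow> sample \<Rightarrow> vtx \<Rightarrow> real" where
  "phi k n \<omega> z = (\<Sum>j<n div k. psi k \<omega> j z)"

definition nbr :: "vtx \<Rightarrow> vtx \<Rightarrow> bool" where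
  "nbr u v \<longleftrightarrow> \<bar>fst u - fst v\<bar> + \<bar>snd u - snd v\<bar> = 1"

definition is_path :: "nat \<Rightarrow> vtx list \<Rightarrow> vtx \<Rightarrow> vtx \<Rightarrow> bool" where
  "is_path n P u v \<longleftrightarrow> P \<noteq> [] \<and> hd P = u \<and> last P = v \<and> set P \<subseteq> VN n \<and>
     (\<forall>i. Suc i < length P \<longrightarrow> nbr (P ! i) (P ! Suc i))"

definition fpp_dist :: "real \<Rightarrow> nat \<Rightarrow> nat \<Rightarrow> sample \<Rightarrow> vtx \<Rightarrow> vtx \<Rightarrow> real" where
  "fpp_dist \<gamma> k n \<omega> u v =
     Inf {(\<Sum>w\<leftarrow>P. exp (\<gamma> * phi k n \<omega> w)) | P. is_path n P u v}"

definition lqg_measure :: "real \<Rightarrow> nat \<Rightarrow> nat \<Rightarrow> sample \<Rightarrow> vtx \<Rightarrow> real" where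
  "lqg_measure \<gamma> k n \<omega> v =
     exp (\<gamma> * phi k n \<omega> v) / (\<Sum>w\<in>VN n. exp (\<gamma> * phi k n \<omega> w))"

end

theory Submission
  imports Defs "HOL-Real_Asymp.Real_Asymp"
begin

text \<open>
  Lower bound.  A \<open>*\<close>-connected set of diameter \<open>K^j\<close> contains, by repeatedly passing to
  separated subcells, a hierarchical skeleton of \<open>(K/64)^j\<close> vertices.  The number of candidate
  skeletons of cells of side \<open>K^i\<close> is exponential in their size with a constant not depending on
  \<open>K\<close>, while the field of level \<open>i\<close> has variance \<open>k = log\<^sub>2 K\<close> and is independent over
  separated cells; so for large \<open>k\<close> a union bound shows that its average over every skeleton is at
  least \<open>- a k\<close>.  By Jensen, \<open>exp (\<gamma> \<phi>)\<close> summed over the set is at least \<open>K^j N^(-\<epsilon>)\<close>, and the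
  same holds for \<open>exp (- \<gamma> \<phi>)\<close> since \<open>- \<phi>\<close> has the law of \<open>\<phi>\<close>.

  Upper bound, by duality.  Integrating the mass of \<open>exp (- \<gamma> \<phi>)\<close> over the level sets of the distance
  from a connected set \<open>A\<close> in a square of side \<open>R\<close> gives at most \<open>R\<^sup>2\<close>; each level set separates \<open>A\<close>
  from its target \<open>B\<close>, hence has a large \<open>*\<close>-component, whose mass is bounded below by the first
  part.  This bounds the distance from \<open>A\<close> to \<open>B\<close>.  Starting from a point of moderate thickness and
  moving from block to block reaches the macroscopic scale at cost \<open>N^(1 + \<epsilon>)\<close>.

  Points of large thickness, and pairs of points at distance below \<open>N^(1 - \<epsilon>)\<close>, carry little
  \<open>\<mu>\<^sub>\<gamma>\<close>-mass by first and second moment estimates, where \<open>\<gamma> < 1/2\<close> lies well inside the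
  \<open>L\<^sup>2\<close> regime.
\<close>

subsection \<open>Gaussian linear functionals\<close>

text \<open>Two cancellations fix the constants. At each generation a skeleton keeps cells congruent
  modulo 8 in both coordinates, so it has \<open>(2^(k-6))^J\<close> instead of
  \<open>2^(k*J)\<close> points. The lost factor \<open>2^(6*m)\<close>, with
  \<open>m = n div k\<close>, is at most \<open>N^(6/k)\<close>; this is where K must be large in
  terms of \<epsilon>. In the upper bound, duality at scale l costs about \<open>2^(k*l)\<close>
  times the exponential of \<gamma> times the levels from l on. A thin point bounds those levels by
  \<open>2 * ln 2 * k * (m - l)\<close>, and \<gamma> < 1/2 makes the exponential at most
  \<open>2^(k * (m - l))\<close>: the product is about N at every scale, so all scales together cost
  only a factor linear in n. The obstacle is the union bound near the root: for the levels just
  below the scale of the set, its skeletons have too few cells to beat the \<open>4^n\<close>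
  positions. These levels, a \<delta>-fraction, are left to a maximum over all vertices, at the
  price \<open>2 * sqrt \<delta> * n\<close> in the field. A similar truncation makes the total mass
  concentrate.\<close>

definition sdev :: "nat \<times> int \<times> int \<Rightarrow> real" where
  "sdev i = 2 powr (- real (fst i))"

lemma sdev_pos: "sdev i > 0"
  by (simp add: sdev_def)

lemma gauss_space_alt: "gauss_space = (\<Pi>\<^sub>M i\<in>UNIV. density lborel (normal_density 0 (sdev i)))"
  by (simp add: gauss_space_def sdev_def)

lemma normal_mgf:
  assumes "\<sigma> > 0"
  shows "integrable (density lborel (normal_density 0 \<sigma>)) (\<lambda>x. exp (a * x))"
    and "(\<integral>x. exp (a * x) \<partial>density lborel (normal_density 0 \<sigma>)) = exp (a\<^sup>2 * \<sigma>\<^sup>2 / 2)"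
proof -
  have eq: "normal_density 0 \<sigma> x * exp (a * x) = exp (a\<^sup>2 * \<sigma>\<^sup>2 / 2) * normal_density (a * \<sigma>\<^sup>2) \<sigma> x" for x
  proof -
    have "- (x\<^sup>2) / (2 * \<sigma>\<^sup>2) + a * x = a\<^sup>2 * \<sigma>\<^sup>2 / 2 + - ((x - a * \<sigma>\<^sup>2)\<^sup>2) / (2 * \<sigma>\<^sup>2)"
      using assms by (simp add: field_simps power2_eq_square)
    then show ?thesis
      by (simp add: normal_density_def exp_add[symmetric] field_simps)
  qed
  show "integrable (density lborel (normal_density 0 \<sigma>)) (\<lambda>x. exp (a * x))"
    by (subst integrable_density) (use assms in \<open>auto simp: eq\<close>)
  show "(\<integral>x. exp (a * x) \<partial>density lborel (normal_density 0 \<sigma>)) = exp (a\<^sup>2 * \<sigma>\<^sup>2 / 2)"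
    by (subst integral_density) (use assms in \<open>auto simp: eq\<close>)
qed

lemma gauss_product: "product_prob_space (\<lambda>i. density lborel (normal_density 0 (sdev i)))"
  by (rule product_prob_spaceI) (rule prob_space_normal_density[OF sdev_pos])

lemma prob_space_gauss: "prob_space gauss_space"
  unfolding gauss_space_alt by (rule prob_space_PiM) (rule prob_space_normal_density[OF sdev_pos])

lemma space_gauss [simp]: "space gauss_space = UNIV"
  by (simp add: gauss_space_alt space_PiM)

lemma gauss_component_measurable [measurable]: "(\<lambda>\<omega>. \<omega> i) \<in> borel_measurable gauss_space"
proof -
  have "(\<lambda>\<omega>. \<omega> i) \<in> measurable gauss_space (density lborel (normal_density 0 (sdev i)))"
    unfolding gauss_space_alt by (rule measurable_component_singleton) simp
  then show ?thesis by simp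
qed

text \<open>Linear functionals of the noise are kept as coefficient functions, summed over a
  finite index set that contains the support.\<close>

definition lin :: "(nat \<times> int \<times> int) set \<Rightarrow> (nat \<times> int \<times> int \<Rightarrow> real) \<Rightarrow> sample \<Rightarrow> real" where
  "lin I c \<omega> = (\<Sum>i\<in>I. c i * \<omega> i)"

text \<open>The variance of the centred Gaussian variable \<open>lin I c\<close>.\<close>

definition qvar :: "(nat \<times> int \<times> int) set \<Rightarrow> (nat \<times> int \<times> int \<Rightarrow> real) \<Rightarrow> real" where
  "qvar I c = (\<Sum>i\<in>I. (c i)\<^sup>2 * (sdev i)\<^sup>2)"

text \<open>The integrand depends only on the coordinates in \<open>I\<close>, so the infinite
  product measure is replaced by its marginal on a finite product, where the exponential of a sum
  factorises.\<close>

lemma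
  assumes I: "finite I"
  shows integrable_exp_lin: "integrable gauss_space (\<lambda>\<omega>. exp (lin I c \<omega>))"
    and integral_exp_lin: "(\<integral>\<omega>. exp (lin I c \<omega>) \<partial>gauss_space) = exp (qvar I c / 2)"
proof -
  let ?M = "\<lambda>i. density lborel (normal_density 0 (sdev i))"
  interpret product_prob_space ?M UNIV by (rule gauss_product)
  have d: "PiM I ?M = distr gauss_space (PiM I ?M) (\<lambda>x. restrict x I)"
    unfolding gauss_space_alt by (rule distr_PiM_restrict_finite[symmetric]) (use I in auto)
  have meas: "(\<lambda>x. restrict x I) \<in> measurable gauss_space (PiM I ?M)"
    unfolding gauss_space_alt by (rule measurable_restrict_subset) simp
  have pm: "(\<lambda>x. \<Prod>i\<in>I. exp (c i * x i)) \<in> borel_measurable (PiM I ?M)"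
  proof (rule borel_measurable_prod)
    fix i assume "i \<in> I"
    then have "(\<lambda>x. x i) \<in> measurable (PiM I ?M) (?M i)"
      by (rule measurable_component_singleton)
    then have "(\<lambda>x. x i) \<in> borel_measurable (PiM I ?M)" by simp
    then show "(\<lambda>x. exp (c i * x i)) \<in> borel_measurable (PiM I ?M)"
      by measurable
  qed
  have e: "exp (lin I c \<omega>) = (\<Prod>i\<in>I. exp (c i * restrict \<omega> I i))" for \<omega>
    by (simp add: lin_def exp_sum I)
  have "integrable (PiM I ?M) (\<lambda>x. \<Prod>i\<in>I. exp (c i * x i))"
    using I by (intro product_integrable_prod normal_mgf sdev_pos)
  then show "integrable gauss_space (\<lambda>\<omega>. exp (lin I c \<omega>))"
    unfolding e by (subst (asm) d) (simp only: integrable_distr_eq[OF meas pm])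
  have "(\<integral>\<omega>. exp (lin I c \<omega>) \<partial>gauss_space) = (\<integral>x. (\<Prod>i\<in>I. exp (c i * x i)) \<partial>PiM I ?M)"
    unfolding e by (subst d) (simp only: integral_distr[OF meas pm])
  also have "\<dots> = (\<Prod>i\<in>I. \<integral>x. exp (c i * x) \<partial>?M i)"
    using I by (intro product_integral_prod normal_mgf sdev_pos)
  also have "\<dots> = exp (qvar I c / 2)"
    by (simp add: normal_mgf sdev_pos qvar_def exp_sum[OF I, symmetric] sum_divide_distrib)
  finally show "(\<integral>\<omega>. exp (lin I c \<omega>) \<partial>gauss_space) = exp (qvar I c / 2)" .
qed

lemma lin_sum: "lin I (\<lambda>i. \<Sum>t\<in>S. c t i) \<omega> = (\<Sum>t\<in>S. lin I (c t) \<omega>)"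
  unfolding lin_def by (subst sum.swap) (simp add: sum_distrib_right)

lemma lin_add: "lin I (\<lambda>i. c i + d i) \<omega> = lin I c \<omega> + lin I d \<omega>"
  unfolding lin_def by (simp add: sum.distrib distrib_right)

lemma lin_scale: "lin I (\<lambda>i. a * c i) \<omega> = a * lin I c \<omega>"
  unfolding lin_def by (simp add: sum_distrib_left mult.assoc)

text \<open>At each coordinate at most one summand is nonzero, so cross terms vanish. Disjoint
  supports are the form in which independence is used throughout.\<close>

lemma qvar_disjoint_sum:
  assumes "finite S"
    and dis: "\<And>t t' i. t \<in> S \<Longrightarrow> t' \<in> S \<Longrightarrow> t \<noteq> t' \<Longrightarrow> c t i = 0 \<or> c t' i = 0"
  shows "qvar I (\<lambda>i. \<Sum>t\<in>S. c t i) = (\<Sum>t\<in>S. qvar I (c t))"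
proof -
  have "(\<Sum>t\<in>S. c t i)\<^sup>2 = (\<Sum>t\<in>S. (c t i)\<^sup>2)" for i
    using assms
  proof (induction S rule: finite_induct)
    case (insert t S)
    have "c t i * (\<Sum>t\<in>S. c t i) = (\<Sum>t'\<in>S. c t i * c t' i)"
      by (simp add: sum_distrib_left)
    also have "\<dots> = 0"
    proof (rule sum.neutral, rule ballI)
      fix t' assume "t' \<in> S"
      with insert.hyps(2) have "t \<noteq> t'" by blast
      with insert.prems(1)[of t t' i] \<open>t' \<in> S\<close> show "c t i * c t' i = 0" by fastforce
    qed
    finally have cross: "c t i * (\<Sum>t\<in>S. c t i) = 0" .
    have "(\<Sum>t\<in>S. c t i)\<^sup>2 = (\<Sum>t\<in>S. (c t i)\<^sup>2)"
      by (rule insert.IH) (use insert.prems(1) in blast)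
    then show ?case
      using insert.hyps cross by (simp add: power2_sum)
  qed simp
  then show ?thesis
    unfolding qvar_def by (subst sum.swap) (simp add: sum_distrib_right)
qed

text \<open>Multiplying out gives a sum over choice functions \<open>g\<close>, each term a single
  exponential of a linear functional, whose variance splits because the chosen coefficients have
  disjoint supports. This is the product rule for expectations of independent factors.\<close>

lemma
  assumes I: "finite I" and S: "finite S" and A: "\<And>t. t \<in> S \<Longrightarrow> finite (A t)"
    and dis: "\<And>t t' a a' i. t \<in> S \<Longrightarrow> t' \<in> S \<Longrightarrow> t \<noteq> t' \<Longrightarrow> a \<in> A t \<Longrightarrow> a' \<in> A t' \<Longrightarrow>
       c t a i = 0 \<or> c t' a' i = 0"
  shows integrable_prod_sum_exp:
      "integrable gauss_space (\<lambda>\<omega>. \<Prod>t\<in>S. \<Sum>a\<in>A t. h t a * exp (lin I (c t a) \<omega>))" (is ?i)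
    and integral_prod_sum_exp:
      "(\<integral>\<omega>. (\<Prod>t\<in>S. \<Sum>a\<in>A t. h t a * exp (lin I (c t a) \<omega>)) \<partial>gauss_space) =
       (\<Prod>t\<in>S. \<Sum>a\<in>A t. h t a * exp (qvar I (c t a) / 2))" (is ?e)
proof -
  have 1: "(\<Prod>t\<in>S. \<Sum>a\<in>A t. h t a * exp (lin I (c t a) \<omega>)) =
     (\<Sum>g\<in>PiE S A. (\<Prod>t\<in>S. h t (g t)) * exp (lin I (\<lambda>i. \<Sum>t\<in>S. c t (g t) i) \<omega>))" for \<omega>
    by (simp add: prod_sum_PiE S A prod.distrib lin_sum exp_sum)
  have fin: "finite (PiE S A)" by (rule finite_PiE) (use S A in auto)
  show ?i unfolding 1 by (intro Bochner_Integration.integrable_sum integrable_mult_right integrable_exp_lin I)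
  have "(\<integral>\<omega>. (\<Prod>t\<in>S. \<Sum>a\<in>A t. h t a * exp (lin I (c t a) \<omega>)) \<partial>gauss_space) =
     (\<Sum>g\<in>PiE S A. (\<Prod>t\<in>S. h t (g t)) * exp (qvar I (\<lambda>i. \<Sum>t\<in>S. c t (g t) i) / 2))"
    unfolding 1 by (subst Bochner_Integration.integral_sum)
      (auto intro!: integrable_exp_lin I simp: integral_exp_lin I)
  also have "\<dots> = (\<Sum>g\<in>PiE S A. \<Prod>t\<in>S. h t (g t) * exp (qvar I (c t (g t)) / 2))"
  proof (rule sum.cong[OF refl])
    fix g assume g: "g \<in> PiE S A"
    have "qvar I (\<lambda>i. \<Sum>t\<in>S. c t (g t) i) = (\<Sum>t\<in>S. qvar I (c t (g t)))"
      by (rule qvar_disjoint_sum) (use S dis g in \<open>auto simp: PiE_mem\<close>)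
    then show "(\<Prod>t\<in>S. h t (g t)) * exp (qvar I (\<lambda>i. \<Sum>t\<in>S. c t (g t) i) / 2) =
      (\<Prod>t\<in>S. h t (g t) * exp (qvar I (c t (g t)) / 2))"
      by (simp add: prod.distrib exp_sum S sum_divide_distrib)
  qed
  also have "\<dots> = (\<Prod>t\<in>S. \<Sum>a\<in>A t. h t a * exp (qvar I (c t a) / 2))"
    by (simp add: prod_sum_PiE S A)
  finally show ?e .
qed

subsection \<open>Events with high probability\<close>

text \<open>``With high probability'', certified through Markov's inequality by nonnegative functions of
  vanishing mean, so that the events themselves need not be measurable.\<close>

definition whp :: "(nat \<Rightarrow> sample \<Rightarrow> bool) \<Rightarrow> bool" where
  "whp P \<longleftrightarrow> (\<exists>F::nat \<Rightarrow> sample \<Rightarrow> real. (\<forall>n. integrable gauss_space (F n)) \<and> (\<forall>n \<omega>. 0 \<le> F n \<omega>) \<and>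
     (\<lambda>n. \<integral>\<omega>. F n \<omega> \<partial>gauss_space) \<longlonglongrightarrow> 0 \<and>
     (\<forall>\<^sub>F n in sequentially. \<forall>\<omega>. F n \<omega> < 1 \<longrightarrow> P n \<omega>))"

lemma whpI:
  fixes F :: "nat \<Rightarrow> sample \<Rightarrow> real"
  assumes "\<And>n. integrable gauss_space (F n)" "\<And>n \<omega>. 0 \<le> F n \<omega>"
    and "\<forall>\<^sub>F n in sequentially. (\<integral>\<omega>. F n \<omega> \<partial>gauss_space) \<le> b n" "b \<longlonglongrightarrow> 0"
    and "\<forall>\<^sub>F n in sequentially. \<forall>\<omega>. F n \<omega> < 1 \<longrightarrow> P n \<omega>"
  shows "whp P"
  unfolding whp_def
proof (intro exI[of _ F] conjI allI assms(1,2,5))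
  show "(\<lambda>n. \<integral>\<omega>. F n \<omega> \<partial>gauss_space) \<longlonglongrightarrow> 0"
    by (rule tendsto_sandwich[OF _ assms(3) tendsto_const assms(4)])
       (auto intro!: always_eventually integral_nonneg_AE assms(2))
qed

text \<open>Certificates add: where \<open>F + G < 1\<close> with both nonnegative, each is below
  1.\<close>

lemma whp_conj:
  assumes "whp P" "whp Q"
  shows "whp (\<lambda>n \<omega>. P n \<omega> \<and> Q n \<omega>)"
proof -
  obtain F :: "nat \<Rightarrow> sample \<Rightarrow> real" where F: "\<And>n. integrable gauss_space (F n)" "\<And>n \<omega>. 0 \<le> F n \<omega>"
     "(\<lambda>n. \<integral>\<omega>. F n \<omega> \<partial>gauss_space) \<longlonglongrightarrow> 0"
     "\<forall>\<^sub>F n in sequentially. \<forall>\<omega>. F n \<omega> < 1 \<longrightarrow> P n \<omega>"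
    using assms(1) unfolding whp_def by blast
  obtain G :: "nat \<Rightarrow> sample \<Rightarrow> real" where G: "\<And>n. integrable gauss_space (G n)" "\<And>n \<omega>. 0 \<le> G n \<omega>"
     "(\<lambda>n. \<integral>\<omega>. G n \<omega> \<partial>gauss_space) \<longlonglongrightarrow> 0"
     "\<forall>\<^sub>F n in sequentially. \<forall>\<omega>. G n \<omega> < 1 \<longrightarrow> Q n \<omega>"
    using assms(2) unfolding whp_def by blast
  show ?thesis unfolding whp_def
  proof (intro exI[of _ "\<lambda>n \<omega>. F n \<omega> + G n \<omega>"] conjI allI)
    show "(\<lambda>n. \<integral>\<omega>. F n \<omega> + G n \<omega> \<partial>gauss_space) \<longlonglongrightarrow> 0"
      using tendsto_add[OF F(3) G(3)] by (simp add: F(1) G(1))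
    show "\<forall>\<^sub>F n in sequentially. \<forall>\<omega>. F n \<omega> + G n \<omega> < 1 \<longrightarrow> P n \<omega> \<and> Q n \<omega>"
      using F(4) G(4)
    proof eventually_elim
      case (elim n)
      show ?case
      proof (intro allI impI)
        fix \<omega> assume "F n \<omega> + G n \<omega> < 1"
        with F(2)[of n \<omega>] G(2)[of n \<omega>] have "F n \<omega> < 1" "G n \<omega> < 1" by linarith+
        with elim show "P n \<omega> \<and> Q n \<omega>" by blast
      qed
    qed
  qed (auto intro: F(1,2) G(1,2) add_nonneg_nonneg)
qed

lemma whp_mono:
  assumes "whp P" "\<forall>\<^sub>F n in sequentially. \<forall>\<omega>. P n \<omega> \<longrightarrow> Q n \<omega>"
  shows "whp Q"
proof -
  obtain F :: "nat \<Rightarrow> sample \<Rightarrow> real" where F: "\<And>n. integrable gauss_space (F n)" "\<And>n \<omega>. 0 \<le> F n \<omega>"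
     "(\<lambda>n. \<integral>\<omega>. F n \<omega> \<partial>gauss_space) \<longlonglongrightarrow> 0"
     "\<forall>\<^sub>F n in sequentially. \<forall>\<omega>. F n \<omega> < 1 \<longrightarrow> P n \<omega>"
    using assms(1) unfolding whp_def by blast
  have "\<forall>\<^sub>F n in sequentially. \<forall>\<omega>. F n \<omega> < 1 \<longrightarrow> Q n \<omega>"
    using F(4) assms(2) by eventually_elim blast
  then show ?thesis using F unfolding whp_def by blast
qed

text \<open>Markov's inequality at level 1 bounds the failure probability by the mean of the
  certificate. Measurability of the event is asked for here, once, for the final statement.\<close>

lemma whp_prob_tendsto_1:
  assumes "whp P" and meas: "\<And>n. {\<omega>. P n \<omega>} \<in> sets gauss_space"
  shows "(\<lambda>n. measure gauss_space {\<omega>. P n \<omega>}) \<longlonglongrightarrow> 1"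
proof -
  interpret prob_space gauss_space by (rule prob_space_gauss)
  obtain F :: "nat \<Rightarrow> sample \<Rightarrow> real" where F: "\<And>n. integrable gauss_space (F n)" "\<And>n \<omega>. 0 \<le> F n \<omega>"
     "(\<lambda>n. \<integral>\<omega>. F n \<omega> \<partial>gauss_space) \<longlonglongrightarrow> 0"
     "\<forall>\<^sub>F n in sequentially. \<forall>\<omega>. F n \<omega> < 1 \<longrightarrow> P n \<omega>"
    using assms(1) unfolding whp_def by blast
  have lower: "\<forall>\<^sub>F n in sequentially. 1 - (\<integral>\<omega>. F n \<omega> \<partial>gauss_space) \<le> measure gauss_space {\<omega>. P n \<omega>}"
    using F(4)
  proof eventually_elim
    case (elim n)
    have [measurable]: "F n \<in> borel_measurable gauss_space"
      using F(1) by (rule borel_measurable_integrable)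
    have "measure gauss_space {\<omega>\<in>space gauss_space. 1 \<le> F n \<omega>} \<le> (\<integral>\<omega>. F n \<omega> \<partial>gauss_space) / 1"
      by (rule integral_Markov_inequality_measure[where A="{}"]) (use F in auto)
    moreover have "{\<omega>\<in>space gauss_space. 1 \<le> F n \<omega>} \<in> sets gauss_space"
      by measurable
    then have "measure gauss_space {\<omega>\<in>space gauss_space. \<not> P n \<omega>} \<le>
        measure gauss_space {\<omega>\<in>space gauss_space. 1 \<le> F n \<omega>}"
      by (intro finite_measure_mono) (use elim in \<open>auto intro: leI\<close>)
    moreover have "measure gauss_space {\<omega>\<in>space gauss_space. \<not> P n \<omega>} = 1 - measure gauss_space {\<omega>. P n \<omega>}"
      using prob_neg[of "P n"] meas[of n] by simp
    ultimately show ?case by simp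
  qed
  have lim: "(\<lambda>n. 1 - (\<integral>\<omega>. F n \<omega> \<partial>gauss_space)) \<longlonglongrightarrow> 1"
    using tendsto_diff[OF tendsto_const F(3), of 1] by simp
  have upper: "\<forall>\<^sub>F n in sequentially. measure gauss_space {\<omega>. P n \<omega>} \<le> 1"
    by (simp add: always_eventually)
  show ?thesis
    by (rule tendsto_sandwich[OF lower upper lim tendsto_const])
qed

subsection \<open>Separation in the square lattice\<close>

definition cheb :: "vtx \<Rightarrow> vtx \<Rightarrow> int" where
  "cheb u v = max \<bar>fst u - fst v\<bar> \<bar>snd u - snd v\<bar>"

text \<open>Diagonal steps and \<open>a = b\<close> are allowed. This is the connectivity dual to
  that of \<open>nbr\<close>: cuts for nearest-neighbour paths are connected in this sense.\<close>

definition star_step :: "vtx set \<Rightarrow> vtx \<Rightarrow> vtx \<Rightarrow> bool" where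
  "star_step W a b \<longleftrightarrow> a \<in> W \<and> b \<in> W \<and> cheb a b \<le> 1"

definition nn_step :: "vtx set \<Rightarrow> vtx \<Rightarrow> vtx \<Rightarrow> bool" where
  "nn_step W a b \<longleftrightarrow> a \<in> W \<and> b \<in> W \<and> nbr a b"

definition square :: "int \<Rightarrow> int \<Rightarrow> int \<Rightarrow> vtx set" where
  "square x0 y0 R = {x0..<x0+R} \<times> {y0..<y0+R}"

lemma finite_square [simp]: "finite (square x0 y0 R)"
  by (simp add: square_def)

lemma cheb_less_square: "p \<in> square x0 y0 R \<Longrightarrow> q \<in> square x0 y0 R \<Longrightarrow> cheb p q < R"
  by (auto simp: square_def cheb_def)

lemma cheb_self [simp]: "cheb a a = 0"
  by (simp add: cheb_def)

lemma cheb_commute: "cheb a b = cheb b a"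
  by (simp add: cheb_def abs_minus_commute)

lemma cheb_triangle: "cheb a c \<le> cheb a b + cheb b c"
  unfolding cheb_def by linarith

lemma nbr_sym: "nbr u v \<longleftrightarrow> nbr v u"
  by (simp add: nbr_def abs_minus_commute)

lemma nbr_cheb: "nbr u v \<Longrightarrow> cheb u v \<le> 1"
  unfolding nbr_def cheb_def by linarith

lemma star_step_sym: "star_step W a b \<Longrightarrow> star_step W b a"
  by (simp add: star_step_def cheb_commute)

lemma star_path_sym: "(star_step W)\<^sup>*\<^sup>* a b \<Longrightarrow> (star_step W)\<^sup>*\<^sup>* b a"
  by (induction rule: rtranclp_induct) (auto intro: converse_rtranclp_into_rtranclp star_step_sym)

lemma star_path_mem: "(star_step W)\<^sup>*\<^sup>* a b \<Longrightarrow> a \<in> W \<Longrightarrow> b \<in> W"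
  by (induction rule: rtranclp_induct) (auto simp: star_step_def)

lemma nbr_cases:
  assumes "nbr p q"
  obtains "q = (fst p + 1, snd p)" | "p = (fst q + 1, snd q)"
    | "q = (fst p, snd p + 1)" | "p = (fst q, snd q + 1)"
proof -
  have "\<bar>fst p - fst q\<bar> + \<bar>snd p - snd q\<bar> = 1" using assms by (simp add: nbr_def)
  then have "(fst q = fst p + 1 \<and> snd q = snd p) \<or> (fst p = fst q + 1 \<and> snd p = snd q) \<or>
     (fst q = fst p \<and> snd q = snd p + 1) \<or> (fst p = fst q \<and> snd p = snd q + 1)" by arith
  then show ?thesis using that by (metis prod.collapse)
qed

lemma even_diff_interval:
  fixes g :: "int \<Rightarrow> int"
  assumes "\<And>x. lo \<le> x \<Longrightarrow> x + 1 < hi \<Longrightarrow> even (g (x + 1) - g x)"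
    and "lo \<le> x" "x < hi" "lo \<le> y" "y < hi"
  shows "even (g x - g y)"
proof -
  have base: "x < hi \<longrightarrow> even (g x - g lo)" if "lo \<le> x" for x
    using that
  proof (induction x rule: int_ge_induct)
    case (step i)
    show ?case
    proof
      assume "i + 1 < hi"
      then have "even (g i - g lo)" "even (g (i + 1) - g i)"
        using step assms(1)[of i] by auto
      then have "even ((g i - g lo) + (g (i + 1) - g i))" by (rule dvd_add)
      then show "even (g (i + 1) - g lo)" by simp
    qed
  qed simp
  have "even ((g x - g lo) - (g y - g lo))"
    by (rule dvd_diff) (use base[of x] base[of y] assms in auto)
  then show ?thesis by simp
qed

text \<open>The Poincare lemma modulo 2 on a rectangle: an edge function that sums to an even number
  round every unit square is a gradient. The potential integrates \<open>h\<close> along the bottom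
  row and then \<open>v\<close> up the column; the square condition carries the horizontal identity
  from row to row.\<close>

lemma parity_potential:
  fixes h v :: "int \<Rightarrow> int \<Rightarrow> int"
  assumes sq: "\<And>x y. x0 \<le> x \<Longrightarrow> x + 1 < x1 \<Longrightarrow> y0 \<le> y \<Longrightarrow> y + 1 < y1 \<Longrightarrow>
     even (h x y + v (x + 1) y + h x (y + 1) + v x y)"
  obtains f where
    "\<And>x y. x0 \<le> x \<Longrightarrow> x + 1 < x1 \<Longrightarrow> y0 \<le> y \<Longrightarrow> y < y1 \<Longrightarrow> even (f (x + 1) y - f x y - h x y)"
    "\<And>x y. x0 \<le> x \<Longrightarrow> x < x1 \<Longrightarrow> y0 \<le> y \<Longrightarrow> y + 1 < y1 \<Longrightarrow> even (f x (y + 1) - f x y - v x y)"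
proof -
  define f where "f x y = (\<Sum>i\<in>{x0..<x}. h i y0) + (\<Sum>j\<in>{y0..<y}. v x j)" for x y
  have ins: "{a..<b + 1} = insert b {a..<b}" if "a \<le> b" for a b :: int
    using that by auto
  have vert: "f x (y + 1) - f x y = v x y" if "y0 \<le> y" for x y
    by (simp add: f_def ins that)
  have hor: "y < y1 \<longrightarrow> even (f (x + 1) y - f x y - h x y)" if "x0 \<le> x" "x + 1 < x1" "y0 \<le> y" for x y
    using \<open>y0 \<le> y\<close>
  proof (induction y rule: int_ge_induct)
    case base
    show ?case by (simp add: f_def ins that)
  next
    case (step y)
    show ?case
    proof
      assume y: "y + 1 < y1"
      have "f (x + 1) (y + 1) - f x (y + 1) - h x (y + 1) =
         (f (x + 1) y - f x y - h x y) + (h x y + v (x + 1) y + h x (y + 1) + v x y)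
           - 2 * (v x y + h x (y + 1))"
        using vert[of y x] vert[of y "x + 1"] step.hyps by (simp add: algebra_simps)
      moreover have "even (f (x + 1) y - f x y - h x y)" using step y by simp
      moreover have "even (h x y + v (x + 1) y + h x (y + 1) + v x y)"
        by (rule sq) (use that step y in auto)
      ultimately show "even (f (x + 1) (y + 1) - f x (y + 1) - h x (y + 1))"
        by (metis dvd_add dvd_diff dvd_triv_left)
    qed
  qed
  show ?thesis
    by (rule that[of f]) (use hor vert in auto)
qed

lemma even_diff_path:
  fixes f :: "vtx \<Rightarrow> int"
  assumes "(nn_step A)\<^sup>*\<^sup>* a b"
    and "\<And>p q. p \<in> A \<Longrightarrow> q \<in> A \<Longrightarrow> nbr p q \<Longrightarrow> even (f q - f p)"
  shows "even (f b - f a)"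
  using assms(1)
proof (induction rule: rtranclp_induct)
  case (step y z)
  then have "even (f z - f y)" using assms(2)[of y z] unfolding nn_step_def by blast
  from dvd_add[OF this step.IH] show ?case by simp
qed simp

text \<open>The rows and columns that miss the ball connect everything outside it.\<close>

lemma even_diff_outside_ball:
  fixes f :: "vtx \<Rightarrow> int"
  assumes R: "2 * \<rho> + 2 \<le> R" "0 \<le> \<rho>"
    and step: "\<And>p q. p \<in> square x0 y0 R \<Longrightarrow> q \<in> square x0 y0 R \<Longrightarrow> nbr p q \<Longrightarrow>
      \<rho> < cheb x p \<Longrightarrow> \<rho> < cheb x q \<Longrightarrow> even (f q - f p)"
    and p: "p \<in> square x0 y0 R" "\<rho> < cheb x p" and q: "q \<in> square x0 y0 R" "\<rho> < cheb x q"
  shows "even (f p - f q)"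
proof -
  obtain xs where xs: "x0 \<le> xs" "xs < x0 + R" "\<rho> < \<bar>fst x - xs\<bar>"
  proof (cases "\<rho> < \<bar>fst x - x0\<bar>")
    case True then show ?thesis using that[of x0] R by auto
  next
    case False then show ?thesis using that[of "x0 + R - 1"] R by auto
  qed
  obtain ys where ys: "y0 \<le> ys" "ys < y0 + R" "\<rho> < \<bar>snd x - ys\<bar>"
  proof (cases "\<rho> < \<bar>snd x - y0\<bar>")
    case True then show ?thesis using that[of y0] R by auto
  next
    case False then show ?thesis using that[of "y0 + R - 1"] R by auto
  qed
  have col: "even (f (a, b) - f (a, b'))"
    if "\<rho> < \<bar>fst x - a\<bar>" "x0 \<le> a" "a < x0 + R" "y0 \<le> b" "b < y0 + R" "y0 \<le> b'" "b' < y0 + R" for a b b'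
    by (rule even_diff_interval[where lo = y0 and hi = "y0 + R" and g = "\<lambda>b. f (a, b)"])
       (use that in \<open>auto intro!: step simp: square_def nbr_def cheb_def simp del: even_diff\<close>)
  have row: "even (f (a, b) - f (a', b))"
    if "\<rho> < \<bar>snd x - b\<bar>" "y0 \<le> b" "b < y0 + R" "x0 \<le> a" "a < x0 + R" "x0 \<le> a'" "a' < x0 + R" for a a' b
    by (rule even_diff_interval[where lo = x0 and hi = "x0 + R" and g = "\<lambda>a. f (a, b)"])
       (use that in \<open>auto intro!: step simp: square_def nbr_def cheb_def simp del: even_diff\<close>)
  have main: "even (f p - f (xs, ys))" if "p \<in> square x0 y0 R" "\<rho> < cheb x p" for p
  proof -
    obtain a b where p: "p = (a, b)" by fastforce
    have ab: "x0 \<le> a" "a < x0 + R" "y0 \<le> b" "b < y0 + R"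
      using that(1) by (auto simp: p square_def)
    have "\<rho> < \<bar>fst x - a\<bar> \<or> \<rho> < \<bar>snd x - b\<bar>"
      using that(2) by (simp add: p cheb_def less_max_iff_disj)
    then show ?thesis
    proof
      assume 1: "\<rho> < \<bar>fst x - a\<bar>"
      have "even ((f (a, b) - f (a, ys)) + (f (a, ys) - f (xs, ys)))"
        by (intro dvd_add col row) (use 1 ab xs ys in auto)
      then show ?thesis by (simp add: p)
    next
      assume 2: "\<rho> < \<bar>snd x - b\<bar>"
      have "even ((f (a, b) - f (xs, b)) + (f (xs, b) - f (xs, ys)))"
        by (intro dvd_add col row) (use 2 ab xs ys in auto)
      then show ?thesis by (simp add: p)
    qed
  qed
  have "even ((f p - f (xs, ys)) - (f q - f (xs, ys)))"
    by (rule dvd_diff) (use main p q in auto)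
  then show ?thesis by simp
qed

text \<open>The parity argument: the boundary edges of \<open>D\<close>, sorted by the \<open>*\<close>-component of \<open>G\<close> they
  touch, form cocycles with potentials \<open>f\<close> whose sum is the indicator of \<open>D\<close>.  If all
  \<open>*\<close>-components are small, no potential separates \<open>A\<close> from \<open>B\<close>.\<close>

lemma separating_set_has_large_star_component:
  fixes D :: "vtx set" and \<rho> x0 y0 R :: int
  defines "Q \<equiv> square x0 y0 R"
  assumes GQ: "G \<subseteq> Q"
    and cut: "\<And>p q. p \<in> Q \<Longrightarrow> q \<in> Q \<Longrightarrow> nbr p q \<Longrightarrow> p \<in> D \<Longrightarrow> q \<notin> D \<Longrightarrow> p \<in> G \<or> q \<in> G"
    and A: "A \<subseteq> D" "A \<subseteq> Q" "A \<noteq> {}" "\<And>x y. x \<in> A \<Longrightarrow> y \<in> A \<Longrightarrow> (nn_step A)\<^sup>*\<^sup>* x y"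
    and B: "B \<inter> D = {}" "B \<subseteq> Q" "B \<noteq> {}" "\<And>x y. x \<in> B \<Longrightarrow> y \<in> B \<Longrightarrow> (nn_step B)\<^sup>*\<^sup>* x y"
    and dA: "\<rho> > 0 \<Longrightarrow> \<exists>x\<in>A. \<exists>y\<in>A. 2 * \<rho> + 1 \<le> cheb x y"
    and dB: "\<rho> > 0 \<Longrightarrow> \<exists>x\<in>B. \<exists>y\<in>B. 2 * \<rho> + 1 \<le> cheb x y"
  shows "\<exists>x y. x \<in> G \<and> (star_step G)\<^sup>*\<^sup>* x y \<and> \<rho> \<le> cheb x y"
proof (rule ccontr)
  assume "\<not> ?thesis"
  then have small: "cheb x y < \<rho>" if "x \<in> G" "(star_step G)\<^sup>*\<^sup>* x y" for x y
    using that by (meson not_le)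
  define cls where "cls x = {y. (star_step G)\<^sup>*\<^sup>* x y}" for x
  define C where "C = cls ` G"
  have finG: "finite G" using GQ by (rule finite_subset) (simp add: Q_def)
  then have finC: "finite C" by (simp add: C_def)
  have cls_closed: "z \<in> cls x \<longleftrightarrow> y \<in> cls x" if "y \<in> G" "z \<in> G" "cheb y z \<le> 1" for x y z
    using that unfolding cls_def
    by (auto intro: rtranclp.rtrancl_into_rtrancl simp: star_step_def cheb_commute)
  have cls_uniq: "cls x = cls y" if "y \<in> cls x" for x y
    using that unfolding cls_def by (auto dest: star_path_sym intro: rtranclp_trans)
  define bd where "bd p q \<longleftrightarrow> (p \<in> D) \<noteq> (q \<in> D)" for p q
  \<comment> \<open>Every boundary edge has an endpoint in \<open>G\<close>. If both endpoints lie
    in \<open>G\<close> they are star-adjacent, so the class of the chosen one does not depend on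
    the orientation of the edge.\<close>
  define rep where "rep p q = (if p \<in> G then p else q)" for p q :: vtx
  have repG: "rep p q \<in> G" if "p \<in> Q" "q \<in> Q" "nbr p q" "bd p q" for p q
    using that cut[of p q] cut[of q p] by (auto simp: bd_def rep_def nbr_sym)
  define h where "h \<kappa> x y = (if bd (x, y) (x + 1, y) \<and> rep (x, y) (x + 1, y) \<in> \<kappa> then 1 else 0 :: int)"
    for \<kappa> x y
  define v where "v \<kappa> x y = (if bd (x, y) (x, y + 1) \<and> rep (x, y) (x, y + 1) \<in> \<kappa> then 1 else 0 :: int)"
    for \<kappa> x y
  have sq: "even (h \<kappa> x y + v \<kappa> (x + 1) y + h \<kappa> x (y + 1) + v \<kappa> x y)"
    if \<kappa>: "\<kappa> \<in> C" and xy: "x0 \<le> x" "x + 1 < x0 + R" "y0 \<le> y" "y + 1 < y0 + R" for \<kappa> x y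
  proof -
    obtain z where z: "\<kappa> = cls z" using \<kappa> by (auto simp: C_def)
    define S where "S = {x, x + 1} \<times> {y, y + 1}"
    have SQ: "S \<subseteq> Q" using xy by (auto simp: S_def Q_def square_def)
    \<comment> \<open>Any two vertices of a unit square are star-adjacent, so either all or none of
      its boundary edges are charged to \<kappa>. A closed walk round the square crosses the
      boundary of \<open>D\<close> an even number of times, which gives the cocycle condition in
      both cases.\<close>
    have "\<exists>b. \<forall>p\<in>S. \<forall>q\<in>S. nbr p q \<longrightarrow> bd p q \<longrightarrow> (rep p q \<in> \<kappa>) = b"
    proof (cases "\<exists>p\<in>S. \<exists>q\<in>S. nbr p q \<and> bd p q")
      case True
      then obtain p q where pq: "p \<in> S" "q \<in> S" "nbr p q" "bd p q" by blast
      show ?thesis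
      proof (intro exI[of _ "rep p q \<in> \<kappa>"] ballI impI)
        fix p' q' assume pq': "p' \<in> S" "q' \<in> S" "nbr p' q'" "bd p' q'"
        have "rep p q \<in> S" "rep p' q' \<in> S" using pq pq' by (auto simp: rep_def)
        then have "cheb (rep p q) (rep p' q') \<le> 1" by (auto simp: S_def cheb_def)
        moreover have "rep p q \<in> G" "rep p' q' \<in> G" using pq pq' SQ repG by blast+
        ultimately show "(rep p' q' \<in> \<kappa>) = (rep p q \<in> \<kappa>)" unfolding z using cls_closed by blast
      qed
    qed blast
    then obtain b where "\<forall>p\<in>S. \<forall>q\<in>S. nbr p q \<longrightarrow> bd p q \<longrightarrow> (rep p q \<in> \<kappa>) = b" by (elim exE)
    then have b: "bd p q \<and> rep p q \<in> \<kappa> \<longleftrightarrow> bd p q \<and> b" if "p \<in> S" "q \<in> S" "nbr p q" for p q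
      using that by metis
    have e: "h \<kappa> x y = of_bool (bd (x, y) (x + 1, y) \<and> b)"
       "h \<kappa> x (y + 1) = of_bool (bd (x, y + 1) (x + 1, y + 1) \<and> b)"
       "v \<kappa> x y = of_bool (bd (x, y) (x, y + 1) \<and> b)"
       "v \<kappa> (x + 1) y = of_bool (bd (x + 1, y) (x + 1, y + 1) \<and> b)"
      unfolding h_def v_def by (subst b; simp add: S_def nbr_def)+
    show ?thesis unfolding e bd_def by (cases "(x, y) \<in> D"; cases "(x + 1, y) \<in> D";
        cases "(x, y + 1) \<in> D"; cases "(x + 1, y + 1) \<in> D"; cases b; simp)
  qed
  have "\<forall>\<kappa>\<in>C. \<exists>f. (\<forall>x y. x0 \<le> x \<and> x + 1 < x0 + R \<and> y0 \<le> y \<and> y < y0 + R \<longrightarrow>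
        even (f (x + 1) y - f x y - h \<kappa> x y)) \<and>
      (\<forall>x y. x0 \<le> x \<and> x < x0 + R \<and> y0 \<le> y \<and> y + 1 < y0 + R \<longrightarrow>
        even (f x (y + 1) - f x y - v \<kappa> x y))"
  proof
    fix \<kappa> assume \<kappa>: "\<kappa> \<in> C"
    show "\<exists>f. (\<forall>x y. x0 \<le> x \<and> x + 1 < x0 + R \<and> y0 \<le> y \<and> y < y0 + R \<longrightarrow>
        even (f (x + 1) y - f x y - h \<kappa> x y)) \<and>
      (\<forall>x y. x0 \<le> x \<and> x < x0 + R \<and> y0 \<le> y \<and> y + 1 < y0 + R \<longrightarrow>
        even (f x (y + 1) - f x y - v \<kappa> x y))"
    proof (rule parity_potential[of x0 "x0 + R" y0 "y0 + R" "h \<kappa>" "v \<kappa>"], rule sq[OF \<kappa>], assumption+)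
      fix f
      assume 1: "\<And>x y. x0 \<le> x \<Longrightarrow> x + 1 < x0 + R \<Longrightarrow> y0 \<le> y \<Longrightarrow> y < y0 + R \<Longrightarrow>
          even (f (x + 1) y - f x y - h \<kappa> x y)"
        and 2: "\<And>x y. x0 \<le> x \<Longrightarrow> x < x0 + R \<Longrightarrow> y0 \<le> y \<Longrightarrow> y + 1 < y0 + R \<Longrightarrow>
          even (f x (y + 1) - f x y - v \<kappa> x y)"
      show ?thesis by (rule exI[of _ f]) (intro conjI allI impI 1 2; simp)
    qed
  qed
  from bchoice[OF this] obtain F where
    Fh: "\<And>\<kappa> x y. \<kappa> \<in> C \<Longrightarrow> x0 \<le> x \<Longrightarrow> x + 1 < x0 + R \<Longrightarrow> y0 \<le> y \<Longrightarrow> y < y0 + R \<Longrightarrow>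
        even (F \<kappa> (x + 1) y - F \<kappa> x y - h \<kappa> x y)"
    and Fv: "\<And>\<kappa> x y. \<kappa> \<in> C \<Longrightarrow> x0 \<le> x \<Longrightarrow> x < x0 + R \<Longrightarrow> y0 \<le> y \<Longrightarrow> y + 1 < y0 + R \<Longrightarrow>
        even (F \<kappa> x (y + 1) - F \<kappa> x y - v \<kappa> x y)"
    by blast
  define f where "f \<kappa> p = F \<kappa> (fst p) (snd p)" for \<kappa> p
  have even_sub: "even (b - a)" if "even (a - b)" for a b :: int using that by simp
  have edge0: "even (f \<kappa> q - f \<kappa> p)"
    if "\<kappa> \<in> C" "p \<in> Q" "q \<in> Q" "nbr p q"
      and no: "bd p q \<Longrightarrow> rep p q \<notin> \<kappa>" "bd q p \<Longrightarrow> rep q p \<notin> \<kappa>" for \<kappa> p q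
    using \<open>nbr p q\<close>
  proof (cases rule: nbr_cases)
    case 1
    then show ?thesis using Fh[of \<kappa> "fst p" "snd p"] that
      by (simp add: f_def h_def Q_def square_def mem_Times_iff)
  next
    case 2
    then have "even (f \<kappa> p - f \<kappa> q)" using Fh[of \<kappa> "fst q" "snd q"] that
      by (simp add: f_def h_def Q_def square_def mem_Times_iff)
    then show ?thesis by (rule even_sub)
  next
    case 3
    then show ?thesis using Fv[of \<kappa> "fst p" "snd p"] that
      by (simp add: f_def v_def Q_def square_def mem_Times_iff)
  next
    case 4
    then have "even (f \<kappa> p - f \<kappa> q)" using Fv[of \<kappa> "fst q" "snd q"] that
      by (simp add: f_def v_def Q_def square_def mem_Times_iff)
    then show ?thesis by (rule even_sub)
  qed
  have ind: "(\<Sum>\<kappa>\<in>C. if P \<and> r \<in> \<kappa> then 1 else 0 :: int) = (if P then 1 else 0)" if "P \<Longrightarrow> r \<in> G" for P r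
  proof (cases P)
    case True
    have "(\<Sum>\<kappa>\<in>C. if P \<and> r \<in> \<kappa> then 1 else 0 :: int) = (\<Sum>\<kappa>\<in>C. if \<kappa> = cls r then 1 else 0)"
    proof (rule sum.cong[OF refl])
      fix \<kappa> assume "\<kappa> \<in> C"
      then obtain z where z: "\<kappa> = cls z" by (auto simp: C_def)
      have "r \<in> cls z \<longleftrightarrow> cls z = cls r"
        using cls_uniq[of r z] by (auto simp: cls_def)
      then show "(if P \<and> r \<in> \<kappa> then 1 else 0 :: int) = (if \<kappa> = cls r then 1 else 0)"
        using True by (simp add: z)
    qed
    also have "\<dots> = 1" using finC that True by (simp add: C_def)
    finally show ?thesis using True by simp
  qed simp
  \<comment> \<open>Each boundary edge is charged to exactly one class, so the sum of the potentials
    jumps where the indicator of \<open>D\<close> does, and \<open>g\<close> is constant modulo 2 on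
    \<open>Q\<close>. As \<open>a \<in> D\<close> and \<open>b \<notin> D\<close>, some potential
    would have to differ in parity at \<open>a\<close> and \<open>b\<close>.\<close>
  define g where "g p = of_bool (p \<in> D) - (\<Sum>\<kappa>\<in>C. f \<kappa> p)" for p
  have gh: "even (g (x + 1, y) - g (x, y))"
    if xy: "x0 \<le> x" "x + 1 < x0 + R" "y0 \<le> y" "y < y0 + R" for x y
  proof -
    have "even (\<Sum>\<kappa>\<in>C. f \<kappa> (x + 1, y) - f \<kappa> (x, y) - h \<kappa> x y)"
      by (rule dvd_sum) (use Fh xy in \<open>simp add: f_def\<close>)
    moreover have "(\<Sum>\<kappa>\<in>C. h \<kappa> x y) = (if bd (x, y) (x + 1, y) then 1 else 0)"
      unfolding h_def by (rule ind, rule repG) (use xy in \<open>auto simp: Q_def square_def nbr_def\<close>)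
    ultimately show ?thesis by (auto simp: g_def sum_subtractf bd_def split: if_splits)
  qed
  have gv: "even (g (x, y + 1) - g (x, y))"
    if xy: "x0 \<le> x" "x < x0 + R" "y0 \<le> y" "y + 1 < y0 + R" for x y
  proof -
    have "even (\<Sum>\<kappa>\<in>C. f \<kappa> (x, y + 1) - f \<kappa> (x, y) - v \<kappa> x y)"
      by (rule dvd_sum) (use Fv xy in \<open>simp add: f_def\<close>)
    moreover have "(\<Sum>\<kappa>\<in>C. v \<kappa> x y) = (if bd (x, y) (x, y + 1) then 1 else 0)"
      unfolding v_def by (rule ind, rule repG) (use xy in \<open>auto simp: Q_def square_def nbr_def\<close>)
    ultimately show ?thesis by (auto simp: g_def sum_subtractf bd_def split: if_splits)
  qed
  obtain a where a: "a \<in> A" using A(3) by blast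
  obtain b where b: "b \<in> B" using B(3) by blast
  have g_ab: "even (g a - g b)"
  proof -
    have ab: "x0 \<le> fst a" "fst a < x0 + R" "y0 \<le> snd a" "snd a < y0 + R"
       "x0 \<le> fst b" "fst b < x0 + R" "y0 \<le> snd b" "snd b < y0 + R"
      using a b A(2) B(2) by (auto simp: Q_def square_def)
    have "even (g (fst a, snd a) - g (fst b, snd a))"
      by (rule even_diff_interval[where lo = x0 and hi = "x0 + R" and g = "\<lambda>x. g (x, snd a)"])
         (use ab gh in auto)
    moreover have "even (g (fst b, snd a) - g (fst b, snd b))"
      by (rule even_diff_interval[where lo = y0 and hi = "y0 + R" and g = "\<lambda>y. g (fst b, y)"])
         (use ab gv in auto)
    ultimately have "even ((g (fst a, snd a) - g (fst b, snd a)) + (g (fst b, snd a) - g (fst b, snd b)))"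
      by (rule dvd_add)
    then show ?thesis by simp
  qed
  \<comment> \<open>The class \<kappa> lies in a ball about \<open>x\<close>. Both \<open>A\<close>
    and \<open>B\<close> are too wide for that ball and have a point outside it; these two points
    are joined outside the ball, where no edge is charged to \<kappa>. Inside \<open>A\<close> and
    inside \<open>B\<close> there is no boundary edge of \<open>D\<close> at all.\<close>
  have f_ab: "even (f \<kappa> a - f \<kappa> b)" if \<kappa>: "\<kappa> \<in> C" for \<kappa>
  proof -
    obtain x where x: "x \<in> G" "\<kappa> = cls x" using \<kappa> by (auto simp: C_def)
    \<comment> \<open>The trivial path at \<open>x\<close> gives \<rho> > 0, which \<open>dA\<close>
      and \<open>dB\<close> presuppose. For \<rho> \<le> 0 a single vertex of \<open>G\<close> would
      already be a large component.\<close>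
    have \<rho>: "\<rho> > 0" using small[OF x(1), of x] by simp
    have near: "cheb x y < \<rho>" if "y \<in> \<kappa>" for y
      using small[OF x(1)] that x(2) by (simp add: cls_def)
    obtain a1 a2 where a12: "a1 \<in> A" "a2 \<in> A" "2 * \<rho> + 1 \<le> cheb a1 a2" using dA[OF \<rho>] by blast
    have "cheb a1 a2 < R"
      by (rule cheb_less_square[of _ x0 y0]) (use a12 A(2) in \<open>auto simp: Q_def\<close>)
    then have R: "2 * \<rho> + 2 \<le> R" using a12(3) by simp
    have far: "\<rho> < cheb x y1 \<or> \<rho> < cheb x y2" if "2 * \<rho> + 1 \<le> cheb y1 y2" for y1 y2
      using cheb_triangle[of y1 y2 x] that by (auto simp: cheb_commute)
    obtain a' where a': "a' \<in> A" "\<rho> < cheb x a'" using far[OF a12(3)] a12 by blast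
    obtain b' where b': "b' \<in> B" "\<rho> < cheb x b'" using dB[OF \<rho>] far by blast
    have "even (f \<kappa> a' - f \<kappa> b')"
    proof (rule even_diff_outside_ball[where x = x and \<rho> = \<rho> and R = R and ?x0.0 = x0 and ?y0.0 = y0])
      fix p q assume pq: "p \<in> square x0 y0 R" "q \<in> square x0 y0 R" "nbr p q" "\<rho> < cheb x p" "\<rho> < cheb x q"
      then have "p \<notin> \<kappa>" "q \<notin> \<kappa>" using near[of p] near[of q] by auto
      then show "even (f \<kappa> q - f \<kappa> p)"
        using pq \<kappa> by (intro edge0) (auto simp: Q_def rep_def)
    qed (use R \<rho> a' b' A(2) B(2) in \<open>auto simp: Q_def\<close>)
    moreover have "even (f \<kappa> a' - f \<kappa> a)"
      by (rule even_diff_path[OF A(4)[OF a a'(1)]])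
        (rule edge0, use A(1,2) \<kappa> in \<open>auto simp: bd_def\<close>)
    moreover have "even (f \<kappa> b' - f \<kappa> b)"
      by (rule even_diff_path[OF B(4)[OF b b'(1)]])
        (rule edge0, use B(1,2) \<kappa> in \<open>auto simp: bd_def\<close>)
    ultimately show ?thesis by presburger
  qed
  have "even (\<Sum>\<kappa>\<in>C. f \<kappa> a - f \<kappa> b)" by (rule dvd_sum) (rule f_ab)
  moreover have "a \<in> D" "b \<notin> D" using a b A(1) B(1) by auto
  ultimately show False using g_ab by (simp add: g_def sum_subtractf)
qed

subsection \<open>Weighted paths and the length-area argument\<close>

text \<open>The cost sums the weights of all vertices on the walk, both ends included; hence the
  correction by \<open>w x\<close> when two walks are glued at \<open>x\<close>.\<close>

inductive wreach :: "vtx set \<Rightarrow> (vtx \<Rightarrow> real) \<Rightarrow> vtx \<Rightarrow> vtx \<Rightarrow> real \<Rightarrow> bool"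
  for Q w a where
  base: "a \<in> Q \<Longrightarrow> wreach Q w a a (w a)"
| step: "wreach Q w a x c \<Longrightarrow> y \<in> Q \<Longrightarrow> nbr x y \<Longrightarrow> wreach Q w a y (c + w y)"

lemma wreach_mem: "wreach Q w a x c \<Longrightarrow> a \<in> Q \<and> x \<in> Q"
  by (induction rule: wreach.induct) auto

lemma wreach_mono: "wreach Q w a x c \<Longrightarrow> Q \<subseteq> Q' \<Longrightarrow> wreach Q' w a x c"
  by (induction rule: wreach.induct) (auto intro: wreach.intros)

lemma wreach_ge:
  assumes "wreach Q w a x c" "\<And>x. x \<in> Q \<Longrightarrow> 0 < w x"
  shows "w x \<le> c"
  using assms(1)
proof (induction rule: wreach.induct)
  case (step x c y)
  then have "0 < w x" using assms(2) wreach_mem by blast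
  with step show ?case by simp
qed simp

lemma wreach_trans:
  assumes "wreach Q w a x c" "wreach Q w x y c'"
  shows "wreach Q w a y (c + c' - w x)"
  using assms(2)
proof (induction rule: wreach.induct)
  case base
  then show ?case using assms(1) by simp
next
  case (step y c' z)
  then have "wreach Q w a z (c + c' - w x + w z)" by (intro wreach.step)
  then show ?case by (simp add: algebra_simps)
qed

lemma wreach_sym: "wreach Q w a x c \<Longrightarrow> wreach Q w x a c"
proof (induction rule: wreach.induct)
  case base
  then show ?case by (rule wreach.base)
next
  case (step x c y)
  have "wreach Q w y x (w y + w x)"
    by (rule wreach.step[OF wreach.base]) (use step wreach_mem nbr_sym in \<open>blast+\<close>)
  from wreach_trans[OF this step.IH] show ?case by (simp add: add.commute)
qed

definition wball :: "vtx set \<Rightarrow> (vtx \<Rightarrow> real) \<Rightarrow> vtx \<Rightarrow> real \<Rightarrow> vtx set" where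
  "wball Q w a C = {x. \<exists>c\<le>C. wreach Q w a x c}"

lemma nn_path_sym: "(nn_step W)\<^sup>*\<^sup>* a b \<Longrightarrow> (nn_step W)\<^sup>*\<^sup>* b a"
  by (induction rule: rtranclp_induct)
    (auto intro: converse_rtranclp_into_rtranclp simp: nn_step_def nbr_sym)

text \<open>Weights are positive, so every initial segment of an admissible walk is admissible: the
  walk from the centre to a point of the ball stays in the ball.\<close>

lemma wball_connected:
  assumes "\<And>x. x \<in> Q \<Longrightarrow> 0 < w x" "x \<in> wball Q w a C" "y \<in> wball Q w a C"
  shows "(nn_step (wball Q w a C))\<^sup>*\<^sup>* x y"
proof -
  have main: "c \<le> C \<longrightarrow> (nn_step (wball Q w a C))\<^sup>*\<^sup>* a x" if "wreach Q w a x c" for x c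
    using that
  proof (induction rule: wreach.induct)
    case (step x c y)
    show ?case
    proof
      assume C: "c + w y \<le> C"
      moreover have "0 < w y" using step assms(1) by blast
      ultimately have "c \<le> C" by simp
      then have "(nn_step (wball Q w a C))\<^sup>*\<^sup>* a x" using step.IH by blast
      moreover have "nn_step (wball Q w a C) x y"
        unfolding nn_step_def wball_def mem_Collect_eq
        using step.hyps C \<open>c \<le> C\<close> wreach.step[OF step.hyps] by blast
      ultimately show "(nn_step (wball Q w a C))\<^sup>*\<^sup>* a y" by (rule rtranclp.rtrancl_into_rtrancl)
    qed
  qed simp
  obtain c c' where "c \<le> C" "wreach Q w a x c" "c' \<le> C" "wreach Q w a y c'"
    using assms(2,3) unfolding wball_def by blast
  then have "(nn_step (wball Q w a C))\<^sup>*\<^sup>* a x" "(nn_step (wball Q w a C))\<^sup>*\<^sup>* a y"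
    using main by blast+
  then show ?thesis by (meson nn_path_sym rtranclp_trans)
qed

text \<open>Length-area argument: the level sets of the distance from \<open>A\<close> are cuts, so their
  \<open>g\<close>-mass is at least \<open>L\<close>; integrating over the level gives at most the \<open>g\<close>-mass weighted by \<open>w\<close>.\<close>

lemma connecting_path:
  fixes \<rho> x0 y0 R :: int and L T :: real
  defines "Q \<equiv> square x0 y0 R"
  assumes w: "\<And>x. x \<in> Q \<Longrightarrow> 0 < w x" and g: "\<And>x. x \<in> Q \<Longrightarrow> 0 \<le> g x"
    and A: "A \<subseteq> Q" "A \<noteq> {}" "\<And>x y. x \<in> A \<Longrightarrow> y \<in> A \<Longrightarrow> (nn_step A)\<^sup>*\<^sup>* x y"
    and B: "B \<subseteq> Q" "B \<noteq> {}" "\<And>x y. x \<in> B \<Longrightarrow> y \<in> B \<Longrightarrow> (nn_step B)\<^sup>*\<^sup>* x y"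
    and dA: "\<rho> > 0 \<Longrightarrow> \<exists>x\<in>A. \<exists>y\<in>A. 2 * \<rho> + 1 \<le> cheb x y"
    and dB: "\<rho> > 0 \<Longrightarrow> \<exists>x\<in>B. \<exists>y\<in>B. 2 * \<rho> + 1 \<le> cheb x y"
    and L: "\<And>G x y. G \<subseteq> Q \<Longrightarrow> x \<in> G \<Longrightarrow> (star_step G)\<^sup>*\<^sup>* x y \<Longrightarrow> \<rho> \<le> cheb x y \<Longrightarrow> L \<le> (\<Sum>x\<in>G. g x)"
    and T: "0 < T" "(\<Sum>x\<in>Q. g x * w x) < T * L"
  shows "A \<inter> B \<noteq> {} \<or> (\<exists>a\<in>A. \<exists>b\<in>B. \<exists>c\<le>T. wreach Q w a b c)"
proof (rule ccontr)
  assume neg: "\<not> ?thesis"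
  \<comment> \<open>Inserting \<open>T\<close> truncates the distance from \<open>A\<close> at
    \<open>T\<close> and keeps the set nonempty at vertices that are not reached, where a real
    infimum would be unspecified.\<close>
  define S where "S x = insert T {c. \<exists>a\<in>A. wreach Q w a x c}" for x
  define D where "D x = Inf (S x)" for x
  have finQ: "finite Q" by (simp add: Q_def)
  have S_nonneg: "0 \<le> c" if "c \<in> S x" for c x
  proof (cases "c = T")
    case True
    then show ?thesis using T(1) by simp
  next
    case False
    then obtain a where a: "wreach Q w a x c"
      using \<open>c \<in> S x\<close> unfolding S_def by blast
    have "w x \<le> c" by (rule wreach_ge[OF a]) (rule w)
    moreover have "0 < w x" by (rule w) (use wreach_mem[OF a] in blast)
    ultimately show ?thesis by simp
  qed
  have bdd: "bdd_below (S x)" for x using S_nonneg by (rule bdd_belowI)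
  have ne: "S x \<noteq> {}" for x by (simp add: S_def)
  have D_T: "D x \<le> T" for x unfolding D_def by (rule cInf_lower[OF _ bdd]) (simp add: S_def)
  have D_A: "D a \<le> w a" if "a \<in> A" for a
    unfolding D_def by (rule cInf_lower[OF _ bdd]) (use that A(1) in \<open>auto simp: S_def intro: wreach.base\<close>)
  have D_step: "D q \<le> D p + w q" if "p \<in> Q" "q \<in> Q" "nbr p q" for p q
  proof -
    have "D q - w q \<le> D p" unfolding D_def[of p]
    proof (rule cInf_greatest[OF ne])
      fix c assume "c \<in> S p"
      then consider "c = T" | a where "a \<in> A" "wreach Q w a p c" by (auto simp: S_def)
      then show "D q - w q \<le> c"
      proof cases
        case 1
        then show ?thesis using D_T[of q] w[OF that(2)] by simp
      next
        case 2
        then have "c + w q \<in> S q" using wreach.step[OF 2(2) that(2,3)] by (auto simp: S_def)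
        then have "D q \<le> c + w q" unfolding D_def by (rule cInf_lower[OF _ bdd])
        then show ?thesis by simp
      qed
    qed
    then show ?thesis by simp
  qed
  \<comment> \<open>A vertex occupies the levels between \<open>D x - w x\<close> and
    \<open>D x\<close>, an interval of length \<open>w x\<close>; this is how its weight appears
    when the level is integrated out.\<close>
  define G where "G t = {x \<in> Q. D x - w x < t \<and> t \<le> D x}" for t
  have GL: "L \<le> (\<Sum>x\<in>G t. g x)" if t: "0 < t" "t \<le> T" for t
  proof -
    \<comment> \<open>\<open>A\<close> is added by hand, since a heavy vertex of \<open>A\<close>
      may have \<open>D \<ge> t\<close>. Such a vertex lies in \<open>G t\<close>, because its
      distance is at most its own weight.\<close>
    define E where "E = A \<union> {x \<in> Q. D x < t}"
    have "\<exists>x y. x \<in> G t \<and> (star_step (G t))\<^sup>*\<^sup>* x y \<and> \<rho> \<le> cheb x y"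
    proof (rule separating_set_has_large_star_component[of "G t" x0 y0 R E A B \<rho>])
      show "G t \<subseteq> square x0 y0 R" by (auto simp: G_def Q_def)
      show "p \<in> G t \<or> q \<in> G t"
        if pq: "p \<in> square x0 y0 R" "q \<in> square x0 y0 R" "nbr p q" "p \<in> E" "q \<notin> E" for p q
      proof (cases "D p < t")
        case True
        then have "D q - w q < t" using D_step[of p q] pq by (simp add: Q_def)
        moreover have "t \<le> D q" using pq by (auto simp: E_def Q_def)
        ultimately show ?thesis using pq by (auto simp: G_def Q_def)
      next
        case False
        then have "p \<in> A" using pq by (auto simp: E_def)
        then have "D p - w p < t" using D_A[of p] t by simp
        then show ?thesis using False pq by (auto simp: G_def Q_def)
      qed
      show "B \<inter> E = {}"
      proof (rule ccontr)
        assume "B \<inter> E \<noteq> {}"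
        then obtain b where b: "b \<in> B" "b \<in> E" by blast
        then have "D b < t" using neg by (auto simp: E_def)
        then obtain c where c: "c \<in> S b" "c < t" unfolding D_def
          by (subst (asm) cInf_less_iff[OF ne bdd]) blast
        then have "\<exists>a\<in>A. wreach Q w a b c" using t by (auto simp: S_def)
        moreover have "c \<le> T" using c t by simp
        ultimately show False using neg b by blast
      qed
    qed (use A B dA dB in \<open>auto simp: E_def Q_def\<close>)
    then show ?thesis using L[of "G t"] by (auto simp: G_def)
  qed
  have ind: "integrable lborel (\<lambda>t. indicator {a<..b} t :: real)" for a b :: real
    by (cases "a \<le> b") (auto intro!: integrable_real_indicator)
  have "T * L = (\<integral>t. L * indicator {0<..T} t \<partial>lborel)"
    using T(1) by simp
  also have "\<dots> \<le> (\<integral>t. (\<Sum>x\<in>Q. g x * indicator {D x - w x<..D x} t) \<partial>lborel)"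
  proof (rule integral_mono)
    fix t :: real
    have "(\<Sum>x\<in>Q. g x * indicator {D x - w x<..D x} t) = (\<Sum>x\<in>G t. g x)"
      unfolding G_def sum.inter_filter[OF finQ]
      by (rule sum.cong[OF refl]) (auto simp: indicator_def)
    moreover have "0 \<le> (\<Sum>x\<in>G t. g x)" by (rule sum_nonneg) (use g in \<open>auto simp: G_def\<close>)
    ultimately show "L * indicator {0<..T} t \<le> (\<Sum>x\<in>Q. g x * indicator {D x - w x<..D x} t)"
      using GL[of t] by (auto simp: indicator_def)
  qed (auto intro!: Bochner_Integration.integrable_sum integrable_mult_right ind)
  also have "\<dots> = (\<Sum>x\<in>Q. g x * w x)"
  proof -
    have "(\<integral>t. (\<Sum>x\<in>Q. g x * indicator {D x - w x<..D x} t) \<partial>lborel) =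
      (\<Sum>x\<in>Q. \<integral>t. g x * indicator {D x - w x<..D x} t \<partial>lborel)"
      by (rule Bochner_Integration.integral_sum) (intro integrable_mult_right ind)
    also have "\<dots> = (\<Sum>x\<in>Q. g x * w x)"
      by (rule sum.cong[OF refl]) (use w in \<open>simp add: less_imp_le\<close>)
    finally show ?thesis .
  qed
  finally show False using T(2) by simp
qed

lemma wreach_imp_path:
  assumes "wreach (VN n) w u v c"
  shows "\<exists>P. is_path n P u v \<and> (\<Sum>x\<leftarrow>P. w x) = c"
  using assms
proof (induction rule: wreach.induct)
  case base
  then show ?case by (intro exI[of _ "[u]"]) (simp add: is_path_def)
next
  case (step x c y)
  then obtain P where P: "is_path n P u x" "(\<Sum>x\<leftarrow>P. w x) = c" by blast
  have "is_path n (P @ [y]) u y" unfolding is_path_def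
  proof (intro conjI allI impI)
    fix i assume i: "Suc i < length (P @ [y])"
    show "nbr ((P @ [y]) ! i) ((P @ [y]) ! Suc i)"
    proof (cases "Suc i < length P")
      case True
      then show ?thesis using P(1) by (simp add: is_path_def nth_append)
    next
      case False
      then have "i = length P - 1" "P \<noteq> []" using i P(1) by (auto simp: is_path_def)
      then show ?thesis using P(1) step.hyps(3) by (simp add: nth_append is_path_def last_conv_nth)
    qed
  qed (use P(1) step.hyps in \<open>auto simp: is_path_def\<close>)
  then show ?case using P(2) by (intro exI[of _ "P @ [y]"]) simp
qed

lemma path_imp_star_path:
  assumes "is_path n P u v"
  shows "u \<in> set P" "(star_step (set P))\<^sup>*\<^sup>* u v" "set P \<subseteq> VN n"
proof -
  have P: "P \<noteq> []" "hd P = u" "last P = v" "set P \<subseteq> VN n"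
    "\<And>i. Suc i < length P \<Longrightarrow> nbr (P ! i) (P ! Suc i)"
    using assms by (auto simp: is_path_def)
  have "i < length P \<longrightarrow> (star_step (set P))\<^sup>*\<^sup>* (P ! 0) (P ! i)" for i
  proof (induction i)
    case (Suc i)
    show ?case
    proof
      assume i: "Suc i < length P"
      have "star_step (set P) (P ! i) (P ! Suc i)"
        using i P(5)[OF i] by (auto simp: star_step_def nbr_cheb)
      with Suc i show "(star_step (set P))\<^sup>*\<^sup>* (P ! 0) (P ! Suc i)"
        by (auto intro: rtranclp.rtrancl_into_rtrancl)
    qed
  qed simp
  from this[of "length P - 1"] P show "(star_step (set P))\<^sup>*\<^sup>* u v"
    by (simp add: hd_conv_nth last_conv_nth)
  show "u \<in> set P" "set P \<subseteq> VN n" using P by (auto simp: hd_in_set)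
qed

lemma fpp_dist_le:
  assumes "wreach (VN n) (\<lambda>x. exp (\<gamma> * phi k n \<omega> x)) u v c"
  shows "fpp_dist \<gamma> k n \<omega> u v \<le> c"
proof -
  obtain P where "is_path n P u v" "(\<Sum>x\<leftarrow>P. exp (\<gamma> * phi k n \<omega> x)) = c"
    using wreach_imp_path[OF assms] by blast
  then show ?thesis unfolding fpp_dist_def
    by (intro cInf_lower bdd_belowI[of _ 0]) (auto intro!: sum_list_nonneg)
qed

text \<open>The walk in the first assumption shows that the infimum is not over the empty set. A
  path may revisit vertices, so its cost is at least the sum over its vertex set, to which bounds
  for star-connected sets apply.\<close>

lemma fpp_dist_ge:
  assumes "wreach (VN n) w u v c'"
    and "\<And>P. set P \<subseteq> VN n \<Longrightarrow> u \<in> set P \<Longrightarrow> (star_step (set P))\<^sup>*\<^sup>* u v \<Longrightarrow>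
      c \<le> (\<Sum>x\<in>set P. exp (\<gamma> * phi k n \<omega> x))"
  shows "c \<le> fpp_dist \<gamma> k n \<omega> u v"
proof -
  obtain P0 where P0: "is_path n P0 u v" using wreach_imp_path[OF assms(1)] by blast
  show ?thesis unfolding fpp_dist_def
  proof (rule cInf_greatest)
    fix y assume "y \<in> {\<Sum>w\<leftarrow>P. exp (\<gamma> * phi k n \<omega> w) |P. is_path n P u v}"
    then obtain P where P: "is_path n P u v" "y = (\<Sum>w\<leftarrow>P. exp (\<gamma> * phi k n \<omega> w))" by blast
    have "c \<le> (\<Sum>x\<in>set P. exp (\<gamma> * phi k n \<omega> x))"
      using path_imp_star_path[OF P(1)] by (intro assms(2))
    also have "\<dots> = (\<Sum>x\<leftarrow>remdups P. exp (\<gamma> * phi k n \<omega> x))"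
      by (simp add: sum_list_distinct_conv_sum_set)
    also have "\<dots> \<le> y" unfolding P(2)
    proof (induction P)
      case (Cons a P)
      have "0 < exp (\<gamma> * phi k n \<omega> a)" by simp
      with Cons show ?case by (simp del: exp_gt_zero)
    qed simp
    finally show "c \<le> y" .
  qed (use P0 in blast)
qed

subsection \<open>Covariances of the field\<close>

definition psic :: "nat \<Rightarrow> nat \<Rightarrow> vtx \<Rightarrow> nat \<times> int \<times> int \<Rightarrow> real" where
  "psic k j z i = (if fst i = j * k \<and> snd i \<in> boxes_containing (j * k) z then sqrt (real k) else 0)"

definition noise_supp :: "nat \<Rightarrow> nat \<Rightarrow> vtx \<Rightarrow> (nat \<times> int \<times> int) set" where
  "noise_supp k j z = {j * k} \<times> boxes_containing (j * k) z"

text \<open>The correlation of two fields of one level. The index is the exponent of the box side,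
  so the fields \<open>psi\<close> of level \<open>j\<close> have correlation
  \<open>ovl (j * k)\<close>.\<close>

definition ovl :: "nat \<Rightarrow> vtx \<Rightarrow> vtx \<Rightarrow> real" where
  "ovl j u v = real (card (boxes_containing j u \<inter> boxes_containing j v)) / 4 ^ j"

definition pphi :: "nat \<Rightarrow> nat \<Rightarrow> nat \<Rightarrow> sample \<Rightarrow> vtx \<Rightarrow> real" where
  "pphi k a b \<omega> z = (\<Sum>j\<in>{a..<b}. psi k \<omega> j z)"

lemma boxes_eq:
  "boxes_containing j z = {fst z - 2^j + 1..fst z} \<times> {snd z - 2^j + 1..snd z}"
  by (auto simp: boxes_containing_def)

lemma finite_boxes [simp]: "finite (boxes_containing j z)"
  by (simp add: boxes_eq)

lemma card_boxes: "card (boxes_containing j z) = 4 ^ j"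
  by (simp add: boxes_eq card_cartesian_product nat_power_eq flip: power_mult_distrib)

lemma finite_noise_supp [simp]: "finite (noise_supp k j z)"
  by (simp add: noise_supp_def)

lemma psi_eq_lin:
  assumes "finite I" "noise_supp k j z \<subseteq> I"
  shows "psi k \<omega> j z = lin I (psic k j z) \<omega>"
proof -
  have "lin I (psic k j z) \<omega> = (\<Sum>i\<in>noise_supp k j z. psic k j z i * \<omega> i)"
    unfolding lin_def by (rule sum.mono_neutral_right) (use assms in \<open>auto simp: psic_def noise_supp_def\<close>)
  also have "\<dots> = (\<Sum>i\<in>noise_supp k j z. sqrt (real k) * \<omega> i)"
    by (rule sum.cong[OF refl]) (auto simp: psic_def noise_supp_def)
  also have "\<dots> = (\<Sum>x\<in>boxes_containing (j*k) z. sqrt (real k) * \<omega> (j * k, x))"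
    unfolding noise_supp_def by (rule sum.reindex_bij_witness[of _ "\<lambda>x. (j * k, x)" snd]) auto
  finally show ?thesis by (simp add: psi_def)
qed

lemma ovl_nonneg: "0 \<le> ovl j u v"
  by (simp add: ovl_def)

lemma ovl_self: "ovl j u u = 1"
  by (simp add: ovl_def card_boxes)

lemma ovl_le_1: "ovl j u v \<le> 1"
proof -
  have "card (boxes_containing j u \<inter> boxes_containing j v) \<le> 4 ^ j"
    by (metis Int_lower1 card_boxes card_mono finite_boxes)
  then have "real (card (boxes_containing j u \<inter> boxes_containing j v)) \<le> 4 ^ j"
    by (metis of_nat_le_iff of_nat_numeral of_nat_power)
  then show ?thesis by (simp add: ovl_def)
qed

lemma boxes_disjoint:
  assumes "2 ^ j \<le> cheb u v"
  shows "boxes_containing j u \<inter> boxes_containing j v = {}"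
  using assms unfolding boxes_eq cheb_def by (auto simp: abs_if split: if_splits)

lemma ovl_far: "2 ^ j \<le> cheb u v \<Longrightarrow> ovl j u v = 0"
  by (simp add: ovl_def boxes_disjoint)

text \<open>With R = 2^j and coordinate differences a, b below R, the common boxes form a rectangle
  with sides R - a and R - b, and (R - a)(R - b) is at least R^2 - 2 R max(a, b). From distance 2^j
  on the right-hand side is at least 2.\<close>

lemma ovl_near: "1 - ovl j u v \<le> 2 * real_of_int (cheb u v) / 2 ^ j"
proof (cases "2 ^ j \<le> cheb u v")
  case True
  then have "(2::real) ^ j \<le> real_of_int (cheb u v)"
    by (metis of_int_le_iff of_int_numeral of_int_power)
  moreover have "0 \<le> (2::real) ^ j" by simp
  ultimately have "(2::real) ^ j \<le> 2 * real_of_int (cheb u v)" by linarith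
  then show ?thesis using ovl_far[OF True] by (simp add: field_simps)
next
  case False
  define R :: int where "R = 2 ^ j"
  define a where "a = \<bar>fst u - fst v\<bar>"
  define b where "b = \<bar>snd u - snd v\<bar>"
  have ab: "0 \<le> a" "a < R" "0 \<le> b" "b < R" "a \<le> cheb u v" "b \<le> cheb u v"
    using False by (auto simp: R_def a_def b_def cheb_def)
  have "boxes_containing j u \<inter> boxes_containing j v =
     {max (fst u) (fst v) - R + 1..min (fst u) (fst v)} \<times> {max (snd u) (snd v) - R + 1..min (snd u) (snd v)}"
    unfolding boxes_eq R_def by auto
  then have "card (boxes_containing j u \<inter> boxes_containing j v) =
     nat (min (fst u) (fst v) - max (fst u) (fst v) + R) * nat (min (snd u) (snd v) - max (snd u) (snd v) + R)"
    by (simp add: card_cartesian_product algebra_simps)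
  also have "min (fst u) (fst v) - max (fst u) (fst v) + R = R - a" by (auto simp: a_def)
  also have "min (snd u) (snd v) - max (snd u) (snd v) + R = R - b" by (auto simp: b_def)
  finally have card: "real (card (boxes_containing j u \<inter> boxes_containing j v)) = real_of_int ((R - a) * (R - b))"
    using ab by simp
  have "R * R - R * (2 * cheb u v) \<le> (R - a) * (R - b)"
  proof -
    have "R * (a + b) \<le> R * (2 * cheb u v)" using ab by (intro mult_left_mono) auto
    moreover have "0 \<le> a * b" using ab by simp
    ultimately show ?thesis by (simp add: algebra_simps)
  qed
  then have "real_of_int (R * R - R * (2 * cheb u v)) \<le> real_of_int ((R - a) * (R - b))"
    by (simp only: of_int_le_iff)
  moreover have r: "real_of_int R = 2 ^ j" by (simp add: R_def)
  ultimately have "2 ^ j * 2 ^ j - 2 ^ j * (2 * real_of_int (cheb u v)) \<le> real_of_int ((R - a) * (R - b))"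
    by simp
  then have "(2 ^ j * 2 ^ j - 2 ^ j * (2 * real_of_int (cheb u v))) / (2 ^ j * 2 ^ j) \<le>
      real_of_int ((R - a) * (R - b)) / (2 ^ j * 2 ^ j)"
    by (rule divide_right_mono) simp
  also have "(2 ^ j * 2 ^ j - 2 ^ j * (2 * real_of_int (cheb u v))) / (2 ^ j * 2 ^ j) =
      1 - 2 * real_of_int (cheb u v) / 2 ^ j"
    by (simp add: diff_divide_distrib)
  finally have "1 - 2 * real_of_int (cheb u v) / 2 ^ j \<le> real_of_int ((R - a) * (R - b)) / (2 ^ j * 2 ^ j)" .
  moreover have "(4::real) ^ j = 2 ^ j * 2 ^ j" by (simp flip: power_mult_distrib)
  ultimately show ?thesis unfolding ovl_def card by simp
qed

text \<open>The noise variance \<open>4^(-j*k)\<close> cancels the number \<open>4^(j*k)\<close> of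
  boxes, so every level has variance \<open>k\<close>, whatever its scale.\<close>

lemma qvar_psic:
  assumes I: "finite I" "noise_supp k j u \<subseteq> I" "noise_supp k j v \<subseteq> I"
  shows "qvar I (\<lambda>i. \<alpha> * psic k j u i + \<beta> * psic k j v i) =
    real k * (\<alpha>\<^sup>2 + \<beta>\<^sup>2 + 2 * \<alpha> * \<beta> * ovl (j * k) u v)"
proof -
  let ?U = "noise_supp k j u" and ?V = "noise_supp k j v"
  have s: "(sdev i)\<^sup>2 = 1 / 4 ^ (j * k)" if "fst i = j * k" for i
  proof -
    have "(sdev i)\<^sup>2 = (2 powr - real (j * k)) * (2 powr - real (j * k))"
      unfolding sdev_def that by (simp add: power2_eq_square)
    also have "\<dots> = 1 / (2 ^ (j * k) * 2 ^ (j * k))"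
      unfolding powr_minus_divide powr_realpow[of "2::real", simplified] by simp
    also have "(2::real) ^ (j * k) * 2 ^ (j * k) = 4 ^ (j * k)" by (simp flip: power_mult_distrib)
    finally show ?thesis .
  qed
  have "qvar I (\<lambda>i. \<alpha> * psic k j u i + \<beta> * psic k j v i) =
    (\<Sum>i\<in>I. (real k / 4 ^ (j * k)) * (\<alpha>\<^sup>2 * of_bool (i \<in> ?U) + \<beta>\<^sup>2 * of_bool (i \<in> ?V) + 2 * \<alpha> * \<beta> * of_bool (i \<in> ?U \<inter> ?V)))"
    unfolding qvar_def
  proof (rule sum.cong[OF refl])
    fix i
    show "(\<alpha> * psic k j u i + \<beta> * psic k j v i)\<^sup>2 * (sdev i)\<^sup>2 =
      (real k / 4 ^ (j * k)) * (\<alpha>\<^sup>2 * of_bool (i \<in> ?U) + \<beta>\<^sup>2 * of_bool (i \<in> ?V) + 2 * \<alpha> * \<beta> * of_bool (i \<in> ?U \<inter> ?V))"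
    proof (cases "fst i = j * k")
      case True
      have p: "psic k j u i = sqrt (real k) * of_bool (i \<in> ?U)" "psic k j v i = sqrt (real k) * of_bool (i \<in> ?V)"
        using True by (auto simp: psic_def noise_supp_def mem_Times_iff)
      show ?thesis unfolding p s[OF True]
        by (cases "i \<in> ?U"; cases "i \<in> ?V") (simp_all add: power2_eq_square field_simps)
    next
      case False
      then show ?thesis by (auto simp: psic_def noise_supp_def)
    qed
  qed
  also have "\<dots> = (real k / 4 ^ (j * k)) * (\<alpha>\<^sup>2 * real (card ?U) + \<beta>\<^sup>2 * real (card ?V) + 2 * \<alpha> * \<beta> * real (card (?U \<inter> ?V)))"
  proof -
    have c: "(\<Sum>i\<in>I. of_bool (i \<in> W)) = real (card W)" if "W \<subseteq> I" for W
    proof -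
      have "(\<Sum>i\<in>I. of_bool (i \<in> W)) = (\<Sum>i\<in>W. 1::real)"
        by (rule sum.mono_neutral_cong_right) (use that I in auto)
      then show ?thesis by simp
    qed
    have "?U \<inter> ?V \<subseteq> I" using I by blast
    then show ?thesis
      by (simp only: sum_distrib_left[symmetric] sum.distrib c I(2,3))
  qed
  also have "card ?U = 4 ^ (j * k)"
    by (simp add: noise_supp_def card_cartesian_product card_boxes)
  also have "card ?V = 4 ^ (j * k)"
    by (simp add: noise_supp_def card_cartesian_product card_boxes)
  also have "?U \<inter> ?V = {j * k} \<times> (boxes_containing (j * k) u \<inter> boxes_containing (j * k) v)"
    by (auto simp: noise_supp_def)
  finally show ?thesis by (simp add: ovl_def card_cartesian_product field_simps)
qed

text \<open>The source of the one- and two-point exponential moments below. As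
  \<open>k \<ge> 1\<close>, different \<open>j\<close> use boxes of different size, hence disjoint
  noise, and the variances of the levels add.\<close>

lemma
  assumes k: "k \<ge> 1" and J: "finite J"
  shows integrable_two_point:
      "integrable gauss_space (\<lambda>\<omega>. exp (\<Sum>j\<in>J. \<alpha> j * psi k \<omega> j u + \<beta> j * psi k \<omega> j v))" (is ?i)
    and integral_two_point:
      "(\<integral>\<omega>. exp (\<Sum>j\<in>J. \<alpha> j * psi k \<omega> j u + \<beta> j * psi k \<omega> j v) \<partial>gauss_space) =
       exp (real k * (\<Sum>j\<in>J. (\<alpha> j)\<^sup>2 + (\<beta> j)\<^sup>2 + 2 * \<alpha> j * \<beta> j * ovl (j * k) u v) / 2)" (is ?e)
proof -
  define I where "I = (\<Union>j\<in>J. noise_supp k j u \<union> noise_supp k j v)"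
  have I: "finite I" using J by (simp add: I_def)
  define c where "c j i = \<alpha> j * psic k j u i + \<beta> j * psic k j v i" for j i
  have eq: "(\<Sum>j\<in>J. \<alpha> j * psi k \<omega> j u + \<beta> j * psi k \<omega> j v) = lin I (\<lambda>i. \<Sum>j\<in>J. c j i) \<omega>" for \<omega>
    unfolding lin_sum
  proof (rule sum.cong[OF refl])
    fix j assume "j \<in> J"
    then have "noise_supp k j u \<subseteq> I" "noise_supp k j v \<subseteq> I" by (auto simp: I_def)
    then show "\<alpha> j * psi k \<omega> j u + \<beta> j * psi k \<omega> j v = lin I (c j) \<omega>"
      unfolding c_def by (simp add: lin_add lin_scale psi_eq_lin[OF I])
  qed
  have "qvar I (\<lambda>i. \<Sum>j\<in>J. c j i) = (\<Sum>j\<in>J. qvar I (c j))"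
    by (rule qvar_disjoint_sum[OF J]) (use k in \<open>auto simp: c_def psic_def\<close>)
  also have "\<dots> = (\<Sum>j\<in>J. real k * ((\<alpha> j)\<^sup>2 + (\<beta> j)\<^sup>2 + 2 * \<alpha> j * \<beta> j * ovl (j * k) u v))"
    unfolding c_def by (rule sum.cong[OF refl], rule qvar_psic[OF I]) (auto simp: I_def)
  finally have q: "qvar I (\<lambda>i. \<Sum>j\<in>J. c j i) = \<dots>" .
  show ?i unfolding eq by (rule integrable_exp_lin[OF I])
  show ?e unfolding eq integral_exp_lin[OF I] q by (simp add: sum_distrib_left)
qed

lemma
  assumes k: "k \<ge> 1"
  shows integrable_exp_pphi: "integrable gauss_space (\<lambda>\<omega>. exp (\<theta> * pphi k a b \<omega> u))"
    and integral_exp_pphi: "(\<integral>\<omega>. exp (\<theta> * pphi k a b \<omega> u) \<partial>gauss_space) = exp (\<theta>\<^sup>2 * real (k * (b - a)) / 2)"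
  using integrable_two_point[OF k, of "{a..<b}" "\<lambda>_. \<theta>" u "\<lambda>_. 0" u]
    integral_two_point[OF k, of "{a..<b}" "\<lambda>_. \<theta>" u "\<lambda>_. 0" u]
  by (simp_all add: pphi_def sum_distrib_left mult.commute mult.left_commute)

lemma pphi_split: "a \<le> b \<Longrightarrow> b \<le> c \<Longrightarrow> pphi k a c \<omega> z = pphi k a b \<omega> z + pphi k b c \<omega> z"
  unfolding pphi_def by (simp add: sum.atLeastLessThan_concat)

lemma phi_eq_pphi: "phi k n \<omega> z = pphi k 0 (n div k) \<omega> z"
  by (simp add: phi_def pphi_def atLeast0LessThan)

text \<open>The extra shift by 1 on the levels above \<open>l\<close> measures how thick a
  \<open>\<mu>\<^sub>\<gamma>\<close>-typical point is.\<close>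

lemma
  assumes k: "k \<ge> 1" and l: "l \<le> M"
  shows integrable_exp_thick: "integrable gauss_space (\<lambda>\<omega>. exp (\<gamma> * pphi k 0 M \<omega> u + pphi k l M \<omega> u))" (is ?i)
    and integral_exp_thick: "(\<integral>\<omega>. exp (\<gamma> * pphi k 0 M \<omega> u + pphi k l M \<omega> u) \<partial>gauss_space) =
      exp (\<gamma>\<^sup>2 * real (k * M) / 2 + (\<gamma> + 1 / 2) * real (k * (M - l)))" (is ?e)
proof -
  define \<beta> where "\<beta> j = (if l \<le> j then 1 else 0 :: real)" for j
  have b: "pphi k l M \<omega> u = (\<Sum>j\<in>{0..<M}. \<beta> j * psi k \<omega> j u)" for \<omega>
    unfolding pphi_def by (rule sum.mono_neutral_cong_left) (auto simp: \<beta>_def)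
  have eq: "\<gamma> * pphi k 0 M \<omega> u + pphi k l M \<omega> u = (\<Sum>j\<in>{0..<M}. \<gamma> * psi k \<omega> j u + \<beta> j * psi k \<omega> j u)" for \<omega>
    unfolding b by (simp add: pphi_def sum_distrib_left sum.distrib)
  show ?i unfolding eq by (rule integrable_two_point[OF k]) simp
  have s: "(\<Sum>j\<in>{0..<M}. \<beta> j) = real (M - l)"
  proof -
    have "(\<Sum>j\<in>{0..<M}. \<beta> j) = (\<Sum>j\<in>{l..<M}. 1)"
      by (rule sum.mono_neutral_cong_right) (auto simp: \<beta>_def)
    then show ?thesis by simp
  qed
  have "(\<Sum>j\<in>{0..<M}. \<gamma>\<^sup>2 + (\<beta> j)\<^sup>2 + 2 * \<gamma> * \<beta> j * ovl (j * k) u u) = (\<Sum>j\<in>{0..<M}. \<gamma>\<^sup>2 + (1 + 2 * \<gamma>) * \<beta> j)"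
    by (rule sum.cong) (auto simp: \<beta>_def ovl_self)
  also have "\<dots> = \<gamma>\<^sup>2 * real M + (1 + 2 * \<gamma>) * real (M - l)"
    by (simp only: sum.distrib sum_distrib_left[symmetric] s) simp
  finally show ?e unfolding eq
    by (subst integral_two_point[OF k]) (simp_all add: field_simps)
qed

lemma pair_eq_sum:
  "\<gamma> * pphi k 0 M \<omega> u + \<gamma> * pphi k 0 M \<omega> v = (\<Sum>j\<in>{0..<M}. \<gamma> * psi k \<omega> j u + \<gamma> * psi k \<omega> j v)"
  by (simp add: pphi_def sum_distrib_left sum.distrib)

lemma integrable_exp_pair:
  "k \<ge> 1 \<Longrightarrow> integrable gauss_space (\<lambda>\<omega>. exp (\<gamma> * pphi k 0 M \<omega> u + \<gamma> * pphi k 0 M \<omega> v))"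
  unfolding pair_eq_sum by (rule integrable_two_point) simp_all

text \<open>Below level \<open>l\<close> the two points share no box; from \<open>l\<close> on the
  correlation is at most 1, which at most doubles the contribution of the level.\<close>

lemma integral_exp_pair_le:
  assumes k: "k \<ge> 1" and l: "l \<le> M" and far: "\<And>j. j < l \<Longrightarrow> 2 ^ (j * k) \<le> cheb u v"
  shows "(\<integral>\<omega>. exp (\<gamma> * pphi k 0 M \<omega> u + \<gamma> * pphi k 0 M \<omega> v) \<partial>gauss_space) \<le>
      exp (\<gamma>\<^sup>2 * real (k * M) + \<gamma>\<^sup>2 * real (k * (M - l)))"
proof -
  have "(\<Sum>j\<in>{0..<M}. \<gamma>\<^sup>2 + \<gamma>\<^sup>2 + 2 * \<gamma> * \<gamma> * ovl (j * k) u v) \<le>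
     (\<Sum>j\<in>{0..<M}. 2 * \<gamma>\<^sup>2 + 2 * \<gamma>\<^sup>2 * (if l \<le> j then 1 else 0))"
  proof (rule sum_mono)
    fix j
    show "\<gamma>\<^sup>2 + \<gamma>\<^sup>2 + 2 * \<gamma> * \<gamma> * ovl (j * k) u v \<le> 2 * \<gamma>\<^sup>2 + 2 * \<gamma>\<^sup>2 * (if l \<le> j then 1 else 0)"
    proof (cases "l \<le> j")
      case True
      have "2 * \<gamma>\<^sup>2 * ovl (j * k) u v \<le> 2 * \<gamma>\<^sup>2 * 1"
        by (intro mult_left_mono ovl_le_1) auto
      then show ?thesis using True by (simp add: power2_eq_square mult.assoc)
    next
      case False
      then show ?thesis using ovl_far[OF far[of j]] by simp
    qed
  qed
  also have "\<dots> = 2 * \<gamma>\<^sup>2 * real M + 2 * \<gamma>\<^sup>2 * real (M - l)"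
  proof -
    have "(\<Sum>j\<in>{0..<M}. if l \<le> j then 1 else 0 :: real) = (\<Sum>j\<in>{l..<M}. 1)"
      by (rule sum.mono_neutral_cong_right) auto
    then have "(\<Sum>j\<in>{0..<M}. if l \<le> j then 1 else 0 :: real) = real (M - l)" by simp
    then show ?thesis by (simp only: sum.distrib sum_distrib_left[symmetric]) simp
  qed
  finally have "real k * (\<Sum>j\<in>{0..<M}. \<gamma>\<^sup>2 + \<gamma>\<^sup>2 + 2 * \<gamma> * \<gamma> * ovl (j * k) u v) \<le>
     real k * (2 * \<gamma>\<^sup>2 * real M + 2 * \<gamma>\<^sup>2 * real (M - l))" by (rule mult_left_mono) simp
  then show ?thesis unfolding pair_eq_sum
    by (subst integral_two_point[OF k]) (simp_all add: field_simps)
qed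

lemma diff_eq_sum:
  "\<theta> * (pphi k a b \<omega> x - pphi k a b \<omega> u) = (\<Sum>j\<in>{a..<b}. \<theta> * psi k \<omega> j x + (- \<theta>) * psi k \<omega> j u)"
  by (simp add: pphi_def sum_distrib_left sum_subtractf right_diff_distrib)

lemma integrable_exp_diff:
  "k \<ge> 1 \<Longrightarrow> integrable gauss_space (\<lambda>\<omega>. exp (\<theta> * (pphi k a b \<omega> x - pphi k a b \<omega> u)))"
  unfolding diff_eq_sum by (rule integrable_two_point) simp_all

text \<open>Level \<open>j\<close> contributes through \<open>1 - ovl\<close>. The levels
  \<open>a\<close>, \<open>a + 1\<close>, \<open>a + 2\<close> count at most 1 each; from
  \<open>a + 3\<close> on the points are close compared with the boxes, and the terms decay
  geometrically with sum at most 2. The total 5 = 3 + 2 does not depend on \<open>b\<close>.\<close>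

lemma integral_exp_diff_le:
  assumes k: "k \<ge> 1" and near: "cheb x u \<le> 2 ^ ((a + 2) * k)"
  shows "(\<integral>\<omega>. exp (\<theta> * (pphi k a b \<omega> x - pphi k a b \<omega> u)) \<partial>gauss_space) \<le> exp (5 * \<theta>\<^sup>2 * real k)"
proof -
  have tm: "1 - ovl (j * k) x u \<le> (if j < a + 3 then 1 else 2 * (1 / 2) ^ (j - (a + 2)))" if "a \<le> j" for j
  proof (cases "j < a + 3")
    case True
    then show ?thesis using ovl_nonneg by simp
  next
    case False
    define d where "d = j - (a + 2)"
    have d: "j = a + 2 + d" using False by (simp add: d_def)
    have "real_of_int (cheb x u) \<le> 2 ^ ((a + 2) * k)"
      using near by (metis of_int_le_iff of_int_numeral of_int_power)
    then have "2 * real_of_int (cheb x u) / 2 ^ (j * k) \<le> 2 * 2 ^ ((a + 2) * k) / 2 ^ (j * k)"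
      by (intro divide_right_mono mult_left_mono) auto
    also have "\<dots> = 2 * (1 / 2) ^ (d * k)"
      by (simp add: d algebra_simps power_add power_divide)
    also have "\<dots> \<le> 2 * (1 / 2) ^ d"
      using k by (intro mult_left_mono power_decreasing) auto
    finally show ?thesis using ovl_near[of "j * k" x u] False by (simp add: d)
  qed
  have "(\<Sum>j\<in>{a..<b}. \<theta>\<^sup>2 + (- \<theta>)\<^sup>2 + 2 * \<theta> * (- \<theta>) * ovl (j * k) x u) =
    2 * \<theta>\<^sup>2 * (\<Sum>j\<in>{a..<b}. 1 - ovl (j * k) x u)"
    by (simp add: sum_distrib_left power2_eq_square algebra_simps)
  also have "\<dots> \<le> 2 * \<theta>\<^sup>2 * 5"
  proof (rule mult_left_mono)
    have "(\<Sum>j\<in>{a..<b}. 1 - ovl (j * k) x u) \<le> (\<Sum>j\<in>{a..<b}. if j < a + 3 then 1 else 2 * (1 / 2) ^ (j - (a + 2)))"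
      by (rule sum_mono) (use tm in auto)
    also have "\<dots> \<le> (\<Sum>j\<in>{a..<a + 3 + b}. if j < a + 3 then 1 else 2 * (1 / 2) ^ (j - (a + 2)))"
      by (rule sum_mono2) auto
    also have "\<dots> = (\<Sum>j\<in>{a..<a + 3}. if j < a + 3 then 1 else 2 * (1 / 2) ^ (j - (a + 2))) +
       (\<Sum>j\<in>{a + 3..<a + 3 + b}. if j < a + 3 then 1 else 2 * (1 / 2) ^ (j - (a + 2)) :: real)"
      by (rule sum.atLeastLessThan_concat[symmetric]) auto
    also have "(\<Sum>j\<in>{a..<a + 3}. if j < a + 3 then 1 else 2 * (1 / 2) ^ (j - (a + 2)) :: real) = 3"
      by simp
    also have "(\<Sum>j\<in>{a + 3..<a + 3 + b}. if j < a + 3 then 1 else 2 * (1 / 2) ^ (j - (a + 2)) :: real) =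
       (\<Sum>i\<in>{0..<b}. (1 / 2) ^ i)"
      using sum.shift_bounds_nat_ivl[of "\<lambda>j. if j < a + 3 then 1 else 2 * (1 / 2) ^ (j - (a + 2)) :: real" 0 "a + 3" b]
      by (simp add: add.commute)
    also have "\<dots> \<le> 2"
      using geometric_sum_less[of "1/2::real" "{0..<b}"] by simp
    finally show "(\<Sum>j\<in>{a..<b}. 1 - ovl (j * k) x u) \<le> 5" by simp
  qed simp
  finally have "real k * (\<Sum>j\<in>{a..<b}. \<theta>\<^sup>2 + (- \<theta>)\<^sup>2 + 2 * \<theta> * (- \<theta>) * ovl (j * k) x u) \<le> real k * (2 * \<theta>\<^sup>2 * 5)"
    by (rule mult_left_mono) simp
  then show ?thesis unfolding diff_eq_sum
    by (subst integral_two_point[OF k]) (simp_all add: field_simps)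
qed

subsection \<open>Skeletons of star-connected sets\<close>

abbreviation star_chain :: "vtx list \<Rightarrow> bool" where
  "star_chain \<equiv> successively (\<lambda>x y. cheb x y \<le> 1)"

definition cellv :: "nat \<Rightarrow> vtx \<Rightarrow> vtx" where
  "cellv s w = (fst w div 2 ^ s, snd w div 2 ^ s)"

text \<open>Radius 3 is large enough for neighbourhoods to be nested along a skeleton
  (\<open>nbh_children_subset\<close>) and small enough for cells with indices 8 apart to see
  disjoint noise (\<open>chain_supp_disjoint\<close>).\<close>

definition nbh :: "nat \<Rightarrow> vtx \<Rightarrow> vtx set" where
  "nbh s c = {w. cheb w (2 ^ s * fst c, 2 ^ s * snd c) \<le> 3 * 2 ^ s}"

definition separated :: "vtx set \<Rightarrow> bool" where
  "separated T \<longleftrightarrow> (\<forall>c\<in>T. \<forall>c'\<in>T. c \<noteq> c' \<longrightarrow> 8 \<le> cheb c c')"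

text \<open>Candidate sets of children of the cell \<open>a\<close>, as a subset of a \<open>*\<close>-chain \<open>L\<close> listed backwards:
  it starts inside \<open>a\<close> with the last entry, and its length \<open>2^k\<close> limits the number of candidates.\<close>

definition children :: "nat \<Rightarrow> vtx \<Rightarrow> vtx set set" where
  "children k a = {T. \<exists>L. length L = 2 ^ k \<and> star_chain L \<and> cellv k (last L) = a \<and> T \<subseteq> set L \<and>
     card T = 2 ^ (k - 6) \<and> separated T}"

text \<open>Cells are given by their indices and no scale is mentioned: if \<open>a\<close> is a
  cell of side 2^(s + d k), the members of \<open>skel k d a\<close> consist of cells of side 2^s.
  One count therefore serves all scales.\<close>

primrec skel :: "nat \<Rightarrow> nat \<Rightarrow> vtx \<Rightarrow> vtx set set" where
  "skel k 0 a = {{a}}"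
| "skel k (Suc d) a = (\<Union>S\<in>skel k d a. (\<lambda>f. \<Union>c\<in>S. f c) ` (Pi\<^sub>E S (children k)))"

lemma cheb_le_iff: "cheb u v \<le> r \<longleftrightarrow> \<bar>fst u - fst v\<bar> \<le> r \<and> \<bar>snd u - snd v\<bar> \<le> r"
  by (auto simp: cheb_def)

lemma cheb_ge_iff: "r \<le> cheb u v \<longleftrightarrow> r \<le> \<bar>fst u - fst v\<bar> \<or> r \<le> \<bar>snd u - snd v\<bar>"
  by (auto simp: cheb_def)

lemma cellv_0 [simp]: "cellv 0 w = w"
  by (simp add: cellv_def)

lemma cellv_add: "cellv (s + t) w = cellv t (cellv s w)"
  by (simp add: cellv_def power_add zdiv_zmult2_eq)

lemma cellv_bounds:
  "2 ^ s * fst (cellv s w) \<le> fst w" "fst w < 2 ^ s * fst (cellv s w) + 2 ^ s"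
  "2 ^ s * snd (cellv s w) \<le> snd w" "snd w < 2 ^ s * snd (cellv s w) + 2 ^ s"
proof -
  have "2 ^ s * (x div 2 ^ s) \<le> x \<and> x < 2 ^ s * (x div 2 ^ s) + 2 ^ s" for x :: int
    using pos_mod_bound[of "2 ^ s" x] pos_mod_sign[of "2 ^ s" x] mult_div_mod_eq[of "2 ^ s" x]
    by (smt (verit) zero_less_power)
  then show "2 ^ s * fst (cellv s w) \<le> fst w" "fst w < 2 ^ s * fst (cellv s w) + 2 ^ s"
    "2 ^ s * snd (cellv s w) \<le> snd w" "snd w < 2 ^ s * snd (cellv s w) + 2 ^ s"
    by (auto simp: cellv_def)
qed

lemma finite_cheb_ball: "finite {w. cheb w c \<le> r}"
proof -
  have "{w. cheb w c \<le> r} \<subseteq> {fst c - r..fst c + r} \<times> {snd c - r..snd c + r}"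
    by (auto simp: cheb_le_iff)
  then show ?thesis by (rule finite_subset) simp
qed

lemma finite_nbh [simp]: "finite (nbh s c)"
  by (simp add: nbh_def finite_cheb_ball)

lemma nbh_nonempty [simp]: "nbh s c \<noteq> {}"
proof -
  have "(2 ^ s * fst c, 2 ^ s * snd c) \<in> nbh s c" by (simp add: nbh_def)
  then show ?thesis by blast
qed

lemma star_chain_cheb: "star_chain L \<Longrightarrow> L \<noteq> [] \<Longrightarrow> cheb (hd L) (last L) \<le> int (length L) - 1"
proof (induction L rule: induct_list012)
  case (3 x y L)
  then have "cheb x y \<le> 1" "cheb y (last (y # L)) \<le> int (length (y # L)) - 1" by auto
  then show ?case using cheb_triangle[of x "last (y # L)" y] by simp
qed auto

lemma star_chain_cheb_mem:
  assumes "star_chain L" "c \<in> set L"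
  shows "cheb c (last L) \<le> int (length L) - 1"
proof -
  obtain L1 L2 where L: "L = L1 @ c # L2" using assms(2) by (meson split_list)
  then have "star_chain (c # L2)" using assms(1) by (auto simp: successively_append_iff)
  then show ?thesis using star_chain_cheb[of "c # L2"] by (simp add: L)
qed

text \<open>A chain of 2^k entries moves by at most 2^k - 1, so the children stay in the 3 by 3
  block of cells around \<open>a\<close>.\<close>

lemma children_near:
  assumes "T \<in> children k a" "c \<in> T"
  shows "2 ^ k * fst a - 2 ^ k < fst c" "fst c < 2 ^ k * fst a + 2 * 2 ^ k"
    "2 ^ k * snd a - 2 ^ k < snd c" "snd c < 2 ^ k * snd a + 2 * 2 ^ k"
proof -
  obtain L where L: "length L = 2 ^ k" "star_chain L" "cellv k (last L) = a" "c \<in> set L"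
    using assms by (auto simp: children_def)
  have "cheb c (last L) \<le> 2 ^ k - 1" using star_chain_cheb_mem[OF L(2,4)] L(1) by simp
  then have "\<bar>fst c - fst (last L)\<bar> \<le> 2 ^ k - 1" "\<bar>snd c - snd (last L)\<bar> \<le> 2 ^ k - 1"
    by (simp_all only: cheb_le_iff)
  then show "2 ^ k * fst a - 2 ^ k < fst c" "fst c < 2 ^ k * fst a + 2 * 2 ^ k"
    "2 ^ k * snd a - 2 ^ k < snd c" "snd c < 2 ^ k * snd a + 2 * 2 ^ k"
    using cellv_bounds[where s = k and w = "last L", unfolded L(3)] by linarith+
qed

section \<open>Entropy and separation of the candidate skeletons\<close>

lemma card_star_chains:
  assumes "finite S"
  shows "finite {L. length L = Suc p \<and> star_chain L \<and> last L \<in> S} \<and>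
    card {L. length L = Suc p \<and> star_chain L \<and> last L \<in> S} \<le> card S * 9 ^ p"
proof (induction p)
  case 0
  have "{L. length L = Suc 0 \<and> star_chain L \<and> last L \<in> S} \<subseteq> (\<lambda>x. [x]) ` S"
    by (auto simp: length_Suc_conv)
  then show ?case
    using assms by (auto intro: finite_subset surj_card_le)
next
  case (Suc p)
  let ?A = "\<lambda>p. {L. length L = Suc p \<and> star_chain L \<and> last L \<in> S}"
  let ?D = "{-1..1::int} \<times> {-1..1::int}"
  let ?f = "\<lambda>(L, d). (fst (hd L) + fst d, snd (hd L) + snd d) # L"
  have sub: "?A (Suc p) \<subseteq> ?f ` (?A p \<times> ?D)"
  proof
    fix L assume L: "L \<in> ?A (Suc p)"
    then obtain x y L' where L': "L = x # y # L'" by (auto simp: length_Suc_conv)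
    have "cheb x y \<le> 1" using L by (simp add: L')
    then have "(fst x - fst y, snd x - snd y) \<in> ?D" by (auto simp: cheb_le_iff abs_le_iff)
    moreover have "y # L' \<in> ?A p" using L by (simp add: L')
    moreover have "L = ?f (y # L', (fst x - fst y, snd x - snd y))" by (simp add: L')
    ultimately show "L \<in> ?f ` (?A p \<times> ?D)" by blast
  qed
  have fin: "finite (?A p \<times> ?D)" using Suc by simp
  have "card (?A (Suc p)) \<le> card (?A p \<times> ?D)"
    using sub fin by (rule surj_card_le[rotated])
  also have "\<dots> = card (?A p) * 9" by (simp add: card_cartesian_product)
  also have "\<dots> \<le> card S * 9 ^ p * 9" using Suc by simp
  finally show ?case using sub fin by (auto intro: finite_subset)
qed

text \<open>72 = 4 * 9 * 2: each entry of the chain has at most 9 choices given the previous one and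
  2 for membership in \<open>T\<close>, and the 4^k starting points are bounded by 4^(2^k). The base
  does not grow with \<open>k\<close>.\<close>

lemma finite_children: "finite (children k a)"
  and card_children: "card (children k a) \<le> 72 ^ (2 ^ k)"
proof -
  let ?S = "{2 ^ k * fst a..<2 ^ k * fst a + 2 ^ k} \<times> {2 ^ k * snd a..<2 ^ k * snd a + 2 ^ k}"
  let ?A = "{L. length L = Suc (2 ^ k - 1) \<and> star_chain L \<and> last L \<in> ?S}"
  have fin: "finite ?A" and card: "card ?A \<le> card ?S * 9 ^ (2 ^ k - 1)"
    using card_star_chains[of ?S "2 ^ k - 1"] by auto
  have sub: "children k a \<subseteq> (\<Union>L\<in>?A. Pow (set L))"
  proof
    fix T assume "T \<in> children k a"
    then obtain L where L: "length L = 2 ^ k" "star_chain L" "cellv k (last L) = a" "T \<subseteq> set L"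
      by (auto simp: children_def)
    have "last L \<in> ?S" using cellv_bounds[where s = k and w = "last L"] L(3) by (auto simp: mem_Times_iff)
    then show "T \<in> (\<Union>L\<in>?A. Pow (set L))" using L by auto
  qed
  then show "finite (children k a)" by (rule finite_subset) (use fin in auto)
  have "card (children k a) \<le> card (\<Union>L\<in>?A. Pow (set L))"
    by (rule card_mono[OF _ sub]) (use fin in auto)
  also have "\<dots> \<le> (\<Sum>L\<in>?A. card (Pow (set L)))" by (rule card_UN_le[OF fin])
  also have "\<dots> \<le> (\<Sum>L\<in>?A. 2 ^ (2 ^ k))"
  proof (rule sum_mono)
    fix L assume L: "L \<in> ?A"
    have "card (set L) \<le> 2 ^ k" using card_length[of L] L by simp
    then show "card (Pow (set L)) \<le> 2 ^ (2 ^ k)" by (simp add: card_Pow power_increasing)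
  qed
  also have "\<dots> \<le> (4 ^ k * 9 ^ (2 ^ k - 1)) * 2 ^ (2 ^ k)"
  proof -
    have "card ?S = 4 ^ k"
      by (simp add: card_cartesian_product nat_power_eq flip: power_mult_distrib)
    then show ?thesis using card by simp
  qed
  also have "\<dots> \<le> (4 ^ (2 ^ k) * 9 ^ (2 ^ k)) * 2 ^ (2 ^ k)"
    by (intro mult_mono power_increasing) (auto intro: less_imp_le less_exp)
  also have "\<dots> = 72 ^ (2 ^ k)" by (simp flip: power_mult_distrib)
  finally show "card (children k a) \<le> 72 ^ (2 ^ k)" .
qed

lemma children_props:
  assumes "T \<in> children k a"
  shows "finite T" "card T = 2 ^ (k - 6)" "separated T"
proof -
  show c: "card T = 2 ^ (k - 6)" and "separated T" using assms by (auto simp: children_def)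
  then show "finite T" by (metis card.infinite power_not_zero zero_neq_numeral)
qed

text \<open>Parents 8 apart have children more than 5 * 2^k apart, since a child leaves its parent
  cell by less than one cell side. Separation is therefore inherited across different
  parents.\<close>

lemma children_far:
  assumes "T \<in> children k a" "T' \<in> children k a'" "8 \<le> cheb a a'" "c \<in> T" "c' \<in> T'" "2 \<le> k"
  shows "8 \<le> cheb c c'"
proof -
  have K: "(2::int) ^ k \<ge> 4"
    using power_increasing[OF assms(6), of "2::int"] by simp
  note n = children_near[OF assms(1,4)] children_near[OF assms(2,5)]
  have diff: "8 \<le> \<bar>x - x'\<bar>"
    if "2 ^ k * b - 2 ^ k < x" "x < 2 ^ k * b + 2 * 2 ^ k"
       "2 ^ k * b' - 2 ^ k < x'" "x' < 2 ^ k * b' + 2 * 2 ^ k" "8 \<le> \<bar>b - b'\<bar>" for x x' b b' :: int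
  proof (cases "b \<le> b'")
    case True
    then have "2 ^ k * (b + 8) \<le> 2 ^ k * b'" using that by (intro mult_left_mono) auto
    then show ?thesis using that K by (simp add: distrib_left)
  next
    case False
    then have "2 ^ k * (b' + 8) \<le> 2 ^ k * b" using that by (intro mult_left_mono) auto
    then show ?thesis using that K by (simp add: distrib_left)
  qed
  from assms(3) have "8 \<le> \<bar>fst a - fst a'\<bar> \<or> 8 \<le> \<bar>snd a - snd a'\<bar>" by (simp only: cheb_ge_iff)
  then show ?thesis
  proof
    assume *: "8 \<le> \<bar>fst a - fst a'\<bar>"
    have "8 \<le> \<bar>fst c - fst c'\<bar>" by (rule diff[OF n(1,2) n(5,6) *])
    then show ?thesis by (simp add: cheb_ge_iff)
  next
    assume *: "8 \<le> \<bar>snd a - snd a'\<bar>"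
    have "8 \<le> \<bar>snd c - snd c'\<bar>" by (rule diff[OF n(3,4) n(7,8) *])
    then show ?thesis by (simp add: cheb_ge_iff)
  qed
qed

lemma union_children:
  assumes S: "finite S" "separated S" and f: "\<And>c. c \<in> S \<Longrightarrow> f c \<in> children k c" and k: "2 \<le> k"
  shows "finite (\<Union>c\<in>S. f c)" "separated (\<Union>c\<in>S. f c)"
    "\<And>g :: vtx \<Rightarrow> real. (\<Sum>c\<in>(\<Union>c\<in>S. f c). g c) = (\<Sum>c\<in>S. \<Sum>c'\<in>f c. g c')"
    "card (\<Union>c\<in>S. f c) = card S * 2 ^ (k - 6)"
proof -
  note p = children_props[OF f]
  have far: "8 \<le> cheb x x'" if "c \<in> S" "c' \<in> S" "c \<noteq> c'" "x \<in> f c" "x' \<in> f c'" for c c' x x'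
    by (rule children_far[OF f f]) (use that S k in \<open>auto simp: separated_def\<close>)
  have dis: "\<forall>c\<in>S. \<forall>c'\<in>S. c \<noteq> c' \<longrightarrow> f c \<inter> f c' = {}"
  proof (intro ballI impI, rule ccontr)
    fix c c' assume c: "c \<in> S" "c' \<in> S" "c \<noteq> c'" "f c \<inter> f c' \<noteq> {}"
    then obtain x where "x \<in> f c" "x \<in> f c'" by blast
    from far[OF c(1-3) this] show False by simp
  qed
  show "finite (\<Union>c\<in>S. f c)" using S p by auto
  show "separated (\<Union>c\<in>S. f c)"
    unfolding separated_def
  proof (intro ballI impI)
    fix x x' assume "x \<in> (\<Union>c\<in>S. f c)" "x' \<in> (\<Union>c\<in>S. f c)" "x \<noteq> x'"
    then obtain c c' where c: "c \<in> S" "c' \<in> S" "x \<in> f c" "x' \<in> f c'" by blast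
    show "8 \<le> cheb x x'"
    proof (cases "c = c'")
      case True
      then show ?thesis using p(3)[OF c(1)] c \<open>x \<noteq> x'\<close> by (auto simp: separated_def)
    next
      case False
      then show ?thesis using far c by blast
    qed
  qed
  show "(\<Sum>c\<in>(\<Union>c\<in>S. f c). g c) = (\<Sum>c\<in>S. \<Sum>c'\<in>f c. g c')" for g :: "vtx \<Rightarrow> real"
    by (rule sum.UNION_disjoint) (use S p dis in auto)
  have "card (\<Union>c\<in>S. f c) = (\<Sum>c\<in>S. card (f c))"
    by (rule card_UN_disjoint) (use S p dis in auto)
  then show "card (\<Union>c\<in>S. f c) = card S * 2 ^ (k - 6)" using p by simp
qed

lemma skel_props:
  assumes "S \<in> skel k d a" "2 \<le> k"
  shows "finite S \<and> separated S \<and> card S = (2 ^ (k - 6)) ^ d"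
  using assms(1)
proof (induction d arbitrary: S)
  case 0
  then show ?case by (simp add: separated_def)
next
  case (Suc d)
  then obtain S' f where S': "S' \<in> skel k d a" "f \<in> Pi\<^sub>E S' (children k)" "S = (\<Union>c\<in>S'. f c)"
    by auto
  note IH = Suc.IH[OF S'(1)]
  have f: "\<And>c. c \<in> S' \<Longrightarrow> f c \<in> children k c" using S'(2) by (auto simp: PiE_mem)
  show ?case using union_children[OF _ _ f, of S'] IH assms(2) by (simp add: S'(3))
qed

lemma geometric_nat_bound:
  fixes q :: nat
  assumes "2 \<le> q"
  shows "q * (\<Sum>i<d. q ^ i) \<le> 2 * q ^ d"
proof (induction d)
  case (Suc d)
  have "q * (\<Sum>i<Suc d. q ^ i) \<le> 2 * q ^ d + q * q ^ d" using Suc by (simp add: distrib_left)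
  also have "2 * q ^ d \<le> q * q ^ d" using assms by (rule mult_right_mono) simp
  finally show ?case by (simp only: power_Suc mult_2)
qed simp

lemma finite_skel: "2 \<le> k \<Longrightarrow> finite (skel k d a)"
proof (induction d)
  case (Suc d)
  have "finite (Pi\<^sub>E S (children k))" if "S \<in> skel k d a" for S
    using skel_props[OF that Suc.prems] by (intro finite_PiE finite_children) auto
  then show ?case using Suc by auto
qed simp

lemma card_skel_aux: "2 \<le> k \<Longrightarrow> card (skel k d a) \<le> (72 ^ 2 ^ k) ^ (\<Sum>i<d. (2 ^ (k - 6)) ^ i)"
proof (induction d)
  case (Suc d)
  let ?C = "72 ^ 2 ^ k :: nat" and ?q = "2 ^ (k - 6) :: nat"
  have "card (skel k (Suc d) a) \<le> (\<Sum>S\<in>skel k d a. card ((\<lambda>f. \<Union>c\<in>S. f c) ` (Pi\<^sub>E S (children k))))"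
    unfolding skel.simps by (rule card_UN_le[OF finite_skel[OF Suc.prems]])
  also have "\<dots> \<le> (\<Sum>S\<in>skel k d a. ?C ^ (?q ^ d))"
  proof (rule sum_mono)
    fix S assume S: "S \<in> skel k d a"
    note p = skel_props[OF S Suc.prems]
    have "card ((\<lambda>f. \<Union>c\<in>S. f c) ` (Pi\<^sub>E S (children k))) \<le> card (Pi\<^sub>E S (children k))"
      using p by (intro card_image_le finite_PiE finite_children) auto
    also have "\<dots> = (\<Prod>c\<in>S. card (children k c))" using p by (simp add: card_PiE)
    also have "\<dots> \<le> (\<Prod>c\<in>S. ?C)" by (rule prod_mono) (use card_children in auto)
    also have "\<dots> = ?C ^ (?q ^ d)" using p by simp
    finally show "card ((\<lambda>f. \<Union>c\<in>S. f c) ` (Pi\<^sub>E S (children k))) \<le> ?C ^ (?q ^ d)" .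
  qed
  also have "\<dots> = card (skel k d a) * ?C ^ (?q ^ d)" by simp
  also have "\<dots> \<le> ?C ^ (\<Sum>i<d. ?q ^ i) * ?C ^ (?q ^ d)"
    by (rule mult_right_mono) (use Suc in auto)
  also have "\<dots> = ?C ^ (\<Sum>i<Suc d. ?q ^ i)" by (simp add: power_add)
  finally show ?case .
qed simp

text \<open>With \<open>q = 2^(k-6)\<close>, generation \<open>i + 1\<close> has \<open>q^i\<close>
  parents with at most \<open>72^(2^k)\<close> choices each, and \<open>2^k = 64 * q\<close>. The
  geometric series bounds the total exponent by \<open>128 * q^d\<close>: exponential in the size of
  the skeleton, with a base free of \<open>k\<close>.\<close>

lemma card_skel:
  assumes "7 \<le> k"
  shows "card (skel k d a) \<le> 72 ^ (128 * (2 ^ (k - 6)) ^ d)"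
proof -
  let ?q = "2 ^ (k - 6) :: nat"
  have q: "2 \<le> ?q" using power_increasing[of 1 "k - 6" "2::nat"] assms by simp
  have K: "2 ^ k = 64 * ?q"
    using assms power_add[of "2::nat" 6 "k - 6"] by simp
  have "2 ^ k * (\<Sum>i<d. ?q ^ i) = 64 * (?q * (\<Sum>i<d. ?q ^ i))" by (simp add: K)
  also have "\<dots> \<le> 64 * (2 * ?q ^ d)" by (rule mult_left_mono[OF geometric_nat_bound[OF q]]) simp
  finally have e: "2 ^ k * (\<Sum>i<d. ?q ^ i) \<le> 128 * ?q ^ d" by simp
  have "card (skel k d a) \<le> 72 ^ (2 ^ k * (\<Sum>i<d. ?q ^ i))"
    using card_skel_aux[of k d a] assms by (simp add: power_mult)
  also have "\<dots> \<le> 72 ^ (128 * ?q ^ d)" by (rule power_increasing[OF e]) simp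
  finally show ?thesis .
qed

section \<open>Extraction of a skeleton from a star-connected set\<close>

lemma star_path_distinct_chain:
  assumes "(star_step X)\<^sup>*\<^sup>* a b" "a \<in> X"
  shows "\<exists>L. L \<noteq> [] \<and> distinct L \<and> last L = a \<and> hd L = b \<and> set L \<subseteq> X \<and> star_chain L"
  using assms(1)
proof (induction rule: rtranclp_induct)
  case base
  then show ?case using assms(2) by (intro exI[of _ "[a]"]) simp
next
  case (step b c)
  then obtain L where L: "L \<noteq> []" "distinct L" "last L = a" "hd L = b" "set L \<subseteq> X" "star_chain L" by blast
  show ?case
  proof (cases "c \<in> set L")
    case True
    \<comment> \<open>Loop erasure: the newest vertex is at the head, and a return to
      \<open>c\<close> cuts the list back to the earlier visit. Distinctness later turns the length
      of the list into a number of cells.\<close>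
    then obtain L1 L2 where "L = L1 @ c # L2" by (meson split_list)
    then show ?thesis using L by (intro exI[of _ "c # L2"]) (auto simp: successively_append_iff)
  next
    case False
    have "cheb c b \<le> 1" "c \<in> X" using step(2) by (auto simp: star_step_def cheb_commute)
    then show ?thesis using L False by (intro exI[of _ "c # L"]) (auto simp: successively_Cons)
  qed
qed

lemma abs_div_le_1:
  fixes x y n :: int
  assumes "\<bar>x - y\<bar> \<le> 1" "0 < n"
  shows "\<bar>x div n - y div n\<bar> \<le> 1"
proof -
  have "x div n \<le> y div n + 1" if "x \<le> y + 1" for x y
  proof -
    have "x div n \<le> (y + n) div n" using that assms(2) by (intro zdiv_mono1) auto
    then show ?thesis using assms(2) by simp
  qed
  from this[of x y] this[of y x] assms(1) show ?thesis by linarith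
qed

lemma cheb_cellv_le_1: "cheb x y \<le> 1 \<Longrightarrow> cheb (cellv s x) (cellv s y) \<le> 1"
  by (simp add: cheb_le_iff cellv_def abs_div_le_1)

text \<open>Points in cells at index distance d are less than (d + 1) 2^s apart. The
  \<open>- 1\<close> in the conclusion fits a chain whose ends, being 2^k - 1 apart, force at least
  2^k entries.\<close>

lemma cheb_cellv_ge:
  assumes "2 ^ (s + k) - 1 \<le> cheb x y"
  shows "2 ^ k - 1 \<le> cheb (cellv s x) (cellv s y)"
proof -
  have *: "2 ^ k - 1 \<le> \<bar>a - b\<bar>"
    if "2 ^ (s + k) - 1 \<le> \<bar>u - v\<bar>" "2 ^ s * a \<le> u" "u < 2 ^ s * a + 2 ^ s" "2 ^ s * b \<le> v" "v < 2 ^ s * b + 2 ^ s"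
    for u v a b :: int
  proof (rule ccontr)
    assume "\<not> 2 ^ k - 1 \<le> \<bar>a - b\<bar>"
    then have "a - b + 2 \<le> 2 ^ k" "b - a + 2 \<le> 2 ^ k" by linarith+
    then have "2 ^ s * (a - b + 2) \<le> 2 ^ s * 2 ^ k" "2 ^ s * (b - a + 2) \<le> 2 ^ s * 2 ^ k"
      by (auto intro: mult_left_mono)
    then have "2 ^ s * a - 2 ^ s * b + 2 * 2 ^ s \<le> 2 ^ (s + k)" "2 ^ s * b - 2 ^ s * a + 2 * 2 ^ s \<le> 2 ^ (s + k)"
      by (simp_all add: power_add algebra_simps)
    moreover have "(1::int) \<le> 2 ^ s" by simp
    ultimately show False using that by linarith
  qed
  show ?thesis using assms *[OF _ cellv_bounds(1,2)[where s = s and w = x] cellv_bounds(1,2)[where s = s and w = y]]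
      *[OF _ cellv_bounds(3,4)[where s = s and w = x] cellv_bounds(3,4)[where s = s and w = y]]
    by (auto simp: cheb_ge_iff)
qed

text \<open>Pigeonhole over the 64 residue classes modulo 8: distinct points of one class differ by
  at least 8 in some coordinate. This is the source of the exponent \<open>k - 6\<close>.\<close>

lemma separated_subset_exists:
  assumes "finite X" "card X = 64 * q" "0 < q"
  shows "\<exists>T\<subseteq>X. card T = q \<and> separated T"
proof -
  define h where "h c = (fst c mod 8, snd c mod 8)" for c :: vtx
  let ?R = "{0..<8::int} \<times> {0..<8::int}"
  have "\<exists>r\<in>?R. q \<le> card {c \<in> X. h c = r}"
  proof (rule ccontr)
    assume "\<not> ?thesis"
    then have less: "card {c \<in> X. h c = r} \<le> q - 1" if "r \<in> ?R" for r using that by force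
    have "card X \<le> card (\<Union>r\<in>?R. {c \<in> X. h c = r})"
      by (rule card_mono) (use assms(1) in \<open>auto simp: h_def\<close>)
    also have "\<dots> \<le> (\<Sum>r\<in>?R. card {c \<in> X. h c = r})" by (rule card_UN_le) simp
    also have "\<dots> \<le> (\<Sum>r\<in>?R. q - 1)" by (rule sum_mono) (rule less)
    also have "\<dots> = 64 * (q - 1)" by (simp add: card_cartesian_product)
    finally show False using assms by simp
  qed
  then obtain r where "q \<le> card {c \<in> X. h c = r}" by blast
  then obtain T where T: "T \<subseteq> {c \<in> X. h c = r}" "card T = q"
    by (meson obtain_subset_with_card_n)
  have "separated T" unfolding separated_def
  proof (intro ballI impI)
    fix c c' assume c: "c \<in> T" "c' \<in> T" "c \<noteq> c'"
    have far: "8 \<le> \<bar>x - y\<bar>" if "x mod 8 = y mod 8" "x \<noteq> y" for x y :: int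
      using that by presburger
    have "fst c mod 8 = fst c' mod 8" "snd c mod 8 = snd c' mod 8" using T c by (auto simp: h_def)
    moreover have "fst c \<noteq> fst c' \<or> snd c \<noteq> snd c'" using c by (auto simp: prod_eq_iff)
    ultimately show "8 \<le> cheb c c'" using far by (auto simp: cheb_ge_iff)
  qed
  then show ?thesis using T by blast
qed

text \<open>Because of the \<open>- 1\<close>, \<open>active W 0 c\<close> means just
  \<open>c \<in> W\<close>, so the descent through the scales ends in points of
  \<open>W\<close>.\<close>

definition active :: "vtx set \<Rightarrow> nat \<Rightarrow> vtx \<Rightarrow> bool" where
  "active W s c \<longleftrightarrow> (\<exists>y\<in>W. \<exists>z. cellv s y = c \<and> (star_step W)\<^sup>*\<^sup>* y z \<and> 2 ^ s - 1 \<le> cheb y z)"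

lemma nbh_children_subset:
  assumes "T \<in> children k a" "c \<in> T" "2 \<le> k"
  shows "nbh s c \<subseteq> nbh (s + k) a"
proof
  fix w assume "w \<in> nbh s c"
  then have w: "\<bar>fst w - 2 ^ s * fst c\<bar> \<le> 3 * 2 ^ s" "\<bar>snd w - 2 ^ s * snd c\<bar> \<le> 3 * 2 ^ s"
    by (auto simp: nbh_def cheb_le_iff)
  have K: "(4::int) \<le> 2 ^ k" using power_increasing[OF assms(3), of "2::int"] by simp
  have *: "\<bar>x - 2 ^ (s + k) * b\<bar> \<le> 3 * 2 ^ (s + k)"
    if "\<bar>x - 2 ^ s * y\<bar> \<le> 3 * 2 ^ s" "2 ^ k * b - 2 ^ k < y" "y < 2 ^ k * b + 2 * 2 ^ k" for x y b :: int
  proof -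
    have "2 ^ s * (y - 2 ^ k * b) \<le> 2 ^ s * (3 * 2 ^ k - 3)" "2 ^ s * (2 ^ k * b - y) \<le> 2 ^ s * (3 * 2 ^ k - 3)"
      using that K by (auto intro!: mult_left_mono)
    then have "2 ^ s * y - 2 ^ (s + k) * b \<le> 3 * 2 ^ (s + k) - 3 * 2 ^ s"
      "2 ^ (s + k) * b - 2 ^ s * y \<le> 3 * 2 ^ (s + k) - 3 * 2 ^ s"
      by (simp_all add: power_add algebra_simps)
    then show ?thesis using that(1) by linarith
  qed
  show "w \<in> nbh (s + k) a"
    unfolding nbh_def mem_Collect_eq cheb_le_iff fst_conv snd_conv
    using *[OF w(1) children_near(1,2)[OF assms(1,2)]] *[OF w(2) children_near(3,4)[OF assms(1,2)]] by blast
qed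

text \<open>A path from \<open>y\<close> to \<open>z\<close> meets at least 2^k distinct subcells,
  of which a separated 64th is kept. Every subcell met is active again: \<open>y\<close> and
  \<open>z\<close> cannot both be near a point \<open>x\<close> on the path, and \<open>x\<close> is
  connected to both.\<close>

lemma active_children:
  assumes "active W (s + k) a" "7 \<le> k"
  shows "\<exists>T\<in>children k a. \<forall>c\<in>T. active W s c"
proof -
  obtain y z where yz: "y \<in> W" "cellv (s + k) y = a" "(star_step W)\<^sup>*\<^sup>* y z" "2 ^ (s + k) - 1 \<le> cheb y z"
    using assms(1) by (auto simp: active_def)
  define X where "X = cellv s ` {x. (star_step W)\<^sup>*\<^sup>* y x}"
  have "(star_step X)\<^sup>*\<^sup>* (cellv s y) (cellv s z)"
    using yz(3)
  proof (induction rule: rtranclp_induct)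
    case (step u v)
    then have "star_step X (cellv s u) (cellv s v)"
      unfolding star_step_def X_def
      by (auto intro!: cheb_cellv_le_1 imageI intro: rtranclp.rtrancl_into_rtrancl simp: star_step_def)
    with step.IH show ?case by (rule rtranclp.rtrancl_into_rtrancl)
  qed simp
  then obtain L where L: "L \<noteq> []" "distinct L" "last L = cellv s y" "hd L = cellv s z" "set L \<subseteq> X" "star_chain L"
    using star_path_distinct_chain[of X "cellv s y" "cellv s z"] by (auto simp: X_def)
  have "2 ^ k - 1 \<le> cheb (cellv s y) (cellv s z)" by (rule cheb_cellv_ge[OF yz(4)])
  also have "\<dots> \<le> int (length L) - 1"
    using star_chain_cheb[OF L(6,1)] L(3,4) by (simp add: cheb_commute)
  finally have "(2::int) ^ k \<le> int (length L)" by linarith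
  then have "int (2 ^ k) \<le> int (length L)" by (simp only: of_nat_power of_nat_numeral)
  then have len: "2 ^ k \<le> length L" by (simp only: of_nat_le_iff)
  \<comment> \<open>The list runs backwards: dropping entries at its front keeps the 2^k cells
    nearest to the start, with the start cell still last.\<close>
  define L' where "L' = drop (length L - 2 ^ k) L"
  have L': "length L' = 2 ^ k" "distinct L'" "last L' = cellv s y" "set L' \<subseteq> X" "star_chain L'"
  proof -
    show "length L' = 2 ^ k" using len by (simp add: L'_def)
    show "distinct L'" using L by (simp add: L'_def)
    show "last L' = cellv s y" using len L by (simp add: L'_def last_drop)
    show "set L' \<subseteq> X" using L set_drop_subset[of "length L - 2 ^ k" L] by (auto simp: L'_def)
    show "star_chain L'"
      using L(6) append_take_drop_id[of "length L - 2 ^ k" L] successively_append_iff unfolding L'_def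
      by metis
  qed
  have K: "(2::nat) ^ k = 64 * 2 ^ (k - 6)" using assms(2) power_add[of "2::nat" 6 "k - 6"] by simp
  have "card (set L') = 64 * 2 ^ (k - 6)" using L' K by (simp add: distinct_card)
  then obtain T where T: "T \<subseteq> set L'" "card T = 2 ^ (k - 6)" "separated T"
    using separated_subset_exists[of "set L'" "2 ^ (k - 6)"] by auto
  have "T \<in> children k a"
    unfolding children_def mem_Collect_eq
    by (intro exI[of _ L']) (use L' T yz(2) in \<open>auto simp: cellv_add\<close>)
  moreover have "active W s c" if "c \<in> T" for c
  proof -
    have "c \<in> X" using that T L' by blast
    then obtain x where x: "(star_step W)\<^sup>*\<^sup>* y x" "c = cellv s x" by (auto simp: X_def)
    have xy: "(star_step W)\<^sup>*\<^sup>* x y" by (rule star_path_sym[OF x(1)])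
    have xz: "(star_step W)\<^sup>*\<^sup>* x z" using xy yz(3) by (rule rtranclp_trans)
    have "2 ^ (s + k) - 1 \<le> cheb x y + cheb x z"
      using yz(4) cheb_triangle[of y z x] by (simp add: cheb_commute)
    moreover have "2 * 2 ^ s \<le> (2::int) ^ (s + k)"
      using power_increasing[of "Suc s" "s + k" "2::int"] assms(2) by simp
    ultimately have "2 ^ s - 1 \<le> cheb x y \<or> 2 ^ s - 1 \<le> cheb x z" by linarith
    then show ?thesis
      unfolding active_def using x xy xz star_path_mem[OF x(1) yz(1)] by blast
  qed
  ultimately show ?thesis by blast
qed

text \<open>Taking minima over neighbourhoods makes the average monotone under refinement: the
  neighbourhoods of children lie in that of the parent, and all cells have equally many children. A
  bound on a coarse skeleton is inherited by its refinements.\<close>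

definition avg_min :: "nat \<Rightarrow> vtx set \<Rightarrow> (vtx \<Rightarrow> real) \<Rightarrow> real" where
  "avg_min s S g = (\<Sum>c\<in>S. Min (g ` nbh s c)) / real (card S)"

lemma avg_min_children:
  assumes S: "finite S" "separated S" and f: "\<And>c. c \<in> S \<Longrightarrow> f c \<in> children k c" and k: "2 \<le> k"
  shows "avg_min (s + k) S g \<le> avg_min s (\<Union>c\<in>S. f c) g"
proof -
  let ?q = "2 ^ (k - 6) :: nat"
  note u = union_children[OF S f k, simplified]
  have "(\<Sum>c\<in>S. Min (g ` nbh (s + k) c)) * real ?q = (\<Sum>c\<in>S. \<Sum>c'\<in>f c. Min (g ` nbh (s + k) c))"
    using children_props(2)[OF f] by (simp add: sum_distrib_left mult.commute)
  also have "\<dots> \<le> (\<Sum>c\<in>S. \<Sum>c'\<in>f c. Min (g ` nbh s c'))"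
    by (intro sum_mono Min_antimono image_mono nbh_children_subset[OF f] k) auto
  also have "\<dots> = (\<Sum>c\<in>(\<Union>c\<in>S. f c). Min (g ` nbh s c))" using u(3) by simp
  finally have "(\<Sum>c\<in>S. Min (g ` nbh (s + k) c)) * real ?q / (real (card S) * real ?q) \<le>
      (\<Sum>c\<in>(\<Union>c\<in>S. f c). Min (g ` nbh s c)) / (real (card S) * real ?q)"
    by (rule divide_right_mono) simp
  then show ?thesis unfolding avg_min_def using u(4) by simp
qed

text \<open>The induction keeps the ancestor skeleton of every earlier generation \<open>e\<close>,
  so that each level of the field can be estimated at its own scale.\<close>

lemma skeleton_exists_aux:
  assumes act: "active W (J * k) a" and k: "7 \<le> k" and d: "d \<le> J"
  shows "\<exists>S\<in>skel k d a. (\<forall>c\<in>S. active W ((J - d) * k) c) \<and>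
    (\<forall>e\<le>d. \<exists>S'\<in>skel k e a. \<forall>g. avg_min ((J - e) * k) S' g \<le> avg_min ((J - d) * k) S g)"
  using d
proof (induction d)
  case 0
  then show ?case using act by auto
next
  case (Suc d)
  then obtain S where S: "S \<in> skel k d a" "\<And>c. c \<in> S \<Longrightarrow> active W ((J - d) * k) c"
    "\<And>e. e \<le> d \<Longrightarrow> \<exists>S'\<in>skel k e a. \<forall>g. avg_min ((J - e) * k) S' g \<le> avg_min ((J - d) * k) S g"
    by auto
  have k2: "2 \<le> k" using k by simp
  have J: "(J - d) * k = (J - Suc d) * k + k"
    using Suc.prems by (metis Suc_diff_Suc Suc_le_lessD add.commute mult_Suc)
  have "\<forall>c\<in>S. \<exists>T\<in>children k c. \<forall>c'\<in>T. active W ((J - Suc d) * k) c'"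
    using active_children[OF _ k] S(2) J by simp
  then obtain f0 where f0: "\<And>c. c \<in> S \<Longrightarrow> f0 c \<in> children k c \<and> (\<forall>c'\<in>f0 c. active W ((J - Suc d) * k) c')"
    by metis
  define f where "f = restrict f0 S"
  have f: "\<And>c. c \<in> S \<Longrightarrow> f c \<in> children k c" "f \<in> Pi\<^sub>E S (children k)" using f0 by (auto simp: f_def)
  define S1 where "S1 = (\<Union>c\<in>S. f c)"
  have S1: "S1 \<in> skel k (Suc d) a" unfolding S1_def skel.simps using S(1) f(2) by blast
  note p = skel_props[OF S(1) k2]
  have le: "avg_min ((J - d) * k) S g \<le> avg_min ((J - Suc d) * k) S1 g" for g
    unfolding S1_def J by (rule avg_min_children) (use p f k2 in auto)
  show ?case
  proof (intro bexI[OF _ S1] conjI ballI allI impI)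
    fix c assume "c \<in> S1"
    then show "active W ((J - Suc d) * k) c" using f0 by (auto simp: S1_def f_def)
  next
    fix e assume e: "e \<le> Suc d"
    show "\<exists>S'\<in>skel k e a. \<forall>g. avg_min ((J - e) * k) S' g \<le> avg_min ((J - Suc d) * k) S1 g"
    proof (cases "e = Suc d")
      case True
      then show ?thesis using S1 by auto
    next
      case False
      then obtain S' where "S' \<in> skel k e a" "\<forall>g. avg_min ((J - e) * k) S' g \<le> avg_min ((J - d) * k) S g"
        using S(3)[of e] e by auto
      then show ?thesis using le by (meson order_trans)
    qed
  qed
qed

text \<open>Level \<open>i\<close> is compared with the ancestor skeleton of cells of side 2^(i k),
  whose candidates are exponential in its own size. The candidates for \<open>S\<close> itself would
  be too many for the number of independent cells at scale \<open>i\<close>.\<close>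

lemma skeleton_exists:
  assumes act: "active W (J * k) a" and k: "7 \<le> k"
  obtains S where "finite S" "S \<subseteq> W" "card S = (2 ^ (k - 6)) ^ J"
    "\<And>i. i \<le> J \<Longrightarrow> \<exists>S'\<in>skel k (J - i) a. \<forall>g. avg_min (i * k) S' g \<le> (\<Sum>w\<in>S. g w) / real (card S)"
proof -
  obtain S where S: "S \<in> skel k J a" "\<And>c. c \<in> S \<Longrightarrow> active W 0 c"
    "\<And>e. e \<le> J \<Longrightarrow> \<exists>S'\<in>skel k e a. \<forall>g. avg_min ((J - e) * k) S' g \<le> avg_min 0 S g"
    using skeleton_exists_aux[OF act k, of J] by auto
  have k2: "2 \<le> k" using k by simp
  have p: "finite S" "card S = (2 ^ (k - 6)) ^ J" using skel_props[OF S(1) k2] by auto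
  have "avg_min 0 S g \<le> (\<Sum>w\<in>S. g w) / real (card S)" for g
    unfolding avg_min_def
  proof (intro divide_right_mono sum_mono)
    fix c
    have "c \<in> nbh 0 c" by (simp add: nbh_def)
    then show "Min (g ` nbh 0 c) \<le> g c" by (intro Min_le) auto
  qed simp
  then have "\<exists>S'\<in>skel k (J - i) a. \<forall>g. avg_min (i * k) S' g \<le> (\<Sum>w\<in>S. g w) / real (card S)" if "i \<le> J" for i
    using S(3)[of "J - i"] that by (metis diff_diff_cancel diff_le_self order_trans)
  moreover have "S \<subseteq> W" using S(2) by (auto simp: active_def)
  ultimately show ?thesis using p that by blast
qed

subsection \<open>Chaining bound for one level\<close>

text \<open>Jensen's inequality for weights of total mass at most 1: the missing mass is placed at
  the value 0 and is paid for by the summand 1.\<close>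

lemma exp_weighted_le:
  fixes q x :: "'a \<Rightarrow> real"
  assumes "finite A" "\<And>a. a \<in> A \<Longrightarrow> 0 \<le> q a" "(\<Sum>a\<in>A. q a) \<le> 1"
  shows "exp (\<Sum>a\<in>A. q a * x a) \<le> 1 + (\<Sum>a\<in>A. q a * exp (x a))"
proof -
  define y where "y = (\<Sum>a\<in>A. q a * x a)"
  define Q where "Q = (\<Sum>a\<in>A. q a)"
  have tangent: "exp y * (1 + z - y) \<le> exp z" for z
  proof -
    have "exp y * (1 + (z - y)) \<le> exp y * exp (z - y)" by (intro mult_left_mono exp_ge_add_one_self) auto
    then show ?thesis by (simp add: exp_diff algebra_simps)
  qed
  have "(\<Sum>a\<in>A. q a * (exp y * (1 + x a - y))) \<le> (\<Sum>a\<in>A. q a * exp (x a))"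
    by (intro sum_mono mult_left_mono tangent assms)
  moreover have "(\<Sum>a\<in>A. q a * (exp y * (1 + x a - y))) = exp y * (Q + y - Q * y)"
  proof -
    have "q a * (exp y * (1 + x a - y)) = (exp y * (1 - y)) * q a + exp y * (q a * x a)" for a
      by (simp add: algebra_simps)
    then have "(\<Sum>a\<in>A. q a * (exp y * (1 + x a - y))) = (exp y * (1 - y)) * Q + exp y * y"
      by (simp add: sum.distrib Q_def y_def flip: sum_distrib_left)
    then show ?thesis by (simp add: algebra_simps)
  qed
  moreover have "(1 - Q) * (exp y * (1 + 0 - y)) \<le> (1 - Q) * exp 0"
    by (intro mult_left_mono tangent) (use assms(3) in \<open>simp add: Q_def\<close>)
  moreover have "(1 - Q) * exp 0 \<le> 1"
    using assms(2) by (simp add: Q_def sum_nonneg)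
  moreover have "exp y * (Q + y - Q * y) + (1 - Q) * (exp y * (1 + 0 - y)) = exp y"
    by (simp add: algebra_simps)
  ultimately show ?thesis unfolding y_def[symmetric] by linarith
qed

text \<open>A geometric law. Its ratio 3/4 exceeds 1/sqrt 2, so increments with variance of order
  2^(-r), divided by the weight, have variance of order \<open>(8/9)^r\<close>, still bounded; its
  mean 3 controls the cost of the net sizes.\<close>

definition chain_q :: "nat \<Rightarrow> real" where
  "chain_q r = (1 / 4) * (3 / 4) ^ r"

lemma chain_q_pos: "0 < chain_q r"
  by (simp add: chain_q_def)

lemma sum_chain_q: "(\<Sum>r<n. chain_q r) = 1 - (3 / 4) ^ n"
  by (induction n) (simp_all add: chain_q_def)

lemma sum_chain_q_index: "(\<Sum>r<n. real r * chain_q r) = 3 - (real n + 3) * (3 / 4) ^ n"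
  by (induction n) (simp_all add: chain_q_def field_simps)

definition dyad :: "nat \<Rightarrow> vtx \<Rightarrow> vtx" where
  "dyad t w = (2 ^ t * (fst w div 2 ^ t), 2 ^ t * (snd w div 2 ^ t))"

lemma dyad_0 [simp]: "dyad 0 w = w"
  by (simp add: dyad_def)

lemma dyad_Suc_dyad: "dyad (Suc t) (dyad t w) = dyad (Suc t) w"
proof -
  have "2 ^ t * (x div 2 ^ t) div (2 ^ t * 2) = x div (2 ^ t * 2)" for x :: int
    by (simp add: zdiv_zmult2_eq)
  then show ?thesis by (simp add: dyad_def mult.commute)
qed

lemma dyad_bounds:
  "fst w - 2 ^ t < fst (dyad t w)" "fst (dyad t w) \<le> fst w"
  "snd w - 2 ^ t < snd (dyad t w)" "snd (dyad t w) \<le> snd w"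
  using cellv_bounds[where s = t and w = w] by (auto simp: dyad_def cellv_def)

text \<open>Chaining: \<open>psi\<close> at a point is telescoped along its dyadic approximations; level \<open>r\<close> has at most
  \<open>49 * 4^r\<close> increments, of variance of order \<open>k / 2^r\<close>, and gets the weight \<open>chain_q r\<close>.\<close>

definition net :: "nat \<Rightarrow> nat \<Rightarrow> vtx \<Rightarrow> vtx set" where
  "net s r c = dyad (s - r) ` nbh s c"

text \<open>\<open>None\<close> carries the constant summand 1 of
  \<open>exp_weighted_le\<close>.\<close>

definition chain_index :: "nat \<Rightarrow> vtx \<Rightarrow> (nat \<times> vtx) option set" where
  "chain_index s c = insert None (Some ` (SIGMA r:{..s}. net s r c))"

text \<open>3136 = 49 * 4^3 is the exponential of the mean of \<open>ln (49 * 4^r)\<close> when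
  \<open>r\<close> has law \<open>chain_q\<close>, whose mean is 3.\<close>

definition chain_weight :: "(nat \<times> vtx) option \<Rightarrow> real" where
  "chain_weight a = (case a of None \<Rightarrow> 3136 | Some (r, w) \<Rightarrow> 3136 * (chain_q r / (49 * 4 ^ r)))"

text \<open>Coefficients of the increment from the parent of \<open>w\<close> in the dyadic chain to
  \<open>w\<close>, divided by \<open>chain_q r\<close> so that the weighted sum telescopes back to
  \<open>l * psi\<close>. At \<open>r = 0\<close> there is no parent. \<open>chain_exp\<close> is
  the corresponding value.\<close>

definition chain_coef :: "nat \<Rightarrow> nat \<Rightarrow> real \<Rightarrow> (nat \<times> vtx) option \<Rightarrow> nat \<times> int \<times> int \<Rightarrow> real" where
  "chain_coef k j l a i = (case a of None \<Rightarrow> 0 | Some (r, w) \<Rightarrow>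
     (l / chain_q r) * psic k j w i +
     (if r = 0 then 0 else - (l / chain_q r)) * psic k j (dyad (Suc (j * k - r)) w) i)"

definition chain_exp :: "nat \<Rightarrow> nat \<Rightarrow> real \<Rightarrow> sample \<Rightarrow> (nat \<times> vtx) option \<Rightarrow> real" where
  "chain_exp k j l \<omega> a = (case a of None \<Rightarrow> 0 | Some (r, w) \<Rightarrow>
     (l / chain_q r) * psi k \<omega> j w +
     (if r = 0 then 0 else - (l / chain_q r)) * psi k \<omega> j (dyad (Suc (j * k - r)) w))"

text \<open>A finite positive combination of exponentials of Gaussians that dominates
  \<open>exp (l * psi)\<close> on the whole neighbourhood of \<open>c\<close>. In contrast to the
  supremum, its products over separated cells have explicit expectations.\<close>

definition sup_bound :: "nat \<Rightarrow> nat \<Rightarrow> real \<Rightarrow> sample \<Rightarrow> vtx \<Rightarrow> real" where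
  "sup_bound k j l \<omega> c = (\<Sum>a\<in>chain_index (j * k) c. chain_weight a * exp (chain_exp k j l \<omega> a))"

lemma finite_net [simp]: "finite (net s r c)"
  by (simp add: net_def)

lemma finite_chain_index [simp]: "finite (chain_index s c)"
  by (simp add: chain_index_def)

lemma chain_weight_pos: "0 < chain_weight a"
  by (auto simp: chain_weight_def chain_q_pos split: option.split)

lemma sup_bound_pos: "0 < sup_bound k j l \<omega> c"
  unfolding sup_bound_def
  by (rule sum_pos) (auto simp: chain_weight_pos chain_index_def)

lemma sum_chain_index:
  "(\<Sum>a\<in>chain_index s c. f a) = f None + (\<Sum>r\<le>s. \<Sum>w\<in>net s r c. f (Some (r, w)))" for f :: "_ \<Rightarrow> real"
proof -
  have "(\<Sum>a\<in>chain_index s c. f a) = f None + (\<Sum>a\<in>Some ` (SIGMA r:{..s}. net s r c). f a)"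
    unfolding chain_index_def by (rule sum.insert) auto
  also have "(\<Sum>a\<in>Some ` (SIGMA r:{..s}. net s r c). f a) = (\<Sum>p\<in>(SIGMA r:{..s}. net s r c). f (Some p))"
    by (simp add: sum.reindex)
  also have "\<dots> = (\<Sum>r\<le>s. \<Sum>w\<in>net s r c. f (Some (r, w)))"
    by (subst sum.Sigma) (auto simp: case_prod_unfold)
  finally show ?thesis .
qed

text \<open>The telescoped exponent is a \<open>chain_q\<close>-average of scaled increments.
  Subtracting \<open>ln (49 * 4^r)\<close> before applying Jensen's inequality normalises by the
  size of the net; the increment of the chain of \<open>w\<close> is then bounded by the sum over
  all net points.\<close>

lemma exp_psi_le_sup_bound:
  assumes w: "w \<in> nbh (j * k) c"
  shows "exp (l * psi k \<omega> j w) \<le> sup_bound k j l \<omega> c"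
proof -
  define s where "s = j * k"
  define wr where "wr r = dyad (s - r) w" for r
  define e where "e r = chain_exp k j l \<omega> (Some (r, wr r))" for r
  define b where "b r = ln (49 * 4 ^ r :: real)" for r
  have tele: "(\<Sum>r\<le>n. chain_q r * e r) = l * psi k \<omega> j (wr n)" if "n \<le> s" for n
    using that
  proof (induction n)
    case 0
    show ?case using chain_q_pos[of 0] by (simp add: e_def chain_exp_def)
  next
    case (Suc n)
    have d: "s - n = Suc (s - Suc n)" using Suc.prems by simp
    have "dyad (Suc (s - Suc n)) (wr (Suc n)) = wr n"
      unfolding wr_def dyad_Suc_dyad by (simp only: d)
    then have "chain_q (Suc n) * e (Suc n) = l * psi k \<omega> j (wr (Suc n)) - l * psi k \<omega> j (wr n)"
      using chain_q_pos[of "Suc n"] by (simp add: e_def chain_exp_def s_def right_diff_distrib)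
    then show ?case using Suc by simp
  qed
  have ws: "wr s = w" by (simp add: wr_def)
  have q1: "(\<Sum>r\<le>s. chain_q r) \<le> 1"
    using sum_chain_q[of "Suc s"] by (simp add: lessThan_Suc_atMost del: sum.lessThan_Suc)
  have qb: "(\<Sum>r\<le>s. chain_q r * b r) \<le> ln 3136"
  proof -
    have bq: "chain_q r * b r = ln 49 * chain_q r + ln 4 * (real r * chain_q r)" for r
      by (simp add: b_def ln_mult ln_realpow algebra_simps)
    have "(\<Sum>r\<le>s. chain_q r * b r) = ln 49 * (\<Sum>r\<le>s. chain_q r) + ln 4 * (\<Sum>r\<le>s. real r * chain_q r)"
      unfolding bq by (simp add: sum.distrib sum_distrib_left)
    also have "\<dots> \<le> ln 49 * 1 + ln 4 * 3"
    proof (intro add_mono mult_left_mono q1)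
      show "(\<Sum>r\<le>s. real r * chain_q r) \<le> 3"
        using sum_chain_q_index[of "Suc s"] by (simp add: lessThan_Suc_atMost del: sum.lessThan_Suc)
    qed auto
    also have "ln 4 * 3 = ln (4 ^ 3 :: real)" by (subst ln_realpow) auto
    also have "ln 49 * 1 + ln (4 ^ 3) = ln (49 * 4 ^ 3 :: real)" by (subst ln_mult) auto
    finally show ?thesis by simp
  qed
  have "l * psi k \<omega> j w = (\<Sum>r\<le>s. chain_q r * e r)" using tele[of s] ws by simp
  also have "\<dots> = (\<Sum>r\<le>s. chain_q r * b r) + (\<Sum>r\<le>s. chain_q r * (e r - b r))"
    by (simp add: sum.distrib[symmetric] algebra_simps)
  finally have "exp (l * psi k \<omega> j w) = exp (\<Sum>r\<le>s. chain_q r * b r) * exp (\<Sum>r\<le>s. chain_q r * (e r - b r))"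
    by (simp add: exp_add)
  also have "\<dots> \<le> 3136 * (1 + (\<Sum>r\<le>s. chain_q r * exp (e r - b r)))"
  proof (rule mult_mono)
    have "exp (\<Sum>r\<le>s. chain_q r * b r) \<le> exp (ln 3136)" using qb by (simp only: exp_le_cancel_iff)
    then show "exp (\<Sum>r\<le>s. chain_q r * b r) \<le> 3136" by simp
    show "exp (\<Sum>r\<le>s. chain_q r * (e r - b r)) \<le> 1 + (\<Sum>r\<le>s. chain_q r * exp (e r - b r))"
      by (rule exp_weighted_le) (use chain_q_pos q1 in \<open>auto intro: less_imp_le\<close>)
  qed auto
  also have "\<dots> \<le> 3136 * (1 + (\<Sum>r\<le>s. \<Sum>v\<in>net s r c. chain_q r / (49 * 4 ^ r) * exp (chain_exp k j l \<omega> (Some (r, v)))))"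
  proof (intro mult_left_mono add_left_mono sum_mono)
    fix r
    have "chain_q r * exp (e r - b r) = chain_q r / (49 * 4 ^ r) * exp (chain_exp k j l \<omega> (Some (r, wr r)))"
      by (simp add: e_def b_def exp_diff)
    also have "\<dots> \<le> (\<Sum>v\<in>net s r c. chain_q r / (49 * 4 ^ r) * exp (chain_exp k j l \<omega> (Some (r, v))))"
      by (rule member_le_sum) (use w chain_q_pos[of r] in \<open>auto simp: net_def wr_def s_def\<close>)
    finally show "chain_q r * exp (e r - b r) \<le> \<dots>" .
  qed simp
  also have "\<dots> = sup_bound k j l \<omega> c"
    unfolding sup_bound_def s_def[symmetric] sum_chain_index
    by (simp add: chain_weight_def chain_exp_def sum_distrib_left algebra_simps)
  finally show ?thesis .
qed

text \<open>A point of the neighbourhood is at most 3 cell sides from the corner; rounding down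
  loses one more side to the left, and so does the corner of a box containing the point: 5 to the
  left, 3 to the right. The width 8 is the distance demanded in \<open>separated\<close>.\<close>

definition chain_supp :: "nat \<Rightarrow> vtx \<Rightarrow> (nat \<times> int \<times> int) set" where
  "chain_supp s c = {s} \<times> ({2 ^ s * (fst c - 5)<..2 ^ s * (fst c + 3)} \<times> {2 ^ s * (snd c - 5)<..2 ^ s * (snd c + 3)})"

lemma finite_chain_supp [simp]: "finite (chain_supp s c)"
  by (simp add: chain_supp_def)

lemma chain_supp_disjoint:
  assumes "8 \<le> cheb c c'"
  shows "chain_supp s c \<inter> chain_supp s c' = {}"
proof -
  have *: "{2 ^ s * (a - 5)<..2 ^ s * (a + 3)} \<inter> {2 ^ s * (b - 5)<..2 ^ s * (b + 3)} = {}"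
    if "8 \<le> \<bar>a - b\<bar>" for a b :: int
  proof -
    have "2 ^ s * (a + 3) \<le> 2 ^ s * (b - 5) \<or> 2 ^ s * (b + 3) \<le> 2 ^ s * (a - 5)"
    proof (cases "a \<le> b")
      case True
      then show ?thesis using that by (intro disjI1 mult_left_mono) auto
    next
      case False
      then show ?thesis using that by (intro disjI2 mult_left_mono) auto
    qed
    then show ?thesis by auto
  qed
  from assms have "8 \<le> \<bar>fst c - fst c'\<bar> \<or> 8 \<le> \<bar>snd c - snd c'\<bar>" by (simp only: cheb_ge_iff)
  then show ?thesis
  proof
    assume "8 \<le> \<bar>fst c - fst c'\<bar>"
    from *[OF this] show ?thesis unfolding chain_supp_def Times_Int_Times by (simp only: Times_empty simp_thms)
  next
    assume "8 \<le> \<bar>snd c - snd c'\<bar>"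
    from *[OF this] show ?thesis unfolding chain_supp_def Times_Int_Times by (simp only: Times_empty simp_thms)
  qed
qed

lemma noise_supp_chain:
  assumes w: "w \<in> nbh (j * k) c" and t: "t \<le> j * k"
  shows "noise_supp k j (dyad t w) \<subseteq> chain_supp (j * k) c"
proof
  fix i assume i: "i \<in> noise_supp k j (dyad t w)"
  define s where "s = j * k"
  have t2: "(2::int) ^ t \<le> 2 ^ s" using t by (simp add: s_def)
  obtain x y where xy: "i = (s, x, y)"
    "fst (dyad t w) - 2 ^ s + 1 \<le> x" "x \<le> fst (dyad t w)"
    "snd (dyad t w) - 2 ^ s + 1 \<le> y" "y \<le> snd (dyad t w)"
    using i by (auto simp: noise_supp_def boxes_eq s_def)
  have "\<bar>fst w - 2 ^ s * fst c\<bar> \<le> 3 * 2 ^ s" "\<bar>snd w - 2 ^ s * snd c\<bar> \<le> 3 * 2 ^ s"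
    using w by (auto simp: nbh_def cheb_le_iff s_def)
  then have "2 ^ s * (fst c - 5) < x" "x \<le> 2 ^ s * (fst c + 3)" "2 ^ s * (snd c - 5) < y" "y \<le> 2 ^ s * (snd c + 3)"
    using dyad_bounds[where t = t and w = w] xy t2 unfolding right_diff_distrib distrib_left by linarith+
  then show "i \<in> chain_supp (j * k) c" by (simp add: chain_supp_def xy(1) s_def[symmetric])
qed

lemma chain_index_cases:
  assumes "a \<in> chain_index (j * k) c"
  obtains "a = None"
    | r w where "a = Some (r, dyad (j * k - r) w)" "r \<le> j * k" "w \<in> nbh (j * k) c"
  using assms by (auto simp: chain_index_def net_def)

lemma chain_noise_supp:
  assumes "r \<le> j * k" "w \<in> nbh (j * k) c"
  shows "noise_supp k j (dyad (j * k - r) w) \<subseteq> chain_supp (j * k) c"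
    and "r \<noteq> 0 \<Longrightarrow> noise_supp k j (dyad (Suc (j * k - r)) (dyad (j * k - r) w)) \<subseteq> chain_supp (j * k) c"
proof -
  show "noise_supp k j (dyad (j * k - r) w) \<subseteq> chain_supp (j * k) c"
    by (rule noise_supp_chain) (use assms in auto)
  show "noise_supp k j (dyad (Suc (j * k - r)) (dyad (j * k - r) w)) \<subseteq> chain_supp (j * k) c" if "r \<noteq> 0"
    unfolding dyad_Suc_dyad by (rule noise_supp_chain) (use assms that in auto)
qed

lemma chain_coef_zero:
  assumes "a \<in> chain_index (j * k) c" "i \<notin> chain_supp (j * k) c"
  shows "chain_coef k j l a i = 0"
  using assms(1)
proof (cases rule: chain_index_cases)
  case (2 r w)
  have "psic k j v i = 0" if "noise_supp k j v \<subseteq> chain_supp (j * k) c" for v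
  proof -
    have "i \<notin> noise_supp k j v" using that assms(2) by blast
    then show ?thesis by (auto simp: psic_def noise_supp_def mem_Times_iff)
  qed
  then show ?thesis using chain_noise_supp[OF 2(2,3)] by (auto simp: 2(1) chain_coef_def)
qed (simp add: chain_coef_def)

lemma chain_exp_eq_lin:
  assumes "finite I" "chain_supp (j * k) c \<subseteq> I" "a \<in> chain_index (j * k) c"
  shows "chain_exp k j l \<omega> a = lin I (chain_coef k j l a) \<omega>"
  using assms(3)
proof (cases rule: chain_index_cases)
  case 1
  then show ?thesis by (simp add: chain_exp_def chain_coef_def lin_def)
next
  case (2 r w)
  let ?x = "dyad (j * k - r) w" and ?y = "dyad (Suc (j * k - r)) (dyad (j * k - r) w)"
  have "chain_coef k j l a = (\<lambda>i. (l / chain_q r) * psic k j ?x i +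
      (if r = 0 then 0 else - (l / chain_q r)) * psic k j ?y i)"
    by (rule ext) (simp add: chain_coef_def 2(1))
  then have "lin I (chain_coef k j l a) \<omega> = (l / chain_q r) * lin I (psic k j ?x) \<omega> +
      (if r = 0 then 0 else - (l / chain_q r)) * lin I (psic k j ?y) \<omega>"
    by (simp only: lin_add lin_scale)
  also have "(l / chain_q r) * lin I (psic k j ?x) \<omega> = (l / chain_q r) * psi k \<omega> j ?x"
    by (subst psi_eq_lin[OF assms(1)]) (use chain_noise_supp[OF 2(2,3)] assms(2) in auto)
  also have "(if r = 0 then 0 else - (l / chain_q r)) * lin I (psic k j ?y) \<omega> =
     (if r = 0 then 0 else - (l / chain_q r)) * psi k \<omega> j ?y"
  proof (cases "r = 0")
    case False
    then show ?thesis
      by (subst psi_eq_lin[OF assms(1)]) (use chain_noise_supp[OF 2(2,3)] assms(2) in auto)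
  qed simp
  finally show ?thesis by (simp add: chain_exp_def 2(1))
qed

text \<open>For \<open>r > 0\<close> the variance is \<open>2 k (l / chain_q r)^2 (1 - ovl)\<close>,
  with \<open>1 - ovl \<le> 4 / 2^r\<close> and squared inverse weight \<open>16 (16/9)^r\<close>,
  in all at most \<open>128 l^2 k (8/9)^r\<close>. The term \<open>r = 0\<close> gives only
  \<open>16 l^2 k\<close>.\<close>

lemma qvar_chain_coef:
  assumes "finite I" "chain_supp (j * k) c \<subseteq> I" "a \<in> chain_index (j * k) c"
  shows "qvar I (chain_coef k j l a) \<le> 128 * l\<^sup>2 * real k"
  using assms(3)
proof (cases rule: chain_index_cases)
  case 1
  then show ?thesis by (simp add: qvar_def chain_coef_def)
next
  case (2 r w)
  let ?x = "dyad (j * k - r) w" and ?y = "dyad (Suc (j * k - r)) (dyad (j * k - r) w)"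
  have cc: "chain_coef k j l a = (\<lambda>i. (l / chain_q r) * psic k j ?x i +
      (if r = 0 then 0 else - (l / chain_q r)) * psic k j ?y i)"
    by (rule ext) (simp add: chain_coef_def 2(1))
  show ?thesis
  proof (cases "r = 0")
    case True
    have "qvar I (chain_coef k j l a) = qvar I (\<lambda>i. (l / chain_q r) * psic k j ?x i + 0 * psic k j ?x i)"
      unfolding cc using True by simp
    also have "\<dots> = real k * ((l / chain_q r)\<^sup>2 + 0\<^sup>2 + 2 * (l / chain_q r) * 0 * ovl (j * k) ?x ?x)"
      by (rule qvar_psic) (use chain_noise_supp[OF 2(2,3)] assms in auto)
    also have "\<dots> = 16 * l\<^sup>2 * real k" by (simp add: True chain_q_def power2_eq_square)
    also have "\<dots> \<le> 128 * l\<^sup>2 * real k" by (intro mult_right_mono) auto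
    finally show ?thesis .
  next
    case False
    have "qvar I (chain_coef k j l a) = qvar I (\<lambda>i. (l / chain_q r) * psic k j ?x i + (- (l / chain_q r)) * psic k j ?y i)"
      unfolding cc using False by simp
    also have "\<dots> = real k * ((l / chain_q r)\<^sup>2 + (- (l / chain_q r))\<^sup>2 + 2 * (l / chain_q r) * (- (l / chain_q r)) * ovl (j * k) ?x ?y)"
      by (rule qvar_psic) (use chain_noise_supp[OF 2(2,3)] False assms in auto)
    also have "\<dots> = 2 * real k * (l / chain_q r)\<^sup>2 * (1 - ovl (j * k) ?x ?y)"
      by (simp add: power2_eq_square algebra_simps)
    also have "\<dots> \<le> 2 * real k * (l / chain_q r)\<^sup>2 * (4 / 2 ^ r)"
    proof (rule mult_left_mono)
      obtain t where t: "j * k = r + t" using 2(2) le_Suc_ex by blast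
      have "cheb ?x ?y \<le> 2 ^ Suc t"
        using dyad_bounds[where t = "Suc (j * k - r)" and w = ?x] by (simp add: cheb_le_iff t)
      then have "real_of_int (cheb ?x ?y) \<le> 2 ^ Suc t"
        by (metis of_int_le_iff of_int_numeral of_int_power)
      then have "2 * real_of_int (cheb ?x ?y) / 2 ^ (j * k) \<le> 2 * 2 ^ Suc t / 2 ^ (j * k)"
        by (intro divide_right_mono mult_left_mono) auto
      also have "\<dots> = 4 / 2 ^ r" by (simp add: t power_add)
      finally show "1 - ovl (j * k) ?x ?y \<le> 4 / 2 ^ r" using ovl_near[of "j * k" ?x ?y] by linarith
    qed simp
    also have "\<dots> = 128 * l\<^sup>2 * real k * (8 / 9) ^ r"
    proof -
      have "(chain_q r)\<^sup>2 = (1 / 16) * (9 / 16) ^ r"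
        by (simp add: chain_q_def power2_eq_square power_mult_distrib[symmetric])
      then have "(chain_q r)\<^sup>2 * (16 * (16 / 9) ^ r) = (1 / 16 * (9 / 16) ^ r) * (16 * (16 / 9) ^ r)"
        by (simp only:)
      also have "\<dots> = 1" by (simp add: power_divide)
      finally have one: "(chain_q r)\<^sup>2 * (16 * (16 / 9) ^ r) = 1" .
      have "(l / chain_q r)\<^sup>2 = l\<^sup>2 * ((chain_q r)\<^sup>2 * (16 * (16 / 9) ^ r)) / (chain_q r)\<^sup>2"
        unfolding one by (simp add: power_divide)
      then have lq: "(l / chain_q r)\<^sup>2 = 16 * l\<^sup>2 * (16 / 9) ^ r"
        using chain_q_pos[of r] by (simp add: mult.left_commute)
      have q89: "(16 / 9) ^ r / 2 ^ r = (8 / 9 :: real) ^ r"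
        by (simp flip: power_divide)
      have "2 * real k * (l / chain_q r)\<^sup>2 * (4 / 2 ^ r) = 128 * l\<^sup>2 * real k * ((16 / 9) ^ r / 2 ^ r)"
        unfolding lq by simp
      then show ?thesis unfolding q89 .
    qed
    also have "\<dots> \<le> 128 * l\<^sup>2 * real k * 1"
      by (intro mult_left_mono power_le_one) auto
    finally show ?thesis by simp
  qed
qed

text \<open>At resolution 2^(s - r) the neighbourhood has at most 6 * 2^r + 1 \<le> 7 * 2^r grid
  values per coordinate.\<close>

lemma card_net:
  assumes "r \<le> s"
  shows "card (net s r c) \<le> 49 * 4 ^ r"
proof -
  let ?A = "\<lambda>x::int. {2 ^ r * x - 3 * 2 ^ r..2 ^ r * x + 3 * 2 ^ r}"
  have "net s r c \<subseteq> (\<lambda>(x, y). (2 ^ (s - r) * x, 2 ^ (s - r) * y)) ` (?A (fst c) \<times> ?A (snd c))"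
  proof
    fix v assume "v \<in> net s r c"
    then obtain w where w: "w \<in> nbh s c" "v = dyad (s - r) w" by (auto simp: net_def)
    have s: "(2::int) ^ s = 2 ^ r * 2 ^ (s - r)" using assms by (simp flip: power_add)
    have *: "x div 2 ^ (s - r) \<in> ?A b" if "\<bar>x - 2 ^ s * b\<bar> \<le> 3 * 2 ^ s" for x b :: int
    proof -
      have "2 ^ (s - r) * (2 ^ r * b - 3 * 2 ^ r) \<le> x" "x \<le> 2 ^ (s - r) * (2 ^ r * b + 3 * 2 ^ r)"
        using that unfolding s by (simp_all add: algebra_simps abs_le_iff)
      then have "(2 ^ (s - r) * (2 ^ r * b - 3 * 2 ^ r)) div 2 ^ (s - r) \<le> x div 2 ^ (s - r)"
        "x div 2 ^ (s - r) \<le> (2 ^ (s - r) * (2 ^ r * b + 3 * 2 ^ r)) div 2 ^ (s - r)"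
        by (simp_all only: zdiv_mono1 zero_less_power zero_less_numeral)
      then show ?thesis by simp
    qed
    have "\<bar>fst w - 2 ^ s * fst c\<bar> \<le> 3 * 2 ^ s" "\<bar>snd w - 2 ^ s * snd c\<bar> \<le> 3 * 2 ^ s"
      using w(1) by (auto simp: nbh_def cheb_le_iff)
    from *[OF this(1)] *[OF this(2)]
    show "v \<in> (\<lambda>(x, y). (2 ^ (s - r) * x, 2 ^ (s - r) * y)) ` (?A (fst c) \<times> ?A (snd c))"
      unfolding w(2) dyad_def by (intro image_eqI[of _ _ "(fst w div 2 ^ (s - r), snd w div 2 ^ (s - r))"]) auto
  qed
  then have "card (net s r c) \<le> card (?A (fst c) \<times> ?A (snd c))"
    by (rule surj_card_le[rotated]) simp
  also have "\<dots> = nat (6 * 2 ^ r + 1) * nat (6 * 2 ^ r + 1)" by (simp add: card_cartesian_product)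
  also have "\<dots> \<le> (7 * 2 ^ r) * (7 * 2 ^ r)"
  proof -
    have "nat (6 * 2 ^ r + 1) = 6 * 2 ^ r + 1" by (simp add: nat_add_distrib nat_mult_distrib nat_power_eq)
    then have "nat (6 * 2 ^ r + 1) \<le> 7 * 2 ^ r" by simp
    then show ?thesis by (intro mult_mono) auto
  qed
  also have "\<dots> = 49 * 4 ^ r" by (simp add: power_mult_distrib[symmetric])
  finally show ?thesis .
qed

text \<open>Separated cells see disjoint noise, so the expectation factorises. The weights of one
  cell sum to 3136 from \<open>None\<close> and at most 3136 from the nets, which gives 6272; 64 is
  half of the variance constant 128.\<close>

lemma
  assumes S: "finite S" "separated S"
  shows integrable_prod_sup_bound: "integrable gauss_space (\<lambda>\<omega>. \<Prod>c\<in>S. sup_bound k j l \<omega> c)" (is ?i)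
    and integral_prod_sup_bound: "(\<integral>\<omega>. (\<Prod>c\<in>S. sup_bound k j l \<omega> c) \<partial>gauss_space) \<le>
      (6272 * exp (64 * l\<^sup>2 * real k)) ^ card S" (is ?e)
proof -
  define s where "s = j * k"
  define I where "I = (\<Union>c\<in>S. chain_supp s c)"
  have I: "finite I" "\<And>c. c \<in> S \<Longrightarrow> chain_supp s c \<subseteq> I" using S by (auto simp: I_def)
  have eq: "(\<Prod>c\<in>S. sup_bound k j l \<omega> c) =
      (\<Prod>c\<in>S. \<Sum>a\<in>chain_index s c. chain_weight a * exp (lin I (chain_coef k j l a) \<omega>))" for \<omega>
    unfolding sup_bound_def s_def
  proof (intro prod.cong sum.cong refl)
    fix c a assume c: "c \<in> S" and a: "a \<in> chain_index (j * k) c"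
    have "chain_exp k j l \<omega> a = lin I (chain_coef k j l a) \<omega>"
      by (rule chain_exp_eq_lin[OF I(1) _ a]) (use I(2)[OF c] in \<open>simp add: s_def\<close>)
    then show "chain_weight a * exp (chain_exp k j l \<omega> a) = chain_weight a * exp (lin I (chain_coef k j l a) \<omega>)"
      by simp
  qed
  have dis: "chain_coef k j l a i = 0 \<or> chain_coef k j l a' i = 0"
    if "c \<in> S" "c' \<in> S" "c \<noteq> c'" "a \<in> chain_index s c" "a' \<in> chain_index s c'" for c c' a a' i
  proof -
    have "chain_supp s c \<inter> chain_supp s c' = {}"
      by (rule chain_supp_disjoint) (use S that in \<open>auto simp: separated_def\<close>)
    then have "i \<notin> chain_supp s c \<or> i \<notin> chain_supp s c'" by blast
    then show ?thesis using that unfolding s_def by (blast intro: chain_coef_zero)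
  qed
  show ?i unfolding eq
    by (rule integrable_prod_sum_exp[OF I(1) S(1) finite_chain_index]) (use dis in blast)
  have "(\<integral>\<omega>. (\<Prod>c\<in>S. sup_bound k j l \<omega> c) \<partial>gauss_space) =
     (\<Prod>c\<in>S. \<Sum>a\<in>chain_index s c. chain_weight a * exp (qvar I (chain_coef k j l a) / 2))"
    unfolding eq by (rule integral_prod_sum_exp[OF I(1) S(1) finite_chain_index]) (use dis in blast)
  also have "\<dots> \<le> (\<Prod>c\<in>S. 6272 * exp (64 * l\<^sup>2 * real k))"
  proof (rule prod_mono, intro conjI)
    fix c assume c: "c \<in> S"
    show "0 \<le> (\<Sum>a\<in>chain_index s c. chain_weight a * exp (qvar I (chain_coef k j l a) / 2))"
      by (rule sum_nonneg) (simp add: chain_weight_pos less_imp_le)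
    have "(\<Sum>a\<in>chain_index s c. chain_weight a * exp (qvar I (chain_coef k j l a) / 2)) \<le>
       (\<Sum>a\<in>chain_index s c. chain_weight a * exp (64 * l\<^sup>2 * real k))"
    proof (intro sum_mono mult_left_mono)
      fix a assume "a \<in> chain_index s c"
      then have "qvar I (chain_coef k j l a) \<le> 128 * l\<^sup>2 * real k"
        using qvar_chain_coef[OF I(1)] I(2)[OF c] by (simp add: s_def)
      then show "exp (qvar I (chain_coef k j l a) / 2) \<le> exp (64 * l\<^sup>2 * real k)" by simp
    qed (simp add: chain_weight_pos less_imp_le)
    also have "\<dots> = (\<Sum>a\<in>chain_index s c. chain_weight a) * exp (64 * l\<^sup>2 * real k)"
      by (simp add: sum_distrib_right)
    also have "\<dots> \<le> 6272 * exp (64 * l\<^sup>2 * real k)"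
    proof (rule mult_right_mono)
      have "(\<Sum>a\<in>chain_index s c. chain_weight a) =
         3136 + (\<Sum>r\<le>s. real (card (net s r c)) * (3136 * (chain_q r / (49 * 4 ^ r))))"
        unfolding sum_chain_index by (simp add: chain_weight_def)
      also have "\<dots> \<le> 3136 + (\<Sum>r\<le>s. (49 * 4 ^ r) * (3136 * (chain_q r / (49 * 4 ^ r))))"
      proof (intro add_left_mono sum_mono mult_right_mono)
        fix r assume "r \<in> {..s}"
        then have "real (card (net s r c)) \<le> real (49 * 4 ^ r)"
          using card_net[of r s c] by (simp only: of_nat_le_iff atMost_iff)
        then show "real (card (net s r c)) \<le> 49 * 4 ^ r" by simp
      qed (simp add: chain_q_pos less_imp_le)
      also have "\<dots> = 3136 + 3136 * (\<Sum>r\<le>s. chain_q r)" by (simp add: sum_distrib_left)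
      also have "\<dots> \<le> 6272"
        using sum_chain_q[of "Suc s"] by (simp add: lessThan_Suc_atMost del: sum.lessThan_Suc)
      finally show "(\<Sum>a\<in>chain_index s c. chain_weight a) \<le> 6272" .
    qed simp
    finally show "(\<Sum>a\<in>chain_index s c. chain_weight a * exp (qvar I (chain_coef k j l a) / 2)) \<le>
      6272 * exp (64 * l\<^sup>2 * real k)" .
  qed
  finally show ?e by simp
qed

subsection \<open>Fluctuations of the field and thick points\<close>

text \<open>Union bound: the sum of the nonnegative \<open>Y n t\<close> is a certificate for all of
  them at once.\<close>

lemma whp_union:
  fixes Y :: "nat \<Rightarrow> 'a \<Rightarrow> sample \<Rightarrow> real"
  assumes fin: "\<And>n. finite (T n)"
    and int: "\<And>n t. t \<in> T n \<Longrightarrow> integrable gauss_space (Y n t)"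
    and nn: "\<And>n t \<omega>. t \<in> T n \<Longrightarrow> 0 \<le> Y n t \<omega>"
    and mean: "\<And>n t. t \<in> T n \<Longrightarrow> (\<integral>\<omega>. Y n t \<omega> \<partial>gauss_space) \<le> c n"
    and card: "\<And>n. real (card (T n)) \<le> N n"
    and c: "\<And>n. 0 \<le> c n" and lim: "(\<lambda>n. N n * c n) \<longlonglongrightarrow> 0"
  shows "whp (\<lambda>n \<omega>. \<forall>t\<in>T n. Y n t \<omega> < 1)"
proof (rule whpI[of "\<lambda>n \<omega>. \<Sum>t\<in>T n. Y n t \<omega>" "\<lambda>n. N n * c n"])
  fix n
  show "integrable gauss_space (\<lambda>\<omega>. \<Sum>t\<in>T n. Y n t \<omega>)"
    by (rule Bochner_Integration.integrable_sum) (rule int)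
  show "0 \<le> (\<Sum>t\<in>T n. Y n t \<omega>)" for \<omega> by (rule sum_nonneg) (rule nn)
next
  have "(\<integral>\<omega>. (\<Sum>t\<in>T n. Y n t \<omega>) \<partial>gauss_space) \<le> N n * c n" for n
  proof -
    have "(\<integral>\<omega>. (\<Sum>t\<in>T n. Y n t \<omega>) \<partial>gauss_space) = (\<Sum>t\<in>T n. \<integral>\<omega>. Y n t \<omega> \<partial>gauss_space)"
      by (rule Bochner_Integration.integral_sum) (rule int)
    also have "\<dots> \<le> (\<Sum>t\<in>T n. c n)" by (rule sum_mono) (rule mean)
    also have "\<dots> \<le> N n * c n" using card[of n] c[of n] by (simp add: mult_right_mono)
    finally show ?thesis .
  qed
  then show "\<forall>\<^sub>F n in sequentially. (\<integral>\<omega>. (\<Sum>t\<in>T n. Y n t \<omega>) \<partial>gauss_space) \<le> N n * c n"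
    by (simp add: always_eventually)
  show "\<forall>\<^sub>F n in sequentially. \<forall>\<omega>. (\<Sum>t\<in>T n. Y n t \<omega>) < 1 \<longrightarrow> (\<forall>t\<in>T n. Y n t \<omega> < 1)"
  proof (intro always_eventually allI impI ballI)
    fix n \<omega> t assume s: "(\<Sum>t\<in>T n. Y n t \<omega>) < 1" and t: "t \<in> T n"
    have "Y n t \<omega> \<le> (\<Sum>t\<in>T n. Y n t \<omega>)" by (rule member_le_sum[OF t _ fin]) (use nn in auto)
    then show "Y n t \<omega> < 1" using s by linarith
  qed
qed (rule lim)

lemma VN_eq_square: "VN n = square 0 0 (2 ^ n)"
  by (simp add: VN_def square_def)

lemma finite_VN [simp]: "finite (VN n)"
  by (simp add: VN_def)

lemma card_VN: "card (VN n) = 4 ^ n"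
  by (simp add: VN_def card_cartesian_product nat_power_eq flip: power_mult_distrib)

lemma levels_le: "k * (n div k) \<le> n" for k n :: nat
  by simp

lemma levels_le_self: "n div k \<le> n" for k n :: nat
  by simp

definition top_levels :: "real \<Rightarrow> nat \<Rightarrow> nat \<Rightarrow> nat" where
  "top_levels \<delta> k n = nat \<lfloor>\<delta> * real (n div k)\<rfloor>"

lemma top_levels_bounds:
  assumes "0 < \<delta>"
  shows "real (top_levels \<delta> k n) \<le> \<delta> * real (n div k)" "\<delta> * real (n div k) < real (top_levels \<delta> k n) + 1"
  using assms by (auto simp: top_levels_def of_nat_nat)

lemma top_levels_le: "0 < \<delta> \<Longrightarrow> \<delta> \<le> 1 \<Longrightarrow> top_levels \<delta> k n \<le> n div k"
  using top_levels_bounds(1)[where \<delta> = \<delta> and k = k and n = n] mult_left_le_one_le[of "real (n div k)" \<delta>] by simp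

lemma top_levels_large:
  assumes "0 < \<delta>" "\<delta> \<le> 1" "k \<ge> 1"
  shows "\<delta> * real n - 2 * real k \<le> real (k * top_levels \<delta> k n)"
proof -
  have "real n \<le> real k * real (n div k) + real k"
  proof -
    have "n \<le> k * (n div k) + k"
      using assms(3) mult_div_mod_eq[of k n] mod_less_divisor[of k n] by linarith
    then show ?thesis by (metis of_nat_add of_nat_le_iff of_nat_mult)
  qed
  then have "\<delta> * real n \<le> \<delta> * (real k * real (n div k) + real k)" using assms by simp
  also have "\<dots> = real k * (\<delta> * real (n div k)) + \<delta> * real k" by (simp add: algebra_simps)
  also have "\<dots> \<le> real k * (real (top_levels \<delta> k n) + 1) + 1 * real k"
    using top_levels_bounds(2)[OF assms(1), where k = k and n = n] assms by (intro add_mono mult_left_mono mult_right_mono) auto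
  finally show ?thesis by (simp add: algebra_simps)
qed

definition crude :: "real \<Rightarrow> nat \<Rightarrow> nat \<Rightarrow> sample \<Rightarrow> bool" where
  "crude \<delta> k n \<omega> \<longleftrightarrow> (\<forall>w\<in>VN n. \<forall>J J'. J \<le> J' \<longrightarrow> J' \<le> n div k \<longrightarrow> J' - J \<le> top_levels \<delta> k n \<longrightarrow>
     \<bar>pphi k J J' \<omega> w\<bar> \<le> 2 * sqrt \<delta> * real n)"

text \<open>Chernoff bound with parameter \<open>2 / sqrt \<delta>\<close>: a variance of at most
  \<delta> n costs exp(2n), the threshold gains exp(-4n), and exp(-2n) beats the 4^n vertices
  because 4 < exp 2. The sign \<sigma> covers both tails.\<close>

lemma whp_crude:
  assumes \<delta>: "0 < \<delta>" and k: "k \<ge> 1"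
  shows "whp (crude \<delta> k)"
proof -
  define T where "T n = {(w, J, J', \<sigma>) \<in> VN n \<times> {..n div k} \<times> {..n div k} \<times> {1, -1::real}. J' - J \<le> top_levels \<delta> k n}" for n
  define \<theta> where "\<theta> = 2 / sqrt \<delta>"
  have \<theta>: "0 < \<theta>" using \<delta> by (simp add: \<theta>_def)
  define Y where "Y n = (\<lambda>(w, J, J', \<sigma>) \<omega>. exp ((\<theta> * \<sigma>) * pphi k J J' \<omega> w) * exp (- (4 * real n)))" for n
  have sub: "T n \<subseteq> VN n \<times> {..n div k} \<times> {..n div k} \<times> {1, -1::real}" for n by (auto simp: T_def)
  have "whp (\<lambda>n \<omega>. \<forall>t\<in>T n. Y n t \<omega> < 1)"
  proof (rule whp_union[where c = "\<lambda>n. exp (- 2 * real n)" and N = "\<lambda>n. 2 * (real n + 1)\<^sup>2 * 4 ^ n"])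
    fix n
    show "finite (T n)" by (rule finite_subset[OF sub]) simp
    have "card (T n) \<le> card (VN n \<times> {..n div k} \<times> {..n div k} \<times> {1, -1::real})"
      by (rule card_mono[OF _ sub]) simp
    also have "\<dots> = 4 ^ n * ((n div k + 1) * ((n div k + 1) * 2))"
      by (simp add: card_cartesian_product card_VN)
    also have "\<dots> \<le> 4 ^ n * ((n + 1) * ((n + 1) * 2))"
      by (intro mult_mono) auto
    finally have "real (card (T n)) \<le> real (4 ^ n * ((n + 1) * ((n + 1) * 2)))" by (simp only: of_nat_le_iff)
    then show "real (card (T n)) \<le> 2 * (real n + 1)\<^sup>2 * 4 ^ n"
      by (simp add: power2_eq_square algebra_simps)
    fix t assume t: "t \<in> T n"
    obtain w J J' \<sigma> where tt: "t = (w, J, J', \<sigma>)" by (cases t) auto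
    show "integrable gauss_space (Y n t)"
      unfolding Y_def tt prod.case by (intro integrable_mult_left integrable_exp_pphi k)
    show "0 \<le> Y n t \<omega>" for \<omega> by (simp add: Y_def tt)
    have \<sigma>: "\<sigma>\<^sup>2 = 1" using t by (auto simp: T_def tt)
    have "real (k * (J' - J)) \<le> real k * (\<delta> * real (n div k))"
      using t top_levels_bounds(1)[OF \<delta>, where k = k and n = n] by (auto simp: T_def tt intro!: mult_left_mono)
    also have "\<dots> = \<delta> * real (k * (n div k))" by simp
    also have "\<dots> \<le> \<delta> * real n"
      using \<delta> by (intro mult_left_mono of_nat_mono levels_le) auto
    finally have "(\<theta> * \<sigma>)\<^sup>2 * real (k * (J' - J)) \<le> (4 / \<delta>) * (\<delta> * real n)"
      using \<delta> unfolding power_mult_distrib \<sigma> by (intro mult_mono) (auto simp: \<theta>_def power_divide)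
    also have "\<dots> = 4 * real n" using \<delta> by simp
    finally have "exp ((\<theta> * \<sigma>)\<^sup>2 * real (k * (J' - J)) / 2) * exp (- (4 * real n)) \<le> exp (- 2 * real n)"
      by (simp flip: exp_add)
    moreover have "(\<integral>\<omega>. Y n t \<omega> \<partial>gauss_space) =
        (\<integral>\<omega>. exp ((\<theta> * \<sigma>) * pphi k J J' \<omega> w) \<partial>gauss_space) * exp (- (4 * real n))"
      unfolding Y_def tt prod.case by (rule integral_mult_left_zero)
    ultimately show "(\<integral>\<omega>. Y n t \<omega> \<partial>gauss_space) \<le> exp (- 2 * real n)"
      by (simp only: integral_exp_pphi[OF k])
  next
    show "(\<lambda>n. 2 * (real n + 1)\<^sup>2 * 4 ^ n * exp (- 2 * real n)) \<longlonglongrightarrow> 0"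
    proof -
      have "(\<lambda>n. 2 * (real n + 1)\<^sup>2 * (4 * exp (-2)) ^ n) \<longlonglongrightarrow> 0"
      proof -
        have "4 * exp (-2) < (1::real)"
        proof -
          have "(5::real) \<le> exp 2" using exp_lower_Taylor_quadratic[of "2::real"] by simp
          then show ?thesis by (simp add: exp_minus field_simps)
        qed
        moreover have "0 < 4 * exp (-2::real)" by simp
        ultimately show ?thesis by real_asymp
      qed
      moreover have "2 * (real n + 1)\<^sup>2 * (4 * exp (-2)) ^ n = 2 * (real n + 1)\<^sup>2 * 4 ^ n * exp (- 2 * real n)" for n
        by (simp add: power_mult_distrib exp_of_nat_mult[symmetric] mult.commute)
      ultimately show ?thesis by (simp only:)
    qed
  qed auto
  then show ?thesis
  proof (rule whp_mono, intro always_eventually allI impI)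
    fix n \<omega> assume Y1: "\<forall>t\<in>T n. Y n t \<omega> < 1"
    show "crude \<delta> k n \<omega>" unfolding crude_def
    proof (intro ballI allI impI)
      fix w J J' assume a: "w \<in> VN n" "J \<le> J'" "J' \<le> n div k" "J' - J \<le> top_levels \<delta> k n"
      have main: "\<sigma> * pphi k J J' \<omega> w \<le> 2 * sqrt \<delta> * real n" if "\<sigma> \<in> {1, -1}" for \<sigma> :: real
      proof -
        have "(w, J, J', \<sigma>) \<in> T n" using a that by (auto simp: T_def)
        from bspec[OF Y1 this] have "exp (\<theta> * \<sigma> * pphi k J J' \<omega> w - 4 * real n) < 1"
          by (simp add: Y_def exp_diff exp_minus field_simps)
        then have "\<theta> * (\<sigma> * pphi k J J' \<omega> w) < \<theta> * (2 * sqrt \<delta> * real n)"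
          using \<delta> by (simp add: \<theta>_def mult.assoc)
        then show ?thesis using \<theta> by (simp only: mult_less_cancel_left_pos less_imp_le)
      qed
      show "\<bar>pphi k J J' \<omega> w\<bar> \<le> 2 * sqrt \<delta> * real n"
        using main[of 1] main[of "-1"] by (simp add: abs_le_iff)
    qed
  qed
qed

definition smooth_top :: "real \<Rightarrow> nat \<Rightarrow> nat \<Rightarrow> sample \<Rightarrow> bool" where
  "smooth_top \<eta> k n \<omega> \<longleftrightarrow> (\<forall>x\<in>VN n. \<forall>u\<in>VN n. \<forall>l\<le>n div k. cheb x u \<le> 2 ^ ((l + 2) * k) \<longrightarrow>
     pphi k l (n div k) \<omega> x \<le> pphi k l (n div k) \<omega> u + \<eta> * real n)"

text \<open>The differences have variance bounded in n, so the exponential moment of order 4/\<eta>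
  costs a constant, while the threshold gains exp(-4n), enough for 16^n pairs. This transfers a
  bound on the upper levels from one vertex to its surroundings.\<close>

lemma whp_smooth_top:
  assumes \<eta>: "0 < \<eta>" and k: "k \<ge> 1"
  shows "whp (smooth_top \<eta> k)"
proof -
  define T where "T n = {(x, u, l) \<in> VN n \<times> VN n \<times> {..n div k}. cheb x u \<le> 2 ^ ((l + 2) * k)}" for n
  define \<theta> where "\<theta> = 4 / \<eta>"
  have \<theta>: "0 < \<theta>" using \<eta> by (simp add: \<theta>_def)
  define Y where "Y n = (\<lambda>(x, u, l) \<omega>. exp (\<theta> * (pphi k l (n div k) \<omega> x - pphi k l (n div k) \<omega> u)) * exp (- (4 * real n)))" for n
  have sub: "T n \<subseteq> VN n \<times> VN n \<times> {..n div k}" for n by (auto simp: T_def)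
  define C where "C = exp (5 * \<theta>\<^sup>2 * real k)"
  have "whp (\<lambda>n \<omega>. \<forall>t\<in>T n. Y n t \<omega> < 1)"
  proof (rule whp_union[where c = "\<lambda>n. C * exp (- 4 * real n)" and N = "\<lambda>n. (real n + 1) * 16 ^ n"])
    fix n
    show "finite (T n)" by (rule finite_subset[OF sub]) simp
    have "card (T n) \<le> card (VN n \<times> VN n \<times> {..n div k})"
      by (rule card_mono[OF _ sub]) simp
    also have "\<dots> = 4 ^ n * (4 ^ n * (n div k + 1))"
      by (simp add: card_cartesian_product card_VN)
    also have "\<dots> \<le> 4 ^ n * (4 ^ n * (n + 1))"
      by (intro mult_mono) auto
    finally have "real (card (T n)) \<le> real (4 ^ n * (4 ^ n * (n + 1)))" by (simp only: of_nat_le_iff)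
    also have "\<dots> = (real n + 1) * (4 ^ n * 4 ^ n)" by (simp add: algebra_simps)
    also have "(4::real) ^ n * 4 ^ n = 16 ^ n" by (simp flip: power_mult_distrib)
    finally show "real (card (T n)) \<le> (real n + 1) * 16 ^ n" .
    fix t assume t: "t \<in> T n"
    obtain x u l where tt: "t = (x, u, l)" by (cases t) auto
    show "integrable gauss_space (Y n t)"
      unfolding Y_def tt prod.case by (intro integrable_mult_left integrable_exp_diff k)
    show "0 \<le> Y n t \<omega>" for \<omega> by (simp add: Y_def tt)
    have "cheb x u \<le> 2 ^ ((l + 2) * k)" using t by (auto simp: T_def tt)
    from integral_exp_diff_le[OF k this, of \<theta> "n div k"]
    show "(\<integral>\<omega>. Y n t \<omega> \<partial>gauss_space) \<le> C * exp (- 4 * real n)"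
      unfolding Y_def tt prod.case C_def by (simp add: integrable_exp_diff[OF k])
  next
    show "(\<lambda>n. (real n + 1) * 16 ^ n * (C * exp (- 4 * real n))) \<longlonglongrightarrow> 0"
    proof -
      have "(\<lambda>n. C * (real n + 1) * (16 * exp (-4)) ^ n) \<longlonglongrightarrow> 0"
      proof -
        have "16 * exp (-4) < (1::real)"
        proof -
          have "(5::real) \<le> exp 2" using exp_lower_Taylor_quadratic[of "2::real"] by simp
          then have "5 * 5 \<le> exp 2 * exp (2::real)" by (intro mult_mono) auto
          then have "(25::real) \<le> exp 4" by (simp flip: exp_add)
          then show ?thesis by (simp add: exp_minus field_simps)
        qed
        moreover have "0 < 16 * exp (-4::real)" by simp
        ultimately show ?thesis by real_asymp
      qed
      moreover have "C * (real n + 1) * (16 * exp (-4)) ^ n = (real n + 1) * 16 ^ n * (C * exp (- 4 * real n))" for n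
        by (simp add: power_mult_distrib exp_of_nat_mult[symmetric] mult.commute mult.left_commute)
      ultimately show ?thesis by (simp only:)
    qed
  qed (auto simp: C_def)
  then show ?thesis
  proof (rule whp_mono, intro always_eventually allI impI)
    fix n \<omega> assume Y1: "\<forall>t\<in>T n. Y n t \<omega> < 1"
    show "smooth_top \<eta> k n \<omega>" unfolding smooth_top_def
    proof (intro ballI allI impI)
      fix x u l assume a: "x \<in> VN n" "u \<in> VN n" "l \<le> n div k" "cheb x u \<le> 2 ^ ((l + 2) * k)"
      have "(x, u, l) \<in> T n" using a by (auto simp: T_def)
      from bspec[OF Y1 this]
      have "exp (\<theta> * (pphi k l (n div k) \<omega> x - pphi k l (n div k) \<omega> u) + - (4 * real n)) < 1"
        by (simp only: Y_def prod.case exp_add)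
      then have "\<theta> * (pphi k l (n div k) \<omega> x - pphi k l (n div k) \<omega> u) + - (4 * real n) < 0"
        by (simp only: exp_less_one_iff)
      moreover have "4 * real n = \<theta> * (\<eta> * real n)" using \<eta> by (simp add: \<theta>_def)
      ultimately have "\<theta> * (pphi k l (n div k) \<omega> x - pphi k l (n div k) \<omega> u) < \<theta> * (\<eta> * real n)"
        by linarith
      then have "pphi k l (n div k) \<omega> x - pphi k l (n div k) \<omega> u < \<eta> * real n"
        using \<theta> by (simp only: mult_less_cancel_left_pos)
      then show "pphi k l (n div k) \<omega> x \<le> pphi k l (n div k) \<omega> u + \<eta> * real n" by linarith
    qed
  qed
qed

section \<open>Thickness under the tilted measure\<close>

definition thin :: "real \<Rightarrow> real \<Rightarrow> nat \<Rightarrow> nat \<Rightarrow> sample \<Rightarrow> bool" where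
  "thin \<gamma> \<eta> k n \<omega> \<longleftrightarrow> (\<forall>l\<le>n div k.
     (\<Sum>u\<in>VN n. exp (\<gamma> * pphi k 0 (n div k) \<omega> u + pphi k l (n div k) \<omega> u)) <
     4 ^ n * exp (\<gamma>\<^sup>2 * real (k * (n div k)) / 2 + 2 * ln 2 * real (k * (n div k - l)) + \<eta> * real n))"

lemma ln_2_lower: "(1::real) / 2 < ln 2"
proof -
  have "exp (1 / 2) ^ 2 < (2::real) ^ 2"
    using exp_le by (simp flip: exp_of_nat_mult)
  then have "exp (1 / 2) < (2::real)" by (rule power_less_imp_less_base) simp
  then show ?thesis by (metis exp_gt_zero exp_less_cancel_iff exp_ln zero_less_numeral)
qed

text \<open>The tilted mean grows at rate \<open>\<gamma> + 1/2 < 1\<close> in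
  \<open>k * (n div k - l)\<close>, less than the allowed \<open>2 * ln 2\<close>; the extra
  \<open>\<eta> * n\<close> makes the mean of the normalised sum decay.\<close>

lemma whp_thin:
  assumes \<eta>: "0 < \<eta>" and \<gamma>: "0 < \<gamma>" "\<gamma> < 1 / 2" and k: "k \<ge> 1"
  shows "whp (thin \<gamma> \<eta> k)"
proof -
  define B where "B n l = 4 ^ n * exp (\<gamma>\<^sup>2 * real (k * (n div k)) / 2 + 2 * ln 2 * real (k * (n div k - l)) + \<eta> * real n)"
    for n l
  have B: "0 < B n l" for n l by (simp add: B_def)
  define Y where "Y n l \<omega> = (\<Sum>u\<in>VN n. exp (\<gamma> * pphi k 0 (n div k) \<omega> u + pphi k l (n div k) \<omega> u)) / B n l" for n l \<omega>
  have "whp (\<lambda>n \<omega>. \<forall>t\<in>{..n div k}. Y n t \<omega> < 1)"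
  proof (rule whp_union[where c = "\<lambda>n. exp (- \<eta> * real n)" and N = "\<lambda>n. real n + 1"])
    fix n
    show "real (card {..n div k}) \<le> real n + 1" using levels_le_self[of n k] by simp
    fix l assume l: "l \<in> {..n div k}"
    then have l': "l \<le> n div k" by simp
    show "integrable gauss_space (Y n l)"
      unfolding Y_def by (intro integrable_divide_zero Bochner_Integration.integrable_sum integrable_exp_thick[OF k l'])
    show "0 \<le> Y n l \<omega>" for \<omega> using B by (simp add: Y_def sum_nonneg less_imp_le)
    have "(\<integral>\<omega>. Y n l \<omega> \<partial>gauss_space) =
       4 ^ n * exp (\<gamma>\<^sup>2 * real (k * (n div k)) / 2 + (\<gamma> + 1 / 2) * real (k * (n div k - l))) / B n l"
      unfolding Y_def
      by (subst integral_divide_zero, subst Bochner_Integration.integral_sum)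
        (simp_all add: integrable_exp_thick[OF k l'] integral_exp_thick[OF k l'] card_VN)
    also have "\<dots> \<le> 4 ^ n * (exp (\<gamma>\<^sup>2 * real (k * (n div k)) / 2 + 2 * ln 2 * real (k * (n div k - l)) + \<eta> * real n) * exp (- \<eta> * real n)) / B n l"
    proof (intro divide_right_mono mult_left_mono)
      have "(\<gamma> + 1 / 2) * real (k * (n div k - l)) \<le> 2 * ln 2 * real (k * (n div k - l))"
        using \<gamma> ln_2_lower by (intro mult_right_mono) auto
      then show "exp (\<gamma>\<^sup>2 * real (k * (n div k)) / 2 + (\<gamma> + 1 / 2) * real (k * (n div k - l))) \<le>
        exp (\<gamma>\<^sup>2 * real (k * (n div k)) / 2 + 2 * ln 2 * real (k * (n div k - l)) + \<eta> * real n) * exp (- \<eta> * real n)"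
        by (simp flip: exp_add)
    qed (use B in \<open>auto simp: less_imp_le\<close>)
    also have "\<dots> = exp (- \<eta> * real n)" using B[of n l] by (simp add: B_def)
    finally show "(\<integral>\<omega>. Y n l \<omega> \<partial>gauss_space) \<le> exp (- \<eta> * real n)" .
  next
    show "(\<lambda>n. (real n + 1) * exp (- \<eta> * real n)) \<longlonglongrightarrow> 0" using \<eta> by real_asymp
  qed auto
  then show ?thesis
    by (rule whp_mono) (use B in \<open>auto simp: Y_def thin_def B_def intro!: always_eventually\<close>)
qed

subsection \<open>Mass of star-connected sets\<close>

lemma real_le_div_plus_1:
  assumes "k \<ge> 1"
  shows "real n / real k \<le> real (n div k) + 1"
proof -
  have "n \<le> (n div k + 1) * k"
    using assms div_mult_mod_eq[of n k] mod_less_divisor[of k n] unfolding add_mult_distrib by linarith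
  then have "real n \<le> real (n div k + 1) * real k" by (metis of_nat_le_iff of_nat_mult)
  then show ?thesis using assms by (simp add: divide_le_eq add.commute)
qed

lemma sum_UN_le:
  fixes f :: "'a \<Rightarrow> real"
  assumes "finite I" "\<And>i. i \<in> I \<Longrightarrow> finite (A i)" "\<And>x. 0 \<le> f x"
  shows "(\<Sum>x\<in>(\<Union>i\<in>I. A i). f x) \<le> (\<Sum>i\<in>I. \<Sum>x\<in>A i. f x)"
  using assms(1,2)
proof (induction I rule: finite_induct)
  case (insert i I)
  have "(\<Sum>x\<in>A i \<union> (\<Union>i\<in>I. A i). f x) + (\<Sum>x\<in>A i \<inter> (\<Union>i\<in>I. A i). f x) = sum f (A i) + sum f (\<Union>i\<in>I. A i)"
    by (rule sum.union_inter) (use insert in auto)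
  moreover have "0 \<le> (\<Sum>x\<in>A i \<inter> (\<Union>i\<in>I. A i). f x)" by (rule sum_nonneg) (rule assms(3))
  moreover have "sum f (\<Union>i\<in>I. A i) \<le> (\<Sum>i\<in>I. \<Sum>x\<in>A i. f x)" using insert by simp
  ultimately show ?case using insert.hyps by simp
qed simp

text \<open>A value of \<open>skel_mass\<close> below 1 forces, via \<open>exp_psi_le_sup_bound\<close>, field averages of at
  least \<open>- a k\<close> per level on every candidate skeleton.\<close>

definition skel_index :: "real \<Rightarrow> nat \<Rightarrow> nat \<Rightarrow> (real \<times> nat \<times> nat \<times> vtx) set" where
  "skel_index \<delta> k n = {(\<sigma>, J, i, y) \<in> {1, -1} \<times> {..n div k} \<times> {..n div k} \<times> VN n.
     i \<le> J \<and> \<delta> * real (n div k) \<le> real (J - i)}"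

definition skel_mass :: "real \<Rightarrow> nat \<Rightarrow> nat \<Rightarrow> real \<times> nat \<times> nat \<times> vtx \<Rightarrow> sample \<Rightarrow> real" where
  "skel_mass a k n = (\<lambda>(\<sigma>, J, i, y) \<omega>. \<Sum>S\<in>skel k (J - i) (cellv (J * k) y).
     exp (- (a / 128) * a * real k * real (card S)) * (\<Prod>c\<in>S. sup_bound k i (- \<sigma> * (a / 128)) \<omega> c))"

definition good_skel :: "real \<Rightarrow> real \<Rightarrow> nat \<Rightarrow> nat \<Rightarrow> sample \<Rightarrow> bool" where
  "good_skel a \<delta> k n \<omega> \<longleftrightarrow> (\<forall>t\<in>skel_index \<delta> k n. skel_mass a k n t \<omega> < 1)"

text \<open>Per cell, the exponent is 128 ln 72 for the number of candidates, ln 6272 from chaining,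
  and - l a k + 64 l^2 k from the Chernoff bound with parameter l. The choice l = a/128 is optimal
  and leaves - a^2 k / 256; \<open>kbig\<close> brings the total to at most -1. The skeletons
  considered have at least \<open>2^(\<delta> * (n div k))\<close> cells, so the failure mean is
  doubly exponentially small and absorbs the 4^n base points.\<close>

lemma whp_good_skel:
  assumes \<delta>: "0 < \<delta>" and k: "7 \<le> k"
    and kbig: "128 * ln 72 + ln 6272 + 1 \<le> a\<^sup>2 / 256 * real k"
  shows "whp (good_skel a \<delta> k)"
proof -
  define c where "c n = exp (- (2 powr (\<delta> * (real n / real k - 1))))" for n :: nat
  have k2: "2 \<le> k" using k by simp
  have sub: "skel_index \<delta> k n \<subseteq> {1, -1} \<times> {..n div k} \<times> {..n div k} \<times> VN n" for n
    by (auto simp: skel_index_def)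
  show ?thesis unfolding good_skel_def
  proof (rule whp_union[where c = c and N = "\<lambda>n. 2 * (real n + 1)\<^sup>2 * 4 ^ n"])
    fix n
    show "finite (skel_index \<delta> k n)" by (rule finite_subset[OF sub]) simp
    have "card (skel_index \<delta> k n) \<le> card ({1, -1::real} \<times> {..n div k} \<times> {..n div k} \<times> VN n)"
      by (rule card_mono[OF _ sub]) simp
    also have "\<dots> = 2 * ((n div k + 1) * ((n div k + 1) * 4 ^ n))"
      by (simp add: card_cartesian_product card_VN)
    also have "\<dots> \<le> 2 * ((n + 1) * ((n + 1) * 4 ^ n))"
      by (intro mult_mono) auto
    finally have "real (card (skel_index \<delta> k n)) \<le> real (2 * ((n + 1) * ((n + 1) * 4 ^ n)))" by (simp only: of_nat_le_iff)
    then show "real (card (skel_index \<delta> k n)) \<le> 2 * (real n + 1)\<^sup>2 * 4 ^ n"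
      by (simp add: power2_eq_square algebra_simps)
    fix t assume t: "t \<in> skel_index \<delta> k n"
    obtain \<sigma> J i y where tt: "t = (\<sigma>, J, i, y)" by (cases t) auto
    define A where "A = skel k (J - i) (cellv (J * k) y)"
    define q where "q = (2 ^ (k - 6) :: nat) ^ (J - i)"
    define l where "l = a / 128"
    have S: "finite S" "separated S" "card S = q" if "S \<in> A" for S
      using skel_props[OF _ k2] that by (auto simp: A_def q_def)
    have mass: "skel_mass a k n t = (\<lambda>\<omega>. \<Sum>S\<in>A. exp (- (a / 128) * a * real k * real (card S)) *
        (\<Prod>c\<in>S. sup_bound k i (- \<sigma> * (a / 128)) \<omega> c))"
      by (simp add: skel_mass_def tt A_def)
    show "integrable gauss_space (skel_mass a k n t)"
      unfolding mass by (intro Bochner_Integration.integrable_sum integrable_mult_right integrable_prod_sup_bound S)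
    show "0 \<le> skel_mass a k n t \<omega>" for \<omega>
      unfolding mass by (intro sum_nonneg mult_nonneg_nonneg prod_nonneg) (auto intro: less_imp_le sup_bound_pos)
    have \<sigma>: "(- \<sigma> * (a / 128))\<^sup>2 = l\<^sup>2" using t by (auto simp: skel_index_def tt l_def)
    have "(\<integral>\<omega>. skel_mass a k n t \<omega> \<partial>gauss_space) = (\<Sum>S\<in>A. exp (- (a / 128) * a * real k * real (card S)) *
        (\<integral>\<omega>. (\<Prod>c\<in>S. sup_bound k i (- \<sigma> * (a / 128)) \<omega> c) \<partial>gauss_space))"
      unfolding mass
      by (subst Bochner_Integration.integral_sum)
         (auto intro!: integrable_mult_right integrable_prod_sup_bound S)
    also have "\<dots> \<le> (\<Sum>S\<in>A. exp (- (a / 128) * a * real k * real q) * (6272 * exp (64 * l\<^sup>2 * real k)) ^ q)"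
    proof (rule sum_mono)
      fix S' assume S': "S' \<in> A"
      show "exp (- (a / 128) * a * real k * real (card S')) *
        (\<integral>\<omega>. (\<Prod>c\<in>S'. sup_bound k i (- \<sigma> * (a / 128)) \<omega> c) \<partial>gauss_space) \<le>
        exp (- (a / 128) * a * real k * real q) * (6272 * exp (64 * l\<^sup>2 * real k)) ^ q"
        using integral_prod_sup_bound[OF S(1,2)[OF S'], of k i "- \<sigma> * (a / 128)"]
        unfolding \<sigma> S(3)[OF S'] by (intro mult_left_mono) auto
    qed
    also have "\<dots> = real (card A) * (exp (- (a / 128) * a * real k * real q) * (6272 * exp (64 * l\<^sup>2 * real k)) ^ q)"
      by simp
    also have "\<dots> \<le> 72 ^ (128 * q) * (exp (- (a / 128) * a * real k * real q) * (6272 * exp (64 * l\<^sup>2 * real k)) ^ q)"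
    proof (rule mult_right_mono)
      have "card A \<le> 72 ^ (128 * q)" unfolding A_def q_def by (rule card_skel[OF k])
      then have "real (card A) \<le> real (72 ^ (128 * q))" by (simp only: of_nat_le_iff)
      then show "real (card A) \<le> 72 ^ (128 * q)" by simp
    qed simp
    also have "\<dots> = exp (real q * (128 * ln 72 + ln 6272 - (a / 128) * a * real k + 64 * l\<^sup>2 * real k))"
    proof -
      have 1: "(72::real) ^ (128 * q) = exp (real q * (128 * ln 72))"
        using exp_of_nat_mult[of "128 * q" "ln (72::real)"] by (simp add: algebra_simps)
      have 2: "(6272 * exp (64 * l\<^sup>2 * real k)) ^ q = exp (real q * (ln 6272 + 64 * l\<^sup>2 * real k))"
        by (subst exp_of_nat_mult) (simp add: exp_add)
      show ?thesis unfolding 1 2 exp_add[symmetric] by (simp add: algebra_simps)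
    qed
    also have "\<dots> \<le> exp (real q * (- 1))"
    proof -
      have "- (a / 128) * a * real k + 64 * l\<^sup>2 * real k = - (a\<^sup>2 / 256 * real k)"
        by (simp add: l_def power2_eq_square)
      then have "128 * ln 72 + ln 6272 - (a / 128) * a * real k + 64 * l\<^sup>2 * real k \<le> - 1"
        using kbig by linarith
      then have "real q * (128 * ln 72 + ln 6272 - (a / 128) * a * real k + 64 * l\<^sup>2 * real k) \<le> real q * (- 1)"
        by (rule mult_left_mono) simp
      then show ?thesis by (simp only: exp_le_cancel_iff)
    qed
    also have "\<dots> \<le> c n"
    proof -
      have "real n / real k \<le> real (n div k) + 1"
        using k by (intro real_le_div_plus_1) simp
      then have "\<delta> * (real n / real k - 1) \<le> \<delta> * real (n div k)" using \<delta> by (intro mult_left_mono) auto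
      also have "\<dots> \<le> real (J - i)" using t by (auto simp: skel_index_def tt)
      finally have "2 powr (\<delta> * (real n / real k - 1)) \<le> 2 powr real (J - i)" by (rule powr_mono) simp
      also have "\<dots> = 2 ^ (J - i)" by (simp add: powr_realpow)
      also have "\<dots> \<le> (2 ^ (k - 6)) ^ (J - i)"
        by (rule power_mono) (use power_increasing[of 1 "k - 6" "2::real"] k in auto)
      also have "\<dots> = real q" by (simp add: q_def)
      finally show ?thesis by (simp add: c_def)
    qed
    finally show "(\<integral>\<omega>. skel_mass a k n t \<omega> \<partial>gauss_space) \<le> c n" .
  next
    define b where "b = \<delta> / real k"
    have b: "b > 0" using \<delta> k by (simp add: b_def)
    have "(\<lambda>n. 2 * (real n + 1)\<^sup>2 * 4 ^ n * exp (- (2 powr (b * real n - \<delta>)))) \<longlonglongrightarrow> 0"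
      using b by real_asymp
    then show "(\<lambda>n. 2 * (real n + 1)\<^sup>2 * 4 ^ n * c n) \<longlonglongrightarrow> 0"
      by (simp add: c_def b_def right_diff_distrib)
  qed (auto simp: c_def)
qed

lemma jensen_exp:
  fixes g :: "'a \<Rightarrow> real"
  assumes "finite S" "S \<noteq> {}"
  shows "real (card S) * exp ((\<Sum>w\<in>S. g w) / real (card S)) \<le> (\<Sum>w\<in>S. exp (g w))"
proof -
  define m where "m = (\<Sum>w\<in>S. g w) / real (card S)"
  have card: "real (card S) > 0" using assms by (simp add: card_gt_0_iff)
  have "exp m * (1 + (g w - m)) \<le> exp (g w)" for w
  proof -
    have "exp m * (1 + (g w - m)) \<le> exp m * exp (g w - m)"
      by (intro mult_left_mono exp_ge_add_one_self) auto
    then show ?thesis by (simp flip: exp_add)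
  qed
  then have "(\<Sum>w\<in>S. exp m * (1 + (g w - m))) \<le> (\<Sum>w\<in>S. exp (g w))" by (intro sum_mono)
  moreover have "(\<Sum>w\<in>S. exp m * (1 + (g w - m))) = exp m * (real (card S) + ((\<Sum>w\<in>S. g w) - real (card S) * m))"
    by (simp add: sum.distrib sum_subtractf flip: sum_distrib_left)
  moreover have "(\<Sum>w\<in>S. g w) - real (card S) * m = 0" using card by (simp add: m_def)
  ultimately show ?thesis by (simp add: m_def mult.commute)
qed

text \<open>A single summand of \<open>skel_mass\<close> is below 1, and each
  \<open>sup_bound\<close> dominates the exponential of \<open>- l\<close> times the minimum over
  its cell's neighbourhood; taking logarithms gives the average.\<close>

lemma good_skel_average:
  assumes good: "good_skel a \<delta> k n \<omega>" and a: "0 < a" and k: "7 \<le> k"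
    and idx: "\<sigma> \<in> {1, -1}" "J \<le> n div k" "i \<le> J" "y \<in> VN n" "\<delta> * real (n div k) \<le> real (J - i)"
    and S: "S \<in> skel k (J - i) (cellv (J * k) y)"
  shows "- (a * real k) \<le> avg_min (i * k) S (\<lambda>w. \<sigma> * psi k \<omega> i w)"
proof -
  define l where "l = a / 128"
  have l: "0 < l" using a by (simp add: l_def)
  have k2: "2 \<le> k" using k by simp
  note p = skel_props[OF S k2]
  have card: "0 < real (card S)" using p by simp
  have t: "(\<sigma>, J, i, y) \<in> skel_index \<delta> k n" using idx by (auto simp: skel_index_def)
  have "exp (- (a / 128) * a * real k * real (card S)) * (\<Prod>c\<in>S. sup_bound k i (- \<sigma> * (a / 128)) \<omega> c)
      \<le> skel_mass a k n (\<sigma>, J, i, y) \<omega>"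
    unfolding skel_mass_def prod.case
    by (rule member_le_sum[OF S _ finite_skel[OF k2]])
       (intro mult_nonneg_nonneg prod_nonneg; auto intro: less_imp_le sup_bound_pos)
  also have "\<dots> < 1" using good t by (auto simp: good_skel_def)
  finally have upper: "exp (- l * a * real k * real (card S)) * (\<Prod>c\<in>S. sup_bound k i (- \<sigma> * l) \<omega> c) < 1"
    by (simp add: l_def)
  define M where "M c = Min ((\<lambda>w. \<sigma> * psi k \<omega> i w) ` nbh (i * k) c)" for c
  have lower: "exp (- l * M c) \<le> sup_bound k i (- \<sigma> * l) \<omega> c" for c
  proof -
    have "M c \<in> (\<lambda>w. \<sigma> * psi k \<omega> i w) ` nbh (i * k) c" unfolding M_def by (rule Min_in) auto
    then obtain w where w: "w \<in> nbh (i * k) c" "M c = \<sigma> * psi k \<omega> i w" by blast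
    have "- l * M c = (- \<sigma> * l) * psi k \<omega> i w" using w(2) by simp
    then show ?thesis using exp_psi_le_sup_bound[OF w(1), of "- \<sigma> * l" \<omega>] by (simp only:)
  qed
  have "exp (- l * (\<Sum>c\<in>S. M c)) = (\<Prod>c\<in>S. exp (- l * M c))"
    using p by (simp add: exp_sum sum_distrib_left flip: sum_negf)
  also have "\<dots> \<le> (\<Prod>c\<in>S. sup_bound k i (- \<sigma> * l) \<omega> c)"
    by (rule prod_mono) (use lower in auto)
  finally have "exp (- l * a * real k * real (card S)) * exp (- l * (\<Sum>c\<in>S. M c)) \<le>
      exp (- l * a * real k * real (card S)) * (\<Prod>c\<in>S. sup_bound k i (- \<sigma> * l) \<omega> c)"
    by (rule mult_left_mono) simp
  with upper have "exp (- l * a * real k * real (card S) + - l * (\<Sum>c\<in>S. M c)) < 1"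
    unfolding exp_add by linarith
  then have "- l * a * real k * real (card S) + - l * (\<Sum>c\<in>S. M c) < 0" by (simp only: exp_less_one_iff)
  then have "l * (- (a * real k * real (card S))) < l * (\<Sum>c\<in>S. M c)" by (simp add: algebra_simps)
  then have "- (a * real k * real (card S)) < (\<Sum>c\<in>S. M c)"
    using l by (simp only: mult_less_cancel_left_pos)
  then have "- (a * real k) * real (card S) \<le> (\<Sum>c\<in>S. M c)" by simp
  then show ?thesis unfolding avg_min_def M_def[symmetric] using card by (simp add: pos_le_divide_eq)
qed

text \<open>Each level below \<open>J1\<close> averages at least \<open>- a k\<close> on its
  ancestor skeleton, a loss of at most \<open>a n\<close> in all; the levels from \<open>J1\<close>
  to \<open>J\<close> are covered by \<open>crude\<close>. Jensen's inequality turns the average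
  over the \<open>(2^(k-6))^J\<close> points into mass. The case \<sigma> = -1 serves the duality
  argument.\<close>

lemma star_connected_mass:
  assumes good: "good_skel a \<delta> k n \<omega>" and crude: "crude \<delta> k n \<omega>"
    and a: "0 < a" and k: "7 \<le> k" and \<delta>: "0 < \<delta>" and \<gamma>: "0 < \<gamma>"
    and \<sigma>: "\<sigma> \<in> {1, -1}" and J: "J \<le> n div k"
    and W: "W \<subseteq> VN n" "y \<in> W" "(star_step W)\<^sup>*\<^sup>* y z" "2 ^ (J * k) - 1 \<le> cheb y z"
  shows "2 ^ ((k - 6) * J) * exp (- \<gamma> * (a * real n + 2 * sqrt \<delta> * real n)) \<le>
    (\<Sum>w\<in>W. exp (\<sigma> * \<gamma> * pphi k 0 J \<omega> w))"
proof -
  have act: "active W (J * k) (cellv (J * k) y)" unfolding active_def using W by blast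
  obtain S where S: "finite S" "S \<subseteq> W" "card S = (2 ^ (k - 6)) ^ J"
    "\<And>i. i \<le> J \<Longrightarrow> \<exists>S'\<in>skel k (J - i) (cellv (J * k) y).
       \<forall>g. avg_min (i * k) S' g \<le> (\<Sum>w\<in>S. g w) / real (card S)"
    using skeleton_exists[OF act k] by metis
  have cardS: "0 < real (card S)" using S(3) by simp
  define av where "av g = (\<Sum>w\<in>S. g w) / real (card S)" for g
  define J1 where "J1 = J - top_levels \<delta> k n"
  have J1: "J1 \<le> J" "J - J1 \<le> top_levels \<delta> k n" by (auto simp: J1_def)
  have lev: "- (a * real k) \<le> av (\<lambda>w. \<sigma> * psi k \<omega> i w)" if "i < J1" for i
  proof -
    have i: "i \<le> J" using that J1 by simp
    obtain S' where S': "S' \<in> skel k (J - i) (cellv (J * k) y)"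
      "\<forall>g. avg_min (i * k) S' g \<le> (\<Sum>w\<in>S. g w) / real (card S)"
      using S(4)[OF i] by blast
    \<comment> \<open>\<open>i < J1\<close> gives one generation more than
      \<open>top_levels\<close>, which makes up for the floor in its definition.\<close>
    have "top_levels \<delta> k n + 1 \<le> J - i" using that by (simp add: J1_def)
    then have "real (top_levels \<delta> k n + 1) \<le> real (J - i)" by (simp only: of_nat_le_iff)
    then have "\<delta> * real (n div k) \<le> real (J - i)"
      using top_levels_bounds(2)[OF \<delta>, where k = k and n = n] by simp
    then have "- (a * real k) \<le> avg_min (i * k) S' (\<lambda>w. \<sigma> * psi k \<omega> i w)"
      using good_skel_average[OF good a k \<sigma> J i _ _ S'(1)] W(1,2) by blast
    also have "\<dots> \<le> av (\<lambda>w. \<sigma> * psi k \<omega> i w)" using S'(2) by (simp add: av_def)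
    finally show ?thesis .
  qed
  have top: "- (2 * sqrt \<delta> * real n) \<le> av (\<lambda>w. \<sigma> * pphi k J1 J \<omega> w)"
  proof -
    have "- (2 * sqrt \<delta> * real n) \<le> \<sigma> * pphi k J1 J \<omega> w" if "w \<in> S" for w
    proof -
      have "w \<in> VN n" using that S(2) W(1) by blast
      then have "\<bar>pphi k J1 J \<omega> w\<bar> \<le> 2 * sqrt \<delta> * real n"
        using crude J1 J unfolding crude_def by blast
      then show ?thesis using \<sigma> by auto
    qed
    then have "(\<Sum>w\<in>S. - (2 * sqrt \<delta> * real n)) \<le> (\<Sum>w\<in>S. \<sigma> * pphi k J1 J \<omega> w)" by (rule sum_mono)
    then show ?thesis unfolding av_def using cardS by (simp add: pos_le_divide_eq mult.commute)
  qed
  have split: "\<sigma> * pphi k 0 J \<omega> w = (\<Sum>i<J1. \<sigma> * psi k \<omega> i w) + \<sigma> * pphi k J1 J \<omega> w" for w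
    using pphi_split[of 0 J1 J k \<omega> w] J1(1)
    by (simp add: pphi_def sum_distrib_left distrib_left atLeast0LessThan)
  have "av (\<lambda>w. \<sigma> * pphi k 0 J \<omega> w) = (\<Sum>i<J1. av (\<lambda>w. \<sigma> * psi k \<omega> i w)) + av (\<lambda>w. \<sigma> * pphi k J1 J \<omega> w)"
    unfolding av_def split sum.distrib by (subst sum.swap) (simp add: add_divide_distrib sum_divide_distrib)
  moreover have "(\<Sum>i<J1. - (a * real k)) \<le> (\<Sum>i<J1. av (\<lambda>w. \<sigma> * psi k \<omega> i w))"
    by (rule sum_mono) (use lev in auto)
  moreover have "- (a * real n) \<le> (\<Sum>i<J1. - (a * real k))"
  proof -
    have "k * J1 \<le> k * (n div k)" using J1(1) J by (intro mult_left_mono) auto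
    then have "k * J1 \<le> n" using levels_le[of k n] by linarith
    then have "real k * real J1 \<le> real n" by (metis of_nat_le_iff of_nat_mult)
    then have "a * (real k * real J1) \<le> a * real n" using a by (intro mult_left_mono) auto
    then show ?thesis by (simp add: algebra_simps)
  qed
  ultimately have avg: "- (a * real n + 2 * sqrt \<delta> * real n) \<le> av (\<lambda>w. \<sigma> * pphi k 0 J \<omega> w)"
    using top by linarith
  have "2 ^ ((k - 6) * J) * exp (- \<gamma> * (a * real n + 2 * sqrt \<delta> * real n)) \<le>
      real (card S) * exp (\<gamma> * av (\<lambda>w. \<sigma> * pphi k 0 J \<omega> w))"
  proof (rule mult_mono)
    show "(2::real) ^ ((k - 6) * J) \<le> real (card S)" using S(3) by (simp add: power_mult)
    have "\<gamma> * (- (a * real n + 2 * sqrt \<delta> * real n)) \<le> \<gamma> * av (\<lambda>w. \<sigma> * pphi k 0 J \<omega> w)"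
      using avg \<gamma> by (intro mult_left_mono) auto
    then show "exp (- \<gamma> * (a * real n + 2 * sqrt \<delta> * real n)) \<le> exp (\<gamma> * av (\<lambda>w. \<sigma> * pphi k 0 J \<omega> w))"
      by (simp only: exp_le_cancel_iff mult_minus_left mult_minus_right)
  qed auto
  also have "\<gamma> * av (\<lambda>w. \<sigma> * pphi k 0 J \<omega> w) = (\<Sum>w\<in>S. \<sigma> * \<gamma> * pphi k 0 J \<omega> w) / real (card S)"
    by (simp add: av_def sum_distrib_left mult_ac)
  also have "real (card S) * exp ((\<Sum>w\<in>S. \<sigma> * \<gamma> * pphi k 0 J \<omega> w) / real (card S)) \<le>
      (\<Sum>w\<in>S. exp (\<sigma> * \<gamma> * pphi k 0 J \<omega> w))"
    by (rule jensen_exp) (use S cardS in auto)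
  also have "\<dots> \<le> (\<Sum>w\<in>W. exp (\<sigma> * \<gamma> * pphi k 0 J \<omega> w))"
    by (rule sum_mono2) (use S(2) finite_subset[OF W(1)] in auto)
  finally show ?thesis .
qed

subsection \<open>Second moments\<close>

lemma card_cheb_ball_le:
  "card {v. cheb u v < 2 ^ s} \<le> 4 * 4 ^ s"
proof -
  have "{v. cheb u v < 2 ^ s} \<subseteq> {fst u - 2 ^ s<..<fst u + 2 ^ s} \<times> {snd u - 2 ^ s<..<snd u + 2 ^ s}"
    by (auto simp: cheb_def)
  then have "card {v. cheb u v < 2 ^ s} \<le> card ({fst u - 2 ^ s<..<fst u + 2 ^ s} \<times> {snd u - 2 ^ s<..<snd u + 2 ^ s})"
    by (rule card_mono[rotated]) simp
  also have "\<dots> = nat (2 * 2 ^ s - 1) * nat (2 * 2 ^ s - 1)" by (simp add: card_cartesian_product)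
  also have "\<dots> \<le> (2 * 2 ^ s) * (2 * 2 ^ s)"
  proof (rule mult_mono)
    have "nat (2 * 2 ^ s - 1) \<le> nat (int (2 * 2 ^ s))" by (rule nat_mono) simp
    then show "nat (2 * 2 ^ s - 1) \<le> 2 * 2 ^ s" "nat (2 * 2 ^ s - 1) \<le> 2 * 2 ^ s" by (simp_all only: nat_int)
  qed auto
  also have "\<dots> = 4 * 4 ^ s" by (simp flip: power_mult_distrib)
  finally show ?thesis .
qed

text \<open>The \<open>L\<^sup>2\<close> regime: pairs at distance below \<open>2^(M0 k)\<close>, grouped by their first common level,
  contribute a geometric sum dominated by the coarsest level.\<close>

lemma near_pairs_sum:
  assumes k: "k \<ge> 1" and \<gamma>: "0 < \<gamma>" "\<gamma> < 1 / 2" and M: "M0 \<le> M"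
  shows "(\<Sum>v\<in>{v \<in> VN n. cheb u v < 2 ^ (M0 * k)}.
      \<integral>\<omega>. exp (\<gamma> * pphi k 0 M \<omega> u + \<gamma> * pphi k 0 M \<omega> v) \<partial>gauss_space) \<le>
    4 * 4 ^ (k * M) * exp (\<gamma>\<^sup>2 * real (k * M)) * (real M + 1) * (1 / 2) ^ (k * (M - M0))"
proof -
  define E where "E v = (\<integral>\<omega>. exp (\<gamma> * pphi k 0 M \<omega> u + \<gamma> * pphi k 0 M \<omega> v) \<partial>gauss_space)" for v
  define A where "A l = {v \<in> VN n. cheb u v < 2 ^ (l * k) \<and> (\<forall>j<l. 2 ^ (j * k) \<le> cheb u v)}" for l
  have E0: "0 \<le> E v" for v unfolding E_def by (rule integral_nonneg_AE) simp
  have finA: "finite (A l)" for l by (simp add: A_def)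
  have sub: "{v \<in> VN n. cheb u v < 2 ^ (M0 * k)} \<subseteq> (\<Union>l\<in>{..M0}. A l)"
  proof
    fix v assume v: "v \<in> {v \<in> VN n. cheb u v < 2 ^ (M0 * k)}"
    define l where "l = (LEAST l. cheb u v < 2 ^ (l * k))"
    have "cheb u v < 2 ^ (l * k)" unfolding l_def by (rule LeastI[of _ M0]) (use v in auto)
    moreover have "l \<le> M0" unfolding l_def by (rule Least_le) (use v in auto)
    moreover have "2 ^ (j * k) \<le> cheb u v" if "j < l" for j
      using not_less_Least[of j "\<lambda>l. cheb u v < 2 ^ (l * k)"] that by (simp add: l_def)
    ultimately show "v \<in> (\<Union>l\<in>{..M0}. A l)" using v by (auto simp: A_def)
  qed
  have lev: "(\<Sum>v\<in>A l. E v) \<le> 4 * 4 ^ (k * M) * exp (\<gamma>\<^sup>2 * real (k * M)) * (1 / 2) ^ (k * (M - M0))" if l: "l \<le> M0" for l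
  proof -
    have lM: "l \<le> M" using l M by simp
    have "(\<Sum>v\<in>A l. E v) \<le> (\<Sum>v\<in>A l. exp (\<gamma>\<^sup>2 * real (k * M) + \<gamma>\<^sup>2 * real (k * (M - l))))"
      unfolding E_def by (intro sum_mono integral_exp_pair_le k lM) (auto simp: A_def)
    also have "\<dots> = real (card (A l)) * (exp (\<gamma>\<^sup>2 * real (k * M)) * exp (\<gamma>\<^sup>2 * real (k * (M - l))))"
      by (simp add: exp_add)
    \<comment> \<open>Since \<gamma>^2 \<le> 1/4 < ln 2, correlation gains at most a factor 2 per
      unit of \<open>k * (M - l)\<close>, whereas the number of pairs loses a factor 4. The surplus
      is \<open>(1/2)^(k * (M - l))\<close>.\<close>
    also have "\<dots> \<le> (4 * 4 ^ (l * k)) * (exp (\<gamma>\<^sup>2 * real (k * M)) * 2 ^ (k * (M - l)))"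
    proof (intro mult_mono mult_left_mono)
      have "finite {v. cheb u v < 2 ^ (l * k)}"
        by (rule finite_subset[OF _ finite_cheb_ball[of u "2 ^ (l * k)"]]) (auto simp: cheb_commute)
      then have "card (A l) \<le> card {v. cheb u v < 2 ^ (l * k)}"
        by (rule card_mono) (auto simp: A_def)
      also have "\<dots> \<le> 4 * 4 ^ (l * k)" by (rule card_cheb_ball_le)
      finally have "real (card (A l)) \<le> real (4 * 4 ^ (l * k))" by (simp only: of_nat_le_iff)
      then show "real (card (A l)) \<le> 4 * 4 ^ (l * k)" by simp
      have "\<gamma>\<^sup>2 \<le> (1 / 2)\<^sup>2" using \<gamma> by (intro power_mono) auto
      then have "\<gamma>\<^sup>2 * real (k * (M - l)) \<le> ln 2 * real (k * (M - l))"
        using ln_2_lower by (intro mult_right_mono) (auto simp: power2_eq_square)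
      also have "\<dots> = ln (2 ^ (k * (M - l)))" by (subst ln_realpow) auto
      finally have "exp (\<gamma>\<^sup>2 * real (k * (M - l))) \<le> exp (ln (2 ^ (k * (M - l))))" by (simp only: exp_le_cancel_iff)
      then show "exp (\<gamma>\<^sup>2 * real (k * (M - l))) \<le> 2 ^ (k * (M - l))" by simp
    qed auto
    also have "\<dots> = 4 * 4 ^ (k * M) * exp (\<gamma>\<^sup>2 * real (k * M)) * (1 / 2) ^ (k * (M - l))"
    proof -
      have "k * M = l * k + k * (M - l)" using lM by (simp add: algebra_simps diff_mult_distrib2)
      then have "(4::real) ^ (k * M) = 4 ^ (l * k) * (2 ^ (k * (M - l)) * 2 ^ (k * (M - l)))"
        by (simp add: power_add flip: power_mult_distrib)
      then show ?thesis by (simp add: power_divide)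
    qed
    also have "\<dots> \<le> 4 * 4 ^ (k * M) * exp (\<gamma>\<^sup>2 * real (k * M)) * (1 / 2) ^ (k * (M - M0))"
      by (intro mult_left_mono power_decreasing) (use l in auto)
    finally show ?thesis .
  qed
  have "(\<Sum>v\<in>{v \<in> VN n. cheb u v < 2 ^ (M0 * k)}. E v) \<le> (\<Sum>v\<in>(\<Union>l\<in>{..M0}. A l). E v)"
    by (rule sum_mono2[OF _ sub]) (use finA E0 in auto)
  also have "\<dots> \<le> (\<Sum>l\<in>{..M0}. \<Sum>v\<in>A l. E v)"
    by (rule sum_UN_le) (use finA E0 in auto)
  also have "\<dots> \<le> (\<Sum>l\<in>{..M0}. 4 * 4 ^ (k * M) * exp (\<gamma>\<^sup>2 * real (k * M)) * (1 / 2) ^ (k * (M - M0)))"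
    by (rule sum_mono) (use lev in auto)
  also have "\<dots> = (real M0 + 1) * (4 * 4 ^ (k * M) * exp (\<gamma>\<^sup>2 * real (k * M)) * (1 / 2) ^ (k * (M - M0)))"
    by simp
  also have "\<dots> \<le> (real M + 1) * (4 * 4 ^ (k * M) * exp (\<gamma>\<^sup>2 * real (k * M)) * (1 / 2) ^ (k * (M - M0)))"
    by (rule mult_right_mono) (use M in auto)
  finally show ?thesis by (simp add: E_def mult_ac)
qed

definition few_close :: "real \<Rightarrow> real \<Rightarrow> nat \<Rightarrow> nat \<Rightarrow> sample \<Rightarrow> bool" where
  "few_close \<gamma> \<delta> k n \<omega> \<longleftrightarrow>
    (\<Sum>u\<in>VN n. \<Sum>v\<in>{v \<in> VN n. cheb u v < 2 ^ ((n div k - top_levels \<delta> k n) * k)}.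
       exp (\<gamma> * pphi k 0 (n div k) \<omega> u + \<gamma> * pphi k 0 (n div k) \<omega> v)) <
    4 * 16 ^ n * exp (\<gamma>\<^sup>2 * real (k * (n div k))) * (real n + 1)\<^sup>2 * (1 / 2) ^ (k * top_levels \<delta> k n)"

lemma power_levels_le: "(4::real) ^ (k * M) \<le> 4 ^ n" if "M \<le> n div k"
proof (rule power_increasing)
  show "k * M \<le> n" using mult_left_mono[OF that, of k] levels_le[of k n] by linarith
qed simp

text \<open>One factor n + 1 in the bound pays for the number of levels; the second makes the mean
  of the normalised sum at most 1/(n + 1).\<close>

lemma whp_few_close:
  assumes \<delta>: "0 < \<delta>" "\<delta> \<le> 1" and \<gamma>: "0 < \<gamma>" "\<gamma> < 1 / 2" and k: "k \<ge> 1"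
  shows "whp (few_close \<gamma> \<delta> k)"
proof -
  define m where "m n = n div k" for n
  define e where "e n = top_levels \<delta> k n" for n
  define B where "B n = 4 * 16 ^ n * exp (\<gamma>\<^sup>2 * real (k * m n)) * (real n + 1)\<^sup>2 * (1 / 2) ^ (k * e n)" for n
  have B: "0 < B n" for n by (simp add: B_def)
  \<comment> \<open>The argument \<open>()\<close> is a dummy: \<open>whp_union\<close> is applied
    to a single quantity.\<close>
  define Y where "Y n (t::unit) \<omega> = (\<Sum>u\<in>VN n. \<Sum>v\<in>{v \<in> VN n. cheb u v < 2 ^ ((m n - e n) * k)}.
       exp (\<gamma> * pphi k 0 (m n) \<omega> u + \<gamma> * pphi k 0 (m n) \<omega> v)) / B n" for n t \<omega>
  have "whp (\<lambda>n \<omega>. \<forall>t\<in>{()}. Y n t \<omega> < 1)"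
  proof (rule whp_union[where c = "\<lambda>n. 1 / (real n + 1)" and N = "\<lambda>n. 1"])
    fix n and t :: unit
    show "integrable gauss_space (Y n t)"
      unfolding Y_def by (intro integrable_divide_zero Bochner_Integration.integrable_sum integrable_exp_pair[OF k])
    show "0 \<le> Y n t \<omega>" for \<omega> using B by (auto simp: Y_def less_imp_le intro!: sum_nonneg divide_nonneg_nonneg)
    have e: "e n \<le> m n" unfolding e_def m_def by (rule top_levels_le[OF \<delta>])
    have "(\<integral>\<omega>. Y n t \<omega> \<partial>gauss_space) = (\<Sum>u\<in>VN n. \<Sum>v\<in>{v \<in> VN n. cheb u v < 2 ^ ((m n - e n) * k)}.
       \<integral>\<omega>. exp (\<gamma> * pphi k 0 (m n) \<omega> u + \<gamma> * pphi k 0 (m n) \<omega> v) \<partial>gauss_space) / B n"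
      unfolding Y_def
      by (simp add: Bochner_Integration.integral_sum integrable_exp_pair[OF k] Bochner_Integration.integrable_sum)
    also have "\<dots> \<le> (\<Sum>u\<in>VN n. 4 * 4 ^ (k * m n) * exp (\<gamma>\<^sup>2 * real (k * m n)) * (real (m n) + 1) * (1 / 2) ^ (k * (m n - (m n - e n)))) / B n"
      using B[of n] by (intro divide_right_mono sum_mono near_pairs_sum k \<gamma>) auto
    also have "\<dots> = (4 ^ n * 4 ^ (k * m n)) * (4 * exp (\<gamma>\<^sup>2 * real (k * m n)) * (real (m n) + 1) * (1 / 2) ^ (k * e n)) / B n"
      using e by (simp add: card_VN)
    also have "\<dots> \<le> (4 ^ n * 4 ^ n) * (4 * exp (\<gamma>\<^sup>2 * real (k * m n)) * (real n + 1) * (1 / 2) ^ (k * e n)) / B n"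
      using B[of n] levels_le_self[of n k]
      by (intro divide_right_mono mult_mono mult_left_mono power_levels_le) (auto simp: m_def)
    also have "(4::real) ^ n * 4 ^ n = 16 ^ n" by (simp flip: power_mult_distrib)
    also have "16 ^ n * (4 * exp (\<gamma>\<^sup>2 * real (k * m n)) * (real n + 1) * (1 / 2) ^ (k * e n)) / B n = 1 / (real n + 1)"
      by (simp add: B_def power2_eq_square)
    finally show "(\<integral>\<omega>. Y n t \<omega> \<partial>gauss_space) \<le> 1 / (real n + 1)" .
  next
    show "(\<lambda>n. 1 * (1 / (real n + 1))) \<longlonglongrightarrow> 0" by real_asymp
  qed auto
  then show ?thesis
  proof (rule whp_mono, intro always_eventually allI impI)
    fix n \<omega> assume "\<forall>t\<in>{()}. Y n t \<omega> < 1"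
    then show "few_close \<gamma> \<delta> k n \<omega>"
      using B[of n] by (simp add: Y_def few_close_def divide_less_eq B_def m_def e_def)
  qed
qed

definition mass_lower :: "real \<Rightarrow> real \<Rightarrow> nat \<Rightarrow> nat \<Rightarrow> sample \<Rightarrow> bool" where
  "mass_lower \<gamma> \<delta> k n \<omega> \<longleftrightarrow>
     4 ^ n * exp (\<gamma>\<^sup>2 * real (k * (n div k - top_levels \<delta> k n)) / 2) / 2 <
     (\<Sum>u\<in>VN n. exp (\<gamma> * pphi k 0 (n div k - top_levels \<delta> k n) \<omega> u))"

text \<open>Chebyshev's inequality for the field without its top levels. These are shared over
  macroscopic distances and would prevent concentration; once they are removed, the fields of
  vertices at distance at least 2^(M k) have no noise in common, and the closer pairs contribute a
  relative variance of order n 4^(k M) / 4^n.\<close>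

lemma whp_mass_lower:
  assumes \<delta>: "0 < \<delta>" "\<delta> \<le> 1" and \<gamma>: "0 < \<gamma>" "\<gamma> < 1 / 2" and k: "k \<ge> 1"
  shows "whp (mass_lower \<gamma> \<delta> k)"
proof -
  define M where "M n = n div k - top_levels \<delta> k n" for n
  define E where "E n = 4 ^ n * exp (\<gamma>\<^sup>2 * real (k * M n) / 2)" for n
  define Z where "Z n \<omega> = (\<Sum>u\<in>VN n. exp (\<gamma> * pphi k 0 (M n) \<omega> u))" for n \<omega>
  have E: "0 < E n" for n by (simp add: E_def)
  have sq: "(Z n \<omega>)\<^sup>2 = (\<Sum>u\<in>VN n. \<Sum>v\<in>VN n. exp (\<gamma> * pphi k 0 (M n) \<omega> u + \<gamma> * pphi k 0 (M n) \<omega> v))" for n \<omega>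
    by (simp add: Z_def power2_eq_square sum_product exp_add)
  have intZ: "integrable gauss_space (Z n)" for n
    unfolding Z_def by (intro Bochner_Integration.integrable_sum integrable_exp_pphi k)
  have intZ2: "integrable gauss_space (\<lambda>\<omega>. (Z n \<omega>)\<^sup>2)" for n
    unfolding sq by (intro Bochner_Integration.integrable_sum integrable_exp_pair k)
  have EZ: "(\<integral>\<omega>. Z n \<omega> \<partial>gauss_space) = E n" for n
    unfolding Z_def by (simp add: Bochner_Integration.integral_sum integrable_exp_pphi[OF k]
        integral_exp_pphi[OF k] card_VN E_def)
  have E2: "(E n)\<^sup>2 = 16 ^ n * exp (\<gamma>\<^sup>2 * real (k * M n))" for n
  proof -
    have "(E n)\<^sup>2 = (4 ^ n * 4 ^ n) * (exp (\<gamma>\<^sup>2 * real (k * M n) / 2) * exp (\<gamma>\<^sup>2 * real (k * M n) / 2))"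
      unfolding E_def power2_eq_square[of "4 ^ n * _"] by (simp only: mult_ac)
    also have "exp (\<gamma>\<^sup>2 * real (k * M n) / 2) * exp (\<gamma>\<^sup>2 * real (k * M n) / 2) = exp (\<gamma>\<^sup>2 * real (k * M n))"
      by (simp flip: exp_add)
    also have "(4::real) ^ n * 4 ^ n = 16 ^ n" by (simp flip: power_mult_distrib)
    finally show ?thesis .
  qed
  define c where "c n = 16 * (real n + 1) * (4 ^ (k * M n) / 4 ^ n)" for n
  have EZ2: "(\<integral>\<omega>. (Z n \<omega>)\<^sup>2 \<partial>gauss_space) \<le> (E n)\<^sup>2 * (1 + c n / 4)" for n
  proof -
    define I where "I u v = (\<integral>\<omega>. exp (\<gamma> * pphi k 0 (M n) \<omega> u + \<gamma> * pphi k 0 (M n) \<omega> v) \<partial>gauss_space)" for u v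
    have I0: "0 \<le> I u v" for u v unfolding I_def by (rule integral_nonneg_AE) simp
    have "(\<integral>\<omega>. (Z n \<omega>)\<^sup>2 \<partial>gauss_space) = (\<Sum>u\<in>VN n. \<Sum>v\<in>VN n. I u v)"
      unfolding sq I_def
      by (simp add: Bochner_Integration.integral_sum integrable_exp_pair[OF k] Bochner_Integration.integrable_sum)
    also have "\<dots> \<le> (\<Sum>u\<in>VN n. 4 ^ n * exp (\<gamma>\<^sup>2 * real (k * M n)) +
        4 * 4 ^ (k * M n) * exp (\<gamma>\<^sup>2 * real (k * M n)) * (real n + 1))"
    proof (rule sum_mono)
      fix u
      let ?N = "{v \<in> VN n. cheb u v < 2 ^ (M n * k)}"
      have "(\<Sum>v\<in>VN n. I u v) = (\<Sum>v\<in>VN n - ?N. I u v) + (\<Sum>v\<in>?N. I u v)"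
        by (rule sum.subset_diff) auto
      also have "(\<Sum>v\<in>VN n - ?N. I u v) \<le> (\<Sum>v\<in>VN n - ?N. exp (\<gamma>\<^sup>2 * real (k * M n)))"
      proof (rule sum_mono)
        fix v assume "v \<in> VN n - ?N"
        then have far: "2 ^ (M n * k) \<le> cheb u v" by auto
        have "I u v \<le> exp (\<gamma>\<^sup>2 * real (k * M n) + \<gamma>\<^sup>2 * real (k * (M n - M n)))"
          unfolding I_def
        proof (rule integral_exp_pair_le[OF k])
          fix j assume "j < M n"
          then have "(2::int) ^ (j * k) \<le> 2 ^ (M n * k)" by (intro power_increasing) auto
          then show "2 ^ (j * k) \<le> cheb u v" using far by linarith
        qed simp
        then show "I u v \<le> exp (\<gamma>\<^sup>2 * real (k * M n))" by simp
      qed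
      also have "\<dots> \<le> (\<Sum>v\<in>VN n. exp (\<gamma>\<^sup>2 * real (k * M n)))" by (rule sum_mono2) auto
      also have "\<dots> = 4 ^ n * exp (\<gamma>\<^sup>2 * real (k * M n))" by (simp add: card_VN)
      also have "(\<Sum>v\<in>?N. I u v) \<le> 4 * 4 ^ (k * M n) * exp (\<gamma>\<^sup>2 * real (k * M n)) * (real (M n) + 1) * (1 / 2) ^ (k * (M n - M n))"
        unfolding I_def by (rule near_pairs_sum[OF k \<gamma>]) simp
      also have "\<dots> \<le> 4 * 4 ^ (k * M n) * exp (\<gamma>\<^sup>2 * real (k * M n)) * (real n + 1) * 1"
        using le_trans[OF diff_le_self levels_le_self, of n k "top_levels \<delta> k n"]
        by (intro mult_mono) (auto simp: M_def)
      finally show "(\<Sum>v\<in>VN n. I u v) \<le> 4 ^ n * exp (\<gamma>\<^sup>2 * real (k * M n)) +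
        4 * 4 ^ (k * M n) * exp (\<gamma>\<^sup>2 * real (k * M n)) * (real n + 1)" by simp
    qed
    also have "\<dots> = 4 ^ n * (4 ^ n * exp (\<gamma>\<^sup>2 * real (k * M n)) +
        4 * 4 ^ (k * M n) * exp (\<gamma>\<^sup>2 * real (k * M n)) * (real n + 1))" by (simp add: card_VN)
    also have "\<dots> = (4 ^ n * 4 ^ n) * exp (\<gamma>\<^sup>2 * real (k * M n)) * (1 + c n / 4)"
      by (simp add: c_def field_simps)
    also have "(4::real) ^ n * 4 ^ n = 16 ^ n" by (simp flip: power_mult_distrib)
    finally show ?thesis unfolding E2 .
  qed
  \<comment> \<open>\<open>Y < 1\<close> says that \<open>Z\<close> differs from its mean by less
    than half of it.\<close>
  define Y where "Y n (t::unit) \<omega> = 4 * (1 - Z n \<omega> / E n)\<^sup>2" for n t \<omega>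
  have Yeq: "Y n t = (\<lambda>\<omega>. 4 - (8 / E n) * Z n \<omega> + (4 / (E n)\<^sup>2) * (Z n \<omega>)\<^sup>2)" for n t
    by (rule ext) (simp add: Y_def power2_eq_square algebra_simps)
  interpret prob_space gauss_space by (rule prob_space_gauss)
  have "whp (\<lambda>n \<omega>. \<forall>t\<in>{()}. Y n t \<omega> < 1)"
  proof (rule whp_union[where c = c and N = "\<lambda>n. 1"])
    fix n and t :: unit
    show "integrable gauss_space (Y n t)"
      unfolding Yeq by (intro Bochner_Integration.integrable_add Bochner_Integration.integrable_diff
          integrable_mult_right intZ intZ2 integrable_const)
    show "0 \<le> Y n t \<omega>" for \<omega> by (simp add: Y_def)
    have "(\<integral>\<omega>. Y n t \<omega> \<partial>gauss_space) = 4 - (8 / E n) * E n + (4 / (E n)\<^sup>2) * (\<integral>\<omega>. (Z n \<omega>)\<^sup>2 \<partial>gauss_space)"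
    proof -
      have "(\<integral>\<omega>. Y n t \<omega> \<partial>gauss_space) = (\<integral>\<omega>. 4 - (8 / E n) * Z n \<omega> \<partial>gauss_space) +
          (\<integral>\<omega>. (4 / (E n)\<^sup>2) * (Z n \<omega>)\<^sup>2 \<partial>gauss_space)"
        unfolding Yeq by (intro Bochner_Integration.integral_add Bochner_Integration.integrable_diff
          integrable_mult_right intZ intZ2 integrable_const)
      also have "(\<integral>\<omega>. 4 - (8 / E n) * Z n \<omega> \<partial>gauss_space) =
          (\<integral>\<omega>. 4 \<partial>gauss_space) - (\<integral>\<omega>. (8 / E n) * Z n \<omega> \<partial>gauss_space)"
        by (intro Bochner_Integration.integral_diff integrable_mult_right intZ integrable_const)
      finally show ?thesis by (simp only: integral_mult_right_zero EZ lebesgue_integral_const prob_space) simp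
    qed
    also have "\<dots> \<le> 4 - 8 + (4 / (E n)\<^sup>2) * ((E n)\<^sup>2 * (1 + c n / 4))"
      using E[of n] EZ2[of n] by (intro add_mono mult_left_mono) auto
    also have "\<dots> = c n" using E[of n] by simp
    finally show "(\<integral>\<omega>. Y n t \<omega> \<partial>gauss_space) \<le> c n" .
    show "0 \<le> c n" by (simp add: c_def)
  next
    have le: "c n \<le> 16 * (real n + 1) * (4 powr (2 * real k) * 4 powr (- \<delta> * real n))" for n
    proof -
      have "k * M n + k * top_levels \<delta> k n = k * (n div k)"
        using top_levels_le[OF \<delta>, of k n] by (simp add: M_def flip: distrib_left)
      then have "real (k * M n + k * top_levels \<delta> k n) \<le> real n"
        by (simp only: of_nat_le_iff levels_le)
      then have "real (k * M n) + real (k * top_levels \<delta> k n) \<le> real n"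
        by (simp only: of_nat_add)
      then have "real (k * M n) \<le> real n + (2 * real k - \<delta> * real n)"
        using top_levels_large[OF \<delta> k, of n] by linarith
      then have "4 powr real (k * M n) \<le> 4 powr (real n + (2 * real k - \<delta> * real n))"
        by (intro powr_mono) auto
      also have "\<dots> = 4 ^ n * (4 powr (2 * real k) * 4 powr (- \<delta> * real n))"
        by (simp add: powr_add[symmetric] powr_realpow[symmetric])
      finally have "4 ^ (k * M n) / 4 ^ n \<le> 4 powr (2 * real k) * 4 powr (- \<delta> * real n)"
        by (simp only: powr_realpow[of "4::real", simplified] pos_divide_le_eq zero_less_power zero_less_numeral mult.commute)
      then show ?thesis unfolding c_def by (intro mult_left_mono) auto
    qed
    have lim: "(\<lambda>n. 16 * (real n + 1) * (4 powr (2 * real k) * 4 powr (- \<delta> * real n))) \<longlonglongrightarrow> 0"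
      using \<delta>(1) by real_asymp
    have nn: "\<forall>\<^sub>F n in sequentially. 0 \<le> c n"
      by (intro always_eventually allI) (simp add: c_def)
    have up: "\<forall>\<^sub>F n in sequentially. c n \<le> 16 * (real n + 1) * (4 powr (2 * real k) * 4 powr (- \<delta> * real n))"
      by (intro always_eventually allI le)
    have "c \<longlonglongrightarrow> 0" by (rule tendsto_sandwich[OF nn up tendsto_const lim])
    then show "(\<lambda>n. 1 * c n) \<longlonglongrightarrow> 0" by simp
  qed auto
  then show ?thesis
  proof (rule whp_mono, intro always_eventually allI impI)
    fix n \<omega> assume "\<forall>t\<in>{()}. Y n t \<omega> < 1"
    then have "4 * (1 - Z n \<omega> / E n)\<^sup>2 < 1" by (simp add: Y_def)
    moreover have "(2 * (1 - Z n \<omega> / E n))\<^sup>2 = 4 * (1 - Z n \<omega> / E n)\<^sup>2"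
      by (simp only: power_mult_distrib) simp
    ultimately have "(2 * (1 - Z n \<omega> / E n))\<^sup>2 < 1" by (simp only:)
    then have "2 * (1 - Z n \<omega> / E n) < 1" by (rule power2_less_imp_less[of _ 1, simplified])
    then have "E n / 2 < Z n \<omega>" using E[of n] by (simp add: field_simps)
    then show "mass_lower \<gamma> \<delta> k n \<omega>" by (simp add: mass_lower_def E_def Z_def M_def)
  qed
qed

section \<open>Mass of the thick points\<close>

definition thin_point :: "real \<Rightarrow> nat \<Rightarrow> nat \<Rightarrow> sample \<Rightarrow> vtx \<Rightarrow> bool" where
  "thin_point \<eta> k n \<omega> u \<longleftrightarrow> (\<forall>l\<le>n div k.
     pphi k l (n div k) \<omega> u \<le> 2 * ln 2 * real (k * (n div k - l)) + 2 * \<eta> * real n)"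

text \<open>If \<open>u\<close> violates the condition at \<open>l\<close>, the factor
  \<open>exp (pphi k l m \<omega> u - t l)\<close> is at least 1 and may be inserted; the resulting
  sums are bounded by \<open>thin\<close>. The slack \<open>2 * \<eta>\<close> here against
  \<open>\<eta>\<close> there is the gain \<open>exp (- \<eta> * n)\<close>.\<close>

lemma thick_mass:
  assumes thin: "thin \<gamma> \<eta> k n \<omega>"
  shows "(\<Sum>u\<in>{u \<in> VN n. \<not> thin_point \<eta> k n \<omega> u}. exp (\<gamma> * pphi k 0 (n div k) \<omega> u)) \<le>
    (real n + 1) * (4 ^ n * exp (\<gamma>\<^sup>2 * real (k * (n div k)) / 2 - \<eta> * real n))"
proof -
  define m where "m = n div k"
  define t where "t l = 2 * ln 2 * real (k * (m - l)) + 2 * \<eta> * real n" for l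
  have "(\<Sum>u\<in>{u \<in> VN n. \<not> thin_point \<eta> k n \<omega> u}. exp (\<gamma> * pphi k 0 m \<omega> u)) \<le>
     (\<Sum>u\<in>{u \<in> VN n. \<not> thin_point \<eta> k n \<omega> u}. \<Sum>l\<le>m. exp (\<gamma> * pphi k 0 m \<omega> u + pphi k l m \<omega> u - t l))"
  proof (rule sum_mono)
    fix u assume "u \<in> {u \<in> VN n. \<not> thin_point \<eta> k n \<omega> u}"
    then obtain l where l: "l \<le> m" "t l < pphi k l m \<omega> u" by (auto simp: thin_point_def t_def m_def not_le)
    then have "exp (\<gamma> * pphi k 0 m \<omega> u) \<le> exp (\<gamma> * pphi k 0 m \<omega> u + pphi k l m \<omega> u - t l)" by simp
    also have "\<dots> \<le> (\<Sum>l\<le>m. exp (\<gamma> * pphi k 0 m \<omega> u + pphi k l m \<omega> u - t l))"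
      by (rule member_le_sum) (use l in auto)
    finally show "exp (\<gamma> * pphi k 0 m \<omega> u) \<le> \<dots>" .
  qed
  also have "\<dots> \<le> (\<Sum>u\<in>VN n. \<Sum>l\<le>m. exp (\<gamma> * pphi k 0 m \<omega> u + pphi k l m \<omega> u - t l))"
    by (rule sum_mono2) (auto intro: sum_nonneg)
  also have "\<dots> = (\<Sum>l\<le>m. (\<Sum>u\<in>VN n. exp (\<gamma> * pphi k 0 m \<omega> u + pphi k l m \<omega> u)) * exp (- t l))"
    by (subst sum.swap) (simp add: exp_diff exp_minus field_simps sum_divide_distrib)
  also have "\<dots> \<le> (\<Sum>l\<le>m. 4 ^ n * exp (\<gamma>\<^sup>2 * real (k * m) / 2 - \<eta> * real n))"
  proof (rule sum_mono)
    fix l assume "l \<in> {..m}"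
    then have "(\<Sum>u\<in>VN n. exp (\<gamma> * pphi k 0 m \<omega> u + pphi k l m \<omega> u)) * exp (- t l) \<le>
      4 ^ n * exp (\<gamma>\<^sup>2 * real (k * m) / 2 + 2 * ln 2 * real (k * (m - l)) + \<eta> * real n) * exp (- t l)"
      using thin by (intro mult_right_mono) (auto simp: thin_def m_def intro: less_imp_le)
    also have "\<dots> = 4 ^ n * exp (\<gamma>\<^sup>2 * real (k * m) / 2 - \<eta> * real n)"
      unfolding mult.assoc exp_add[symmetric] by (simp add: t_def algebra_simps)
    finally show "(\<Sum>u\<in>VN n. exp (\<gamma> * pphi k 0 m \<omega> u + pphi k l m \<omega> u)) * exp (- t l) \<le> \<dots>" .
  qed
  also have "\<dots> = (real m + 1) * (4 ^ n * exp (\<gamma>\<^sup>2 * real (k * m) / 2 - \<eta> * real n))" by simp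
  also have "\<dots> \<le> (real n + 1) * (4 ^ n * exp (\<gamma>\<^sup>2 * real (k * m) / 2 - \<eta> * real n))"
    by (rule mult_right_mono) (auto simp: m_def)
  finally show ?thesis by (simp add: m_def)
qed

lemma exp_ln2_real: "exp (ln 2 * real i) = 2 ^ i"
  by (simp add: exp_of_nat2_mult)

subsection \<open>Lower and upper bounds for the distance\<close>

text \<open>A path from \<open>u\<close> to \<open>v\<close> is a star-connected set of diameter at
  least that of the scale left when a \<delta>2-fraction of the levels is removed;
  \<open>crude \<delta>2\<close> restores these levels. The parameter \<delta>1 governs the error in
  the mass of the path and can be chosen much smaller.\<close>

lemma fpp_lower_bound:
  assumes good: "good_skel a \<delta>1 k n \<omega>" and crude: "crude \<delta>1 k n \<omega>" "crude \<delta>2 k n \<omega>"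
    and par: "0 < a" "7 \<le> k" "0 < \<delta>1" "0 < \<delta>2" "0 < \<gamma>"
    and uv: "wreach (VN n) w u v c"
    and far: "2 ^ ((n div k - top_levels \<delta>2 k n) * k) \<le> cheb u v"
  shows "2 ^ ((k - 6) * (n div k - top_levels \<delta>2 k n)) * exp (- \<gamma> * (a * real n + 2 * sqrt \<delta>1 * real n)) *
      exp (- \<gamma> * (2 * sqrt \<delta>2 * real n)) \<le> fpp_dist \<gamma> k n \<omega> u v"
proof (rule fpp_dist_ge[OF uv])
  define J where "J = n div k - top_levels \<delta>2 k n"
  have J: "J \<le> n div k" "n div k - J \<le> top_levels \<delta>2 k n" by (auto simp: J_def)
  fix P assume P: "set P \<subseteq> VN n" "u \<in> set P" "(star_step (set P))\<^sup>*\<^sup>* u v"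
  have mass: "2 ^ ((k - 6) * J) * exp (- \<gamma> * (a * real n + 2 * sqrt \<delta>1 * real n)) \<le>
     (\<Sum>w\<in>set P. exp (1 * \<gamma> * pphi k 0 J \<omega> w))"
    by (rule star_connected_mass[OF good crude(1) par(1,2,3,5) _ J(1) P]) (use far in \<open>auto simp: J_def\<close>)
  have "2 ^ ((k - 6) * J) * exp (- \<gamma> * (a * real n + 2 * sqrt \<delta>1 * real n)) * exp (- \<gamma> * (2 * sqrt \<delta>2 * real n)) \<le>
    (\<Sum>w\<in>set P. exp (1 * \<gamma> * pphi k 0 J \<omega> w)) * exp (- \<gamma> * (2 * sqrt \<delta>2 * real n))"
    by (rule mult_right_mono[OF mass]) simp
  also have "\<dots> = (\<Sum>w\<in>set P. exp (1 * \<gamma> * pphi k 0 J \<omega> w) * exp (- \<gamma> * (2 * sqrt \<delta>2 * real n)))"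
    by (simp add: sum_distrib_right)
  also have "\<dots> \<le> (\<Sum>w\<in>set P. exp (\<gamma> * phi k n \<omega> w))"
  proof (rule sum_mono)
    fix w assume "w \<in> set P"
    then have "w \<in> VN n" using P(1) by blast
    then have "\<bar>pphi k J (n div k) \<omega> w\<bar> \<le> 2 * sqrt \<delta>2 * real n"
      using crude(2) J unfolding crude_def by blast
    then have "- (2 * sqrt \<delta>2 * real n) \<le> pphi k J (n div k) \<omega> w" by linarith
    then have "\<gamma> * - (2 * sqrt \<delta>2 * real n) \<le> \<gamma> * pphi k J (n div k) \<omega> w"
      using par(5) by (intro mult_left_mono) auto
    then have "1 * \<gamma> * pphi k 0 J \<omega> w + - \<gamma> * (2 * sqrt \<delta>2 * real n) \<le> \<gamma> * phi k n \<omega> w"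
      unfolding phi_eq_pphi pphi_split[OF le0 J(1), of k \<omega> w] by (simp add: distrib_left)
    then show "exp (1 * \<gamma> * pphi k 0 J \<omega> w) * exp (- \<gamma> * (2 * sqrt \<delta>2 * real n)) \<le> exp (\<gamma> * phi k n \<omega> w)"
      by (simp only: exp_add[symmetric] exp_le_cancel_iff)
  qed
  finally show "2 ^ ((k - 6) * (n div k - top_levels \<delta>2 k n)) * exp (- \<gamma> * (a * real n + 2 * sqrt \<delta>1 * real n)) *
      exp (- \<gamma> * (2 * sqrt \<delta>2 * real n)) \<le> (\<Sum>x\<in>set P. exp (\<gamma> * phi k n \<omega> x))" by (simp add: J_def)
qed

text \<open>With test mass \<open>exp (- \<gamma> \<phi>)\<close> the weighted sum over the square
  is exactly R^2, so the threshold is 2 R^2 / L, where L bounds the mass of a cut at scale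
  \<open>l\<close> from below and the factor 2 gives strictness. \<open>h\<close> bounds the levels
  from \<open>l\<close> on.\<close>

lemma connect_in_square:
  fixes x0 y0 R :: int
  defines "Q \<equiv> square x0 y0 R"
  assumes good: "good_skel a \<delta> k n \<omega>" "crude \<delta> k n \<omega>"
    and par: "0 < a" "7 \<le> k" "0 < \<delta>" "0 < \<gamma>"
    and Q: "Q \<subseteq> VN n" "0 < R" and l: "l \<le> n div k"
    and h: "\<And>x. x \<in> Q \<Longrightarrow> \<gamma> * pphi k l (n div k) \<omega> x \<le> h"
    and A: "A \<subseteq> Q" "A \<noteq> {}" "\<And>x y. x \<in> A \<Longrightarrow> y \<in> A \<Longrightarrow> (nn_step A)\<^sup>*\<^sup>* x y"
    and B: "B \<subseteq> Q" "B \<noteq> {}" "\<And>x y. x \<in> B \<Longrightarrow> y \<in> B \<Longrightarrow> (nn_step B)\<^sup>*\<^sup>* x y"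
    and dA: "0 < l \<Longrightarrow> \<exists>x\<in>A. \<exists>y\<in>A. 2 * 2 ^ (l * k) \<le> cheb x y"
    and dB: "0 < l \<Longrightarrow> \<exists>x\<in>B. \<exists>y\<in>B. 2 * 2 ^ (l * k) \<le> cheb x y"
  shows "A \<inter> B \<noteq> {} \<or> (\<exists>x\<in>A. \<exists>y\<in>B.
     \<exists>c\<le>2 * (real_of_int R)\<^sup>2 * exp (h + \<gamma> * (a * real n + 2 * sqrt \<delta> * real n)) / 2 ^ ((k - 6) * l).
       wreach Q (\<lambda>x. exp (\<gamma> * phi k n \<omega> x)) x y c)"
  unfolding Q_def
proof (rule connecting_path[where g = "\<lambda>x. exp (- (\<gamma> * phi k n \<omega> x))" and \<rho> = "2 ^ (l * k) - 1"
      and L = "2 ^ ((k - 6) * l) * exp (- h - \<gamma> * (a * real n + 2 * sqrt \<delta> * real n))"])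
  \<comment> \<open>At \<open>l = 0\<close> the required diameter is 0 and single vertices suffice,
    so widths of \<open>A\<close> and \<open>B\<close> are demanded only for
    \<open>l > 0\<close>.\<close>
  have l0: "0 < l" if "0 < (2::int) ^ (l * k) - 1" using that by (cases l) auto
  have weaken: "\<exists>x\<in>X. \<exists>y\<in>X. 2 * (2 ^ (l * k) - 1) + 1 \<le> cheb x y"
    if dist: "\<exists>x\<in>X. \<exists>y\<in>X. 2 * 2 ^ (l * k) \<le> cheb x y" for X
  proof -
    obtain x y where "x \<in> X" "y \<in> X" "2 * 2 ^ (l * k) \<le> cheb x y" using dist by blast
    moreover from this have "2 * (2 ^ (l * k) - 1) + 1 \<le> cheb x y" by simp
    ultimately show ?thesis by blast
  qed
  show "\<exists>x\<in>A. \<exists>y\<in>A. 2 * (2 ^ (l * k) - 1) + 1 \<le> cheb x y" if "0 < (2::int) ^ (l * k) - 1"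
    by (rule weaken[OF dA[OF l0[OF that]]])
  show "\<exists>x\<in>B. \<exists>y\<in>B. 2 * (2 ^ (l * k) - 1) + 1 \<le> cheb x y" if "0 < (2::int) ^ (l * k) - 1"
    by (rule weaken[OF dB[OF l0[OF that]]])
  show "2 ^ ((k - 6) * l) * exp (- h - \<gamma> * (a * real n + 2 * sqrt \<delta> * real n)) \<le> (\<Sum>x\<in>G. exp (- (\<gamma> * phi k n \<omega> x)))"
    if G: "G \<subseteq> square x0 y0 R" "x \<in> G" "(star_step G)\<^sup>*\<^sup>* x y" "2 ^ (l * k) - 1 \<le> cheb x y" for G x y
  proof -
    have GV: "G \<subseteq> VN n" using G(1) Q(1) by (simp add: Q_def)
    have mass: "2 ^ ((k - 6) * l) * exp (- \<gamma> * (a * real n + 2 * sqrt \<delta> * real n)) \<le>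
       (\<Sum>w\<in>G. exp (- 1 * \<gamma> * pphi k 0 l \<omega> w))"
      by (rule star_connected_mass[OF good par _ l GV G(2-4)]) simp
    have "2 ^ ((k - 6) * l) * exp (- h - \<gamma> * (a * real n + 2 * sqrt \<delta> * real n)) =
      (2 ^ ((k - 6) * l) * exp (- \<gamma> * (a * real n + 2 * sqrt \<delta> * real n))) * exp (- h)"
      by (simp add: mult.assoc flip: exp_add)
    also have "\<dots> \<le> (\<Sum>w\<in>G. exp (- 1 * \<gamma> * pphi k 0 l \<omega> w)) * exp (- h)"
      by (rule mult_right_mono[OF mass]) simp
    also have "\<dots> = (\<Sum>w\<in>G. exp (- 1 * \<gamma> * pphi k 0 l \<omega> w) * exp (- h))"
      by (simp add: sum_distrib_right)
    also have "\<dots> \<le> (\<Sum>w\<in>G. exp (- (\<gamma> * phi k n \<omega> w)))"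
    proof (rule sum_mono)
      fix w assume "w \<in> G"
      then have "\<gamma> * pphi k l (n div k) \<omega> w \<le> h" using G(1) h unfolding Q_def by blast
      then have "- 1 * \<gamma> * pphi k 0 l \<omega> w + - h \<le> - (\<gamma> * phi k n \<omega> w)"
        unfolding phi_eq_pphi pphi_split[OF le0 l, of k \<omega> w] by (simp add: distrib_left)
      then show "exp (- 1 * \<gamma> * pphi k 0 l \<omega> w) * exp (- h) \<le> exp (- (\<gamma> * phi k n \<omega> w))"
        by (simp only: exp_add[symmetric] exp_le_cancel_iff)
    qed
    finally show ?thesis .
  qed
  show "0 < 2 * (real_of_int R)\<^sup>2 * exp (h + \<gamma> * (a * real n + 2 * sqrt \<delta> * real n)) / 2 ^ ((k - 6) * l)"
    using Q(2) by simp
  have card: "real (card (square x0 y0 R)) = (real_of_int R)\<^sup>2"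
    using Q(2) by (simp add: square_def card_cartesian_product power2_eq_square)
  have "(\<Sum>x\<in>square x0 y0 R. exp (- (\<gamma> * phi k n \<omega> x)) * exp (\<gamma> * phi k n \<omega> x)) = (real_of_int R)\<^sup>2"
    by (simp add: card flip: exp_add)
  also have "\<dots> < 2 * (real_of_int R)\<^sup>2" using Q(2) by simp
  also have "\<dots> = 2 * (real_of_int R)\<^sup>2 *
      (exp (h + \<gamma> * (a * real n + 2 * sqrt \<delta> * real n)) * exp (- h - \<gamma> * (a * real n + 2 * sqrt \<delta> * real n)))"
    unfolding exp_add[symmetric] by simp
  also have "\<dots> = 2 * (real_of_int R)\<^sup>2 * exp (h + \<gamma> * (a * real n + 2 * sqrt \<delta> * real n)) / 2 ^ ((k - 6) * l) *
     (2 ^ ((k - 6) * l) * exp (- h - \<gamma> * (a * real n + 2 * sqrt \<delta> * real n)))"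
    by simp
  finally show "(\<Sum>x\<in>square x0 y0 R. exp (- (\<gamma> * phi k n \<omega> x)) * exp (\<gamma> * phi k n \<omega> x)) <
     2 * (real_of_int R)\<^sup>2 * exp (h + \<gamma> * (a * real n + 2 * sqrt \<delta> * real n)) / 2 ^ ((k - 6) * l) *
     (2 ^ ((k - 6) * l) * exp (- h - \<gamma> * (a * real n + 2 * sqrt \<delta> * real n)))" .
qed (use A B in \<open>auto simp: Q_def\<close>)

text \<open>With \<open>m = n div k\<close>, the exponents of
  \<open>R^2 \<le> 2^(2 (l+2) k)\<close>, \<open>2^(k (m - l))\<close> and
  \<open>1 / 2^((k-6) l)\<close> add up to \<open>4 k + k m + 6 l\<close>. The scale survives only
  in \<open>6 l \<le> 6 m\<close>, so one cost serves all scales.\<close>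

definition step_cost :: "real \<Rightarrow> real \<Rightarrow> real \<Rightarrow> real \<Rightarrow> nat \<Rightarrow> nat \<Rightarrow> real" where
  "step_cost \<gamma> \<eta> a \<delta> k n = 2 * 2 ^ (4 * k + k * (n div k) + 6 * (n div k)) *
     exp (2 * \<eta> * real n + \<gamma> * (a * real n + 2 * sqrt \<delta> * real n))"

text \<open>\<open>smooth_top\<close> spreads the thin bound at \<open>u\<close> over the square,
  and \<gamma> < 1/2 halves its slope \<open>2 * ln 2\<close>. The resulting factor
  \<open>2^(k (m - l))\<close> is just what separates scale \<open>l\<close> from the full
  size.\<close>

lemma connect_near_thin_point:
  fixes x0 y0 R :: int
  defines "Q \<equiv> square x0 y0 R"
  assumes good: "good_skel a \<delta> k n \<omega>" "crude \<delta> k n \<omega>" "smooth_top \<eta> k n \<omega>"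
    and par: "0 < a" "7 \<le> k" "0 < \<delta>" "0 < \<gamma>" "\<gamma> < 1 / 2" "0 < \<eta>"
    and u: "u \<in> Q" "thin_point \<eta> k n \<omega> u"
    and Q: "Q \<subseteq> VN n" "0 < R" "R \<le> 2 ^ ((l + 2) * k)" and l: "l \<le> n div k"
    and A: "A \<subseteq> Q" "A \<noteq> {}" "\<And>x y. x \<in> A \<Longrightarrow> y \<in> A \<Longrightarrow> (nn_step A)\<^sup>*\<^sup>* x y"
    and B: "B \<subseteq> Q" "B \<noteq> {}" "\<And>x y. x \<in> B \<Longrightarrow> y \<in> B \<Longrightarrow> (nn_step B)\<^sup>*\<^sup>* x y"
    and dA: "0 < l \<Longrightarrow> \<exists>x\<in>A. \<exists>y\<in>A. 2 * 2 ^ (l * k) \<le> cheb x y"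
    and dB: "0 < l \<Longrightarrow> \<exists>x\<in>B. \<exists>y\<in>B. 2 * 2 ^ (l * k) \<le> cheb x y"
  shows "A \<inter> B \<noteq> {} \<or> (\<exists>x\<in>A. \<exists>y\<in>B. \<exists>c\<le>step_cost \<gamma> \<eta> a \<delta> k n.
       wreach Q (\<lambda>x. exp (\<gamma> * phi k n \<omega> x)) x y c)"
proof -
  define m where "m = n div k"
  define h where "h = ln 2 * real (k * (m - l)) + 2 * \<eta> * real n"
  define T where "T = 2 * (real_of_int R)\<^sup>2 * exp (h + \<gamma> * (a * real n + 2 * sqrt \<delta> * real n)) / 2 ^ ((k - 6) * l)"
  have lm: "l \<le> m" using l by (simp add: m_def)
  have h_bound: "\<gamma> * pphi k l (n div k) \<omega> x \<le> h" if x: "x \<in> Q" for x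
  proof -
    have "cheb x u < R" unfolding Q_def by (rule cheb_less_square[of _ x0 y0]) (use x u in \<open>auto simp: Q_def\<close>)
    then have near: "cheb x u \<le> 2 ^ ((l + 2) * k)" using Q(3) by linarith
    \<comment> \<open>4 \<eta> leaves room above the needed 2 \<eta> + \<eta>, so that half of
      \<open>s\<close> is \<open>h\<close>.\<close>
    define s where "s = 2 * ln 2 * real (k * (m - l)) + 4 * \<eta> * real n"
    have "pphi k l (n div k) \<omega> x \<le> pphi k l (n div k) \<omega> u + \<eta> * real n"
      using good(3) x u(1) Q(1) l near unfolding smooth_top_def by blast
    also have "pphi k l (n div k) \<omega> u \<le> 2 * ln 2 * real (k * (m - l)) + 2 * \<eta> * real n"
      using u(2) l by (simp add: thin_point_def m_def)
    finally have "pphi k l (n div k) \<omega> x \<le> s"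
      using mult_nonneg_nonneg[of \<eta> "real n"] par(6) unfolding s_def by linarith
    moreover have "0 \<le> s" using par(6) by (simp add: s_def)
    ultimately have "\<gamma> * pphi k l (n div k) \<omega> x \<le> 1 / 2 * s"
      using par(4,5) by (meson less_imp_le mult_left_mono mult_right_mono order_trans)
    then show ?thesis by (simp add: s_def h_def)
  qed
  have "T \<le> step_cost \<gamma> \<eta> a \<delta> k n"
  proof -
    have R2: "(real_of_int R)\<^sup>2 \<le> 2 ^ (2 * ((l + 2) * k))"
    proof -
      have "real_of_int R \<le> 2 ^ ((l + 2) * k)"
        using Q(3) by (metis of_int_le_iff of_int_numeral of_int_power)
      then have "(real_of_int R)\<^sup>2 \<le> (2 ^ ((l + 2) * k))\<^sup>2" using Q(2) by (intro power_mono) auto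
      then show ?thesis by (simp add: power_mult[symmetric] mult.commute)
    qed
    have eh: "exp (h + \<gamma> * (a * real n + 2 * sqrt \<delta> * real n)) =
       2 ^ (k * (m - l)) * exp (2 * \<eta> * real n + \<gamma> * (a * real n + 2 * sqrt \<delta> * real n))"
    proof -
      have "exp (ln 2 * real (k * (m - l))) = (2::real) ^ (k * (m - l))"
        by (rule exp_ln2_real)
      then show ?thesis by (simp add: h_def exp_add)
    qed
    have "2 * ((l + 2) * k) + k * (m - l) \<le> 4 * k + k * m + 6 * m + (k - 6) * l"
    proof -
      obtain d where d: "m = l + d" using lm le_Suc_ex by blast
      obtain k' where k': "k = 6 + k'" using par(2) le_Suc_ex[of 6 k] by auto
      show ?thesis by (simp add: d k' algebra_simps)
    qed
    then have "(2::real) ^ (2 * ((l + 2) * k) + k * (m - l)) \<le> 2 ^ (4 * k + k * m + 6 * m + (k - 6) * l)"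
      by (rule power_increasing) simp
    then have p: "(2::real) ^ (2 * ((l + 2) * k)) * 2 ^ (k * (m - l)) \<le> 2 ^ (4 * k + k * m + 6 * m) * 2 ^ ((k - 6) * l)"
      by (simp only: power_add)
    define X where "X = exp (2 * \<eta> * real n + \<gamma> * (a * real n + 2 * sqrt \<delta> * real n))"
    have X: "0 < X" by (simp add: X_def)
    have "(real_of_int R)\<^sup>2 * 2 ^ (k * (m - l)) \<le> 2 ^ (2 * ((l + 2) * k)) * 2 ^ (k * (m - l))"
      using R2 by (rule mult_right_mono) simp
    also note p
    finally have "2 * X * ((real_of_int R)\<^sup>2 * 2 ^ (k * (m - l))) \<le> 2 * X * (2 ^ (4 * k + k * m + 6 * m) * 2 ^ ((k - 6) * l))"
      using X by (intro mult_left_mono) auto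
    then have "2 * (real_of_int R)\<^sup>2 * (2 ^ (k * (m - l)) * X) \<le> (2 * 2 ^ (4 * k + k * m + 6 * m) * X) * 2 ^ ((k - 6) * l)"
      by (simp only: mult_ac)
    then show ?thesis
      unfolding T_def eh step_cost_def m_def[symmetric] X_def[symmetric]
      by (simp only: pos_divide_le_eq zero_less_power zero_less_numeral)
  qed
  moreover have "A \<inter> B \<noteq> {} \<or> (\<exists>x\<in>A. \<exists>y\<in>B. \<exists>c\<le>T. wreach Q (\<lambda>x. exp (\<gamma> * phi k n \<omega> x)) x y c)"
    unfolding T_def Q_def
    by (rule connect_in_square[OF good(1,2) par(1-4)]) (use Q l h_bound A B dA dB in \<open>auto simp: Q_def\<close>)
  ultimately show ?thesis by (meson order_trans)
qed

section \<open>Dyadic blocks and the escape of balls through the scales\<close>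

definition block :: "nat \<Rightarrow> vtx \<Rightarrow> vtx set" where
  "block s u = {x. cellv s x = cellv s u}"

lemma block_eq_square: "block s u = square (2 ^ s * fst (cellv s u)) (2 ^ s * snd (cellv s u)) (2 ^ s)"
proof -
  have *: "x div 2 ^ s = b \<longleftrightarrow> 2 ^ s * b \<le> x \<and> x < 2 ^ s * b + 2 ^ s" for x b :: int
  proof
    assume "x div 2 ^ s = b"
    then show "2 ^ s * b \<le> x \<and> x < 2 ^ s * b + 2 ^ s"
      using cellv_bounds(1,2)[where s = s and w = "(x, 0)"] by (simp add: cellv_def)
  next
    assume "2 ^ s * b \<le> x \<and> x < 2 ^ s * b + 2 ^ s"
    then show "x div 2 ^ s = b"
      using div_pos_geq int_div_pos_eq[of x "2 ^ s" b "x - 2 ^ s * b"] by simp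
  qed
  show ?thesis
    by (auto simp: block_def square_def cellv_def *)
qed

lemma block_mono: "block s u \<subseteq> block (s + t) u"
  by (auto simp: block_def cellv_add)

lemma block_self: "u \<in> block s u"
  by (simp add: block_def)

text \<open>The side of \<open>VN n\<close> is a power of two, so aligned blocks never cross its
  boundary, unlike squares centred at \<open>u\<close>.\<close>

lemma block_subset_VN:
  assumes "u \<in> VN n" "s \<le> n"
  shows "block s u \<subseteq> VN n"
proof -
  have "cellv n u = (0, 0)" using assms(1) by (auto simp: VN_def cellv_def)
  then have "block n u = square 0 0 (2 ^ n)" by (simp add: block_eq_square)
  then show ?thesis using block_mono[of s u "n - s"] assms(2) by (simp add: VN_eq_square)
qed

lemma column_connected:
  assumes "x \<in> {a} \<times> {y0..<y1}" "y \<in> {a} \<times> {y0..<y1}"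
  shows "(nn_step ({a} \<times> {y0..<y1}))\<^sup>*\<^sup>* x y"
proof -
  have base: "t < y1 \<longrightarrow> (nn_step ({a} \<times> {y0..<y1}))\<^sup>*\<^sup>* (a, y0) (a, t)" if "y0 \<le> t" for t
    using that
  proof (induction t rule: int_ge_induct)
    case (step i)
    show ?case
    proof
      assume i: "i + 1 < y1"
      then have "(nn_step ({a} \<times> {y0..<y1}))\<^sup>*\<^sup>* (a, y0) (a, i)" using step by simp
      moreover have "nn_step ({a} \<times> {y0..<y1}) (a, i) (a, i + 1)"
        using i step.hyps by (simp add: nn_step_def nbr_def)
      ultimately show "(nn_step ({a} \<times> {y0..<y1}))\<^sup>*\<^sup>* (a, y0) (a, i + 1)"
        by (rule rtranclp.rtrancl_into_rtrancl)
    qed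
  qed simp
  obtain t t' where "x = (a, t)" "y = (a, t')" "y0 \<le> t" "t < y1" "y0 \<le> t'" "t' < y1" using assms by auto
  then show ?thesis using base nn_path_sym by (metis rtranclp_trans)
qed

text \<open>Balls around a thin point escape from block to block: at each scale the current ball is
  connected to the far side of the next block.\<close>

lemma thin_point_escape:
  fixes \<omega> :: sample
  defines "w \<equiv> \<lambda>n k \<gamma> x. exp (\<gamma> * phi k n \<omega> x)"
  assumes good: "good_skel a \<delta> k n \<omega>" "crude \<delta> k n \<omega>" "smooth_top \<eta> k n \<omega>"
    and par: "0 < a" "7 \<le> k" "0 < \<delta>" "0 < \<gamma>" "\<gamma> < 1 / 2" "0 < \<eta>"
    and u: "u \<in> VN n" "thin_point \<eta> k n \<omega> u"
    and j: "j \<le> n div k"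
  shows "\<exists>b. \<exists>c\<le>real (j + 1) * step_cost \<gamma> \<eta> a \<delta> k n.
     wreach (block (j * k) u) (w n k \<gamma>) u b c \<and> (1 \<le> j \<longrightarrow> 2 ^ (j * k) \<le> 2 * cheb u b)"
  using j
proof (induction j)
  case 0
  define m where "m = n div k"
  have "phi k n \<omega> u \<le> 2 * ln 2 * real (k * m) + 2 * \<eta> * real n"
    using u(2) unfolding thin_point_def phi_eq_pphi m_def by (metis diff_zero le0)
  moreover have "0 \<le> 2 * ln 2 * real (k * m) + 2 * \<eta> * real n" using par(6) by simp
  ultimately have "\<gamma> * phi k n \<omega> u \<le> 1 / 2 * (2 * ln 2 * real (k * m) + 2 * \<eta> * real n)"
    using par(4,5) by (meson less_imp_le mult_left_mono mult_right_mono order_trans)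
  also have "\<dots> \<le> ln 2 * real (k * m) + (2 * \<eta> * real n + \<gamma> * (a * real n + 2 * sqrt \<delta> * real n))"
    using par by simp
  finally have "w n k \<gamma> u \<le> exp (ln 2 * real (k * m) + (2 * \<eta> * real n + \<gamma> * (a * real n + 2 * sqrt \<delta> * real n)))"
    by (simp add: w_def)
  also have "\<dots> = 2 ^ (k * m) * exp (2 * \<eta> * real n + \<gamma> * (a * real n + 2 * sqrt \<delta> * real n))"
    by (simp only: exp_add[of "ln 2 * real (k * m)"] exp_ln2_real)
  also have "\<dots> \<le> (2 * 2 ^ (4 * k + k * m + 6 * m)) * exp (2 * \<eta> * real n + \<gamma> * (a * real n + 2 * sqrt \<delta> * real n))"
  proof (rule mult_right_mono)
    have "(2::real) ^ (k * m) \<le> 2 ^ (4 * k + k * m + 6 * m)" by (rule power_increasing) auto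
    then show "(2::real) ^ (k * m) \<le> 2 * 2 ^ (4 * k + k * m + 6 * m)"
      by (smt (verit) zero_less_power)
  qed simp
  finally have "w n k \<gamma> u \<le> step_cost \<gamma> \<eta> a \<delta> k n" by (simp add: step_cost_def m_def)
  moreover have "wreach (block (0 * k) u) (w n k \<gamma>) u u (w n k \<gamma> u)"
    by (rule wreach.base) (rule block_self)
  ultimately show ?case by (intro exI[of _ u] exI[of _ "w n k \<gamma> u"]) simp
next
  case (Suc j)
  define T where "T = step_cost \<gamma> \<eta> a \<delta> k n"
  obtain b c where b: "c \<le> real (j + 1) * T" "wreach (block (j * k) u) (w n k \<gamma>) u b c"
    "1 \<le> j \<Longrightarrow> 2 ^ (j * k) \<le> 2 * cheb u b"
    using Suc unfolding T_def by auto
  define s where "s = Suc j * k"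
  define R :: int where "R = 2 ^ s"
  define x0 where "x0 = 2 ^ s * fst (cellv s u)"
  define y0 where "y0 = 2 ^ s * snd (cellv s u)"
  \<comment> \<open>For \<open>j \<ge> 1\<close> the ball has diameter at least 2^(j k) / 2, wide
    enough for cuts at scale j - 1 since 2^k \<ge> 4, and the block has side 2^((l+2) k). For
    \<open>j = 0\<close> truncated subtraction gives \<open>l = 0\<close>, where no width is
    required.\<close>
  define l where "l = j - 1"
  have T0: "0 \<le> T" by (simp add: T_def step_cost_def)
  have Qsq: "block s u = square x0 y0 R" by (simp add: block_eq_square x0_def y0_def R_def)
  have "k * Suc j \<le> k * (n div k)" using Suc.prems by (intro mult_left_mono) auto
  then have "k * Suc j \<le> n" by (rule le_trans[OF _ levels_le])
  then have sn: "s \<le> n" by (simp only: s_def mult.commute)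
  have QV: "block s u \<subseteq> VN n" by (rule block_subset_VN[OF u(1) sn])
  have wpos: "0 < w n k \<gamma> x" for x by (simp add: w_def)
  have sub: "block (j * k) u \<subseteq> block s u"
    using block_mono[of "j * k" u k] by (simp add: s_def add.commute)
  define A where "A = wball (block s u) (w n k \<gamma>) u (real (j + 1) * T)"
  have reach_b: "wreach (block s u) (w n k \<gamma>) u b c" by (rule wreach_mono[OF b(2) sub])
  have bA: "b \<in> A" unfolding A_def wball_def using reach_b b(1) by blast
  have uA: "u \<in> A"
  proof -
    have "w n k \<gamma> u \<le> c" by (rule wreach_ge[OF wreach_sym[OF reach_b]]) (rule wpos)
    then show ?thesis unfolding A_def wball_def using wreach.base[OF block_self] b(1) by (smt (verit) mem_Collect_eq)
  qed
  have uQ: "x0 \<le> fst u" "fst u < x0 + R" using block_self[of u s] by (auto simp: Qsq square_def)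
  \<comment> \<open>The vertical side of the block farther from \<open>u\<close>: its points are at
    distance at least R/2, which is the invariant at the next scale.\<close>
  define xs where "xs = (if 2 * (fst u - x0) < R then x0 + R - 1 else x0)"
  define B where "B = {xs} \<times> {y0..<y0 + R}"
  have Rpos: "0 < R" by (simp add: R_def)
  have Rbig: "2 * (2 * 2 ^ (l * k)) \<le> R"
  proof -
    have "2 + l * k \<le> s"
      using par(2) by (cases j) (auto simp: s_def l_def)
    then have "(2::int) ^ (2 + l * k) \<le> 2 ^ s" by (rule power_increasing) simp
    then show ?thesis by (simp add: R_def power_add)
  qed
  have xs: "x0 \<le> xs" "xs < x0 + R" using Rpos by (auto simp: xs_def)
  have far: "R \<le> 2 * cheb u y" if "y \<in> B" for y
  proof -
    have "even R" using par(2) by (simp add: R_def s_def)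
    then obtain r where r: "R = 2 * r" by (elim evenE)
    have "r \<le> \<bar>fst u - xs\<bar>"
    proof (cases "2 * (fst u - x0) < R")
      case True
      then have "r \<le> - (fst u - xs)" using r by (simp add: xs_def)
      then show ?thesis using abs_ge_minus_self[of "fst u - xs"] by linarith
    next
      case False
      then have "r \<le> fst u - xs" using r by (simp add: xs_def)
      then show ?thesis using abs_ge_self[of "fst u - xs"] by linarith
    qed
    moreover have "fst y = xs" using that by (auto simp: B_def)
    then have "\<bar>fst u - xs\<bar> \<le> cheb u y" by (simp add: cheb_def)
    ultimately show ?thesis using r by linarith
  qed
  have "A \<inter> B \<noteq> {} \<or> (\<exists>x\<in>A. \<exists>y\<in>B. \<exists>c\<le>T. wreach (block s u) (w n k \<gamma>) x y c)"
    unfolding T_def Qsq w_def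
  proof (rule connect_near_thin_point[OF good par])
    show "u \<in> square x0 y0 R" using block_self Qsq by blast
    show "thin_point \<eta> k n \<omega> u" by (rule u(2))
    show "square x0 y0 R \<subseteq> VN n" using QV Qsq by simp
    show "0 < R" by (rule Rpos)
    show "l \<le> n div k" using Suc.prems by (simp add: l_def)
    show "R \<le> 2 ^ ((l + 2) * k)" unfolding R_def s_def l_def
      by (intro power_increasing mult_right_mono) auto
    show "A \<subseteq> square x0 y0 R" using wreach_mem by (fastforce simp: A_def wball_def Qsq)
    show "A \<noteq> {}" using bA by blast
    show "(nn_step A)\<^sup>*\<^sup>* x y" if "x \<in> A" "y \<in> A" for x y
      using that unfolding A_def by (intro wball_connected wpos)
    show "B \<subseteq> square x0 y0 R" using xs by (auto simp: B_def square_def)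
    show "B \<noteq> {}" using Rpos by (auto simp: B_def)
    show "(nn_step B)\<^sup>*\<^sup>* x y" if "x \<in> B" "y \<in> B" for x y
      using that unfolding B_def by (rule column_connected)
    show "\<exists>x\<in>A. \<exists>y\<in>A. 2 * 2 ^ (l * k) \<le> cheb x y" if "0 < l"
    proof -
      have "2 + l * k \<le> j * k" using that par(2) by (cases j) (auto simp: l_def)
      then have "(2::int) ^ (2 + l * k) \<le> 2 ^ (j * k)" by (rule power_increasing) simp
      then have "2 * 2 ^ (l * k) \<le> cheb u b" using b(3) that by (simp add: power_add l_def)
      then show ?thesis using uA bA by blast
    qed
    show "\<exists>x\<in>B. \<exists>y\<in>B. 2 * 2 ^ (l * k) \<le> cheb x y" if "0 < l"
    proof (intro bexI)
      have "(1::int) \<le> 2 ^ (l * k)" by simp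
      then show "2 * 2 ^ (l * k) \<le> cheb (xs, y0) (xs, y0 + R - 1)" using Rbig unfolding cheb_def by simp
      show "(xs, y0) \<in> B" "(xs, y0 + R - 1) \<in> B" using Rpos by (auto simp: B_def)
    qed
  qed
  then obtain y c' where y: "y \<in> B" "wreach (block s u) (w n k \<gamma>) u y c'" "c' \<le> real (j + 1) * T + T"
  proof
    assume "A \<inter> B \<noteq> {}"
    then obtain y where "y \<in> A" "y \<in> B" by blast
    then obtain c' where "c' \<le> real (j + 1) * T" "wreach (block s u) (w n k \<gamma>) u y c'"
      by (auto simp: A_def wball_def)
    then show ?thesis using that[OF \<open>y \<in> B\<close>] T0 by simp
  next
    assume "\<exists>x\<in>A. \<exists>y\<in>B. \<exists>c\<le>T. wreach (block s u) (w n k \<gamma>) x y c"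
    then obtain x y c2 where x: "x \<in> A" "y \<in> B" "c2 \<le> T" "wreach (block s u) (w n k \<gamma>) x y c2" by blast
    then obtain c1 where c1: "c1 \<le> real (j + 1) * T" "wreach (block s u) (w n k \<gamma>) u x c1"
      by (auto simp: A_def wball_def)
    show ?thesis using that[OF x(2) wreach_trans[OF c1(2) x(4)]] c1(1) x(3) wpos[of x] by simp
  qed
  show ?case
  proof (intro exI[of _ y] exI[of _ c'] conjI impI)
    show "c' \<le> real (Suc j + 1) * step_cost \<gamma> \<eta> a \<delta> k n" using y(3) by (simp add: T_def algebra_simps)
    show "wreach (block (Suc j * k) u) (w n k \<gamma>) u y c'" using y(2) by (simp add: s_def)
    show "2 ^ (Suc j * k) \<le> 2 * cheb u y" using far[OF y(1)] by (simp only: R_def s_def)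
  qed
qed

text \<open>Both balls reach half the side of a top block, so one more duality step, in
  \<open>VN n\<close> with l = m - 1 and 2^n \<le> 2^((m+1) k), joins them. The cost is m + 1 steps
  for each ball and one for the junction, 2 m + 3 in all.\<close>

lemma thin_points_connected:
  assumes good: "good_skel a \<delta> k n \<omega>" "crude \<delta> k n \<omega>" "smooth_top \<eta> k n \<omega>"
    and par: "0 < a" "7 \<le> k" "0 < \<delta>" "0 < \<gamma>" "\<gamma> < 1 / 2" "0 < \<eta>"
    and u: "u \<in> VN n" "thin_point \<eta> k n \<omega> u" and v: "v \<in> VN n" "thin_point \<eta> k n \<omega> v"
    and n: "k \<le> n"
  shows "\<exists>c\<le>(2 * real n + 3) * step_cost \<gamma> \<eta> a \<delta> k n. wreach (VN n) (\<lambda>x. exp (\<gamma> * phi k n \<omega> x)) u v c"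
proof -
  define m where "m = n div k"
  define w where "w x = exp (\<gamma> * phi k n \<omega> x)" for x
  define T where "T = step_cost \<gamma> \<eta> a \<delta> k n"
  define l where "l = m - 1"
  have m1: "1 \<le> m" using n par(2) by (simp add: m_def div_greater_zero_iff Suc_le_eq)
  have wpos: "0 < w x" for x by (simp add: w_def)
  have T0: "0 \<le> T" by (simp add: T_def step_cost_def)
  have mk: "m * k \<le> n" by (simp add: m_def)
  have esc: "\<exists>b c. c \<le> real (m + 1) * T \<and> wreach (VN n) w x b c \<and> 2 ^ (m * k) \<le> 2 * cheb x b"
    if x: "x \<in> VN n" "thin_point \<eta> k n \<omega> x" for x
  proof -
    obtain b c where "c \<le> real (m + 1) * T" "wreach (block (m * k) x) w x b c" "2 ^ (m * k) \<le> 2 * cheb x b"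
      using thin_point_escape[OF good par x, of m] m1 unfolding T_def w_def m_def by blast
    then show ?thesis using wreach_mono[OF _ block_subset_VN[OF x(1) mk]] by blast
  qed
  define A where "A x = wball (VN n) w x (real (m + 1) * T)" for x
  have A: "A x \<subseteq> VN n" "x \<in> A x" "\<exists>b\<in>A x. 2 * 2 ^ (l * k) \<le> cheb x b"
     if x: "x \<in> VN n" "thin_point \<eta> k n \<omega> x" for x
  proof -
    obtain b c where b: "c \<le> real (m + 1) * T" "wreach (VN n) w x b c" "2 ^ (m * k) \<le> 2 * cheb x b"
      using esc[OF x] by blast
    show "A x \<subseteq> VN n" using wreach_mem by (fastforce simp: A_def wball_def)
    have "w x \<le> c" by (rule wreach_ge[OF wreach_sym[OF b(2)]]) (rule wpos)
    then show "x \<in> A x" unfolding A_def wball_def using wreach.base[OF x(1)] b(1) by (smt (verit) mem_Collect_eq)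
    have "2 + l * k \<le> m * k" using m1 par(2) by (cases m) (auto simp: l_def)
    then have "(2::int) ^ (2 + l * k) \<le> 2 ^ (m * k)" by (rule power_increasing) simp
    then have "2 * 2 ^ (l * k) \<le> cheb x b" using b(3) by (simp add: power_add)
    moreover have "b \<in> A x" unfolding A_def wball_def using b by blast
    ultimately show "\<exists>b\<in>A x. 2 * 2 ^ (l * k) \<le> cheb x b" by blast
  qed
  have "A u \<inter> A v \<noteq> {} \<or> (\<exists>x\<in>A u. \<exists>y\<in>A v. \<exists>c\<le>T. wreach (VN n) w x y c)"
    unfolding T_def VN_eq_square w_def
  proof (rule connect_near_thin_point[OF good par])
    show "u \<in> square 0 0 (2 ^ n)" using u(1) by (simp add: VN_eq_square)
    show "l \<le> n div k" by (simp add: l_def m_def)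
    have "n \<le> (l + 2) * k"
    proof -
      have "n < k * m + k" using par(2) mult_div_mod_eq[of k n] mod_less_divisor[of k n] unfolding m_def by linarith
      moreover have "l + 2 = m + 1" using m1 by (simp add: l_def)
      ultimately show ?thesis by (simp add: mult.commute)
    qed
    then show "(2::int) ^ n \<le> 2 ^ ((l + 2) * k)" by (rule power_increasing) simp
    show "(nn_step (A u))\<^sup>*\<^sup>* x y" if "x \<in> A u" "y \<in> A u" for x y
      using that unfolding A_def by (intro wball_connected wpos)
    show "(nn_step (A v))\<^sup>*\<^sup>* x y" if "x \<in> A v" "y \<in> A v" for x y
      using that unfolding A_def by (intro wball_connected wpos)
    show "\<exists>x\<in>A u. \<exists>y\<in>A u. 2 * 2 ^ (l * k) \<le> cheb x y" using A[OF u] by blast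
    show "\<exists>x\<in>A v. \<exists>y\<in>A v. 2 * 2 ^ (l * k) \<le> cheb x y" using A[OF v] by blast
    show "A u \<subseteq> square 0 0 (2 ^ n)" "A v \<subseteq> square 0 0 (2 ^ n)"
      using A(1)[OF u] A(1)[OF v] by (simp_all add: VN_eq_square)
    show "A u \<noteq> {}" "A v \<noteq> {}" using A(2)[OF u] A(2)[OF v] by blast+
  qed (use u(2) in \<open>auto simp: VN_eq_square\<close>)
  \<comment> \<open>The bound is \<open>T + w x\<close>, since a common vertex gives only the
    one-vertex walk of cost \<open>w x\<close>; gluing subtracts \<open>w x\<close> again.\<close>
  then obtain x y c where xy: "x \<in> A u" "y \<in> A v" "wreach (VN n) w x y c" "c \<le> T + w x"
  proof
    assume "A u \<inter> A v \<noteq> {}"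
    then obtain x where x: "x \<in> A u" "x \<in> A v" by blast
    then have "x \<in> VN n" using A(1)[OF u] by blast
    then show ?thesis using that[OF x wreach.base] T0 by simp
  next
    assume "\<exists>x\<in>A u. \<exists>y\<in>A v. \<exists>c\<le>T. wreach (VN n) w x y c"
    then obtain x y c where "x \<in> A u" "y \<in> A v" "c \<le> T" "wreach (VN n) w x y c" by blast
    then show ?thesis using that wpos[of x] by fastforce
  qed
  obtain c1 where c1: "c1 \<le> real (m + 1) * T" "wreach (VN n) w u x c1" using xy(1) by (auto simp: A_def wball_def)
  obtain c2 where c2: "c2 \<le> real (m + 1) * T" "wreach (VN n) w v y c2" using xy(2) by (auto simp: A_def wball_def)
  have uv: "wreach (VN n) w u v (c1 + c - w x + c2 - w y)"
    by (rule wreach_trans[OF wreach_trans[OF c1(2) xy(3)] wreach_sym[OF c2(2)]])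
  have "c1 + c - w x + c2 - w y \<le> real (m + 1) * T + T + real (m + 1) * T"
    using c1(1) c2(1) xy(4) wpos[of y] by linarith
  also have "\<dots> = (2 * real m + 3) * T" by (simp add: algebra_simps)
  also have "\<dots> \<le> (2 * real n + 3) * T"
    using T0 levels_le_self[of n k] by (intro mult_right_mono) (auto simp: m_def)
  finally show ?thesis using uv unfolding T_def w_def by blast
qed

subsection \<open>Assembling the estimates\<close>

lemma psi_measurable [measurable]: "(\<lambda>\<omega>. psi k \<omega> j z) \<in> borel_measurable gauss_space"
  unfolding psi_def by measurable

lemma phi_measurable [measurable]: "(\<lambda>\<omega>. phi k n \<omega> z) \<in> borel_measurable gauss_space"
  unfolding phi_def by measurable

text \<open>An infimum over countably many paths, and a constant if there are none.\<close>

lemma fpp_dist_measurable [measurable]: "(\<lambda>\<omega>. fpp_dist \<gamma> k n \<omega> u v) \<in> borel_measurable gauss_space"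
proof -
  have eq: "fpp_dist \<gamma> k n \<omega> u v = (INF P\<in>{P. is_path n P u v}. \<Sum>w\<leftarrow>P. exp (\<gamma> * phi k n \<omega> w))" for \<omega>
    unfolding fpp_dist_def by (rule arg_cong[where f = Inf]) auto
  have 1: "(\<lambda>\<omega>. \<Sum>w\<leftarrow>P. exp (\<gamma> * phi k n \<omega> w)) \<in> borel_measurable gauss_space" for P :: "vtx list"
    by (induction P) simp_all
  show ?thesis
  proof (cases "{P. is_path n P u v} = {}")
    case True
    then show ?thesis unfolding eq by simp
  next
    case False
    show ?thesis unfolding eq
      by (rule borel_measurable_cINF_real) (use 1 in auto)
  qed
qed

lemma lqg_measure_measurable [measurable]: "(\<lambda>\<omega>. lqg_measure \<gamma> k n \<omega> v) \<in> borel_measurable gauss_space"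
  unfolding lqg_measure_def by measurable

lemma good_pairs_event_measurable:
  "{\<omega>. t \<le> (\<Sum>p\<in>{(u, v) \<in> VN n \<times> VN n. a \<le> fpp_dist \<gamma> k n \<omega> u v \<and> fpp_dist \<gamma> k n \<omega> u v \<le> b}.
     lqg_measure \<gamma> k n \<omega> (fst p) * lqg_measure \<gamma> k n \<omega> (snd p))} \<in> sets gauss_space"
proof -
  have eq: "(\<Sum>p\<in>{(u, v) \<in> VN n \<times> VN n. a \<le> fpp_dist \<gamma> k n \<omega> u v \<and> fpp_dist \<gamma> k n \<omega> u v \<le> b}.
     lqg_measure \<gamma> k n \<omega> (fst p) * lqg_measure \<gamma> k n \<omega> (snd p)) =
    (\<Sum>p\<in>VN n \<times> VN n. if a \<le> fpp_dist \<gamma> k n \<omega> (fst p) (snd p) \<and> fpp_dist \<gamma> k n \<omega> (fst p) (snd p) \<le> b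
       then lqg_measure \<gamma> k n \<omega> (fst p) * lqg_measure \<gamma> k n \<omega> (snd p) else 0)" for \<omega>
    by (subst sum.inter_filter[symmetric]) (auto intro!: sum.cong)
  have "{\<omega> \<in> space gauss_space. t \<le> (\<Sum>p\<in>VN n \<times> VN n.
      if a \<le> fpp_dist \<gamma> k n \<omega> (fst p) (snd p) \<and> fpp_dist \<gamma> k n \<omega> (fst p) (snd p) \<le> b
       then lqg_measure \<gamma> k n \<omega> (fst p) * lqg_measure \<gamma> k n \<omega> (snd p) else 0)} \<in> sets gauss_space"
    by measurable
  then show ?thesis by (simp only: eq space_gauss UNIV_I simp_thms)
qed

section \<open>Bookkeeping of the exponents\<close>

lemma upper_exponent:
  assumes e: "0 < e" "e \<le> 1" and k: "24 / e \<le> real k" "7 \<le> k" and \<gamma>: "0 < \<gamma>" "\<gamma> < 1 / 2"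
    and \<delta>: "0 \<le> s1" "s1 \<le> e / 64" "\<delta>1 = s1\<^sup>2"
  shows "\<forall>\<^sub>F n in sequentially. (2 * real n + 3) * step_cost \<gamma> (e / 64) (e / 64) \<delta>1 k n \<le> (2 ^ n) powr (1 + e)"
proof -
  \<comment> \<open>Budget for the excess exponent \<open>e\<close>: 1/4 for \<open>6 m\<close>, as
    \<open>24 \<le> e * k\<close>; 1/8 for the error terms; 5/8 for the linear factor and the
    constant \<open>C\<close>.\<close>
  define C where "C = 2 * (2::real) ^ (4 * k)"
  have "\<forall>\<^sub>F n in sequentially. (2 * real n + 3) * C \<le> 2 powr (5 / 8 * e * real n)"
    using e(1) by real_asymp
  then show ?thesis
  proof eventually_elim
    case (elim n)
    define m where "m = n div k"
    have kpos: "0 < real k" using k by simp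
    have ke: "24 \<le> e * real k" using k(1) e(1) by (simp add: pos_divide_le_eq mult.commute)
    have km: "real k * real m \<le> real n"
      using levels_le[of k n] unfolding m_def by (metis of_nat_le_iff of_nat_mult)
    have "24 * real m \<le> e * (real k * real m)" using mult_right_mono[OF ke, of "real m"] by (simp add: mult.assoc)
    also have "\<dots> \<le> e * real n" using km e(1) by (intro mult_left_mono) auto
    finally have m6: "6 * real m \<le> e / 4 * real n" by simp
    have p: "(2::real) ^ (4 * k + k * m + 6 * m) \<le> 2 ^ (4 * k) * 2 powr (real n + e / 4 * real n)"
    proof -
      have "real (k * m + 6 * m) \<le> real n + e / 4 * real n" using km m6 by simp
      then have "2 powr real (k * m + 6 * m) \<le> 2 powr (real n + e / 4 * real n)" by (rule powr_mono) simp
      then have "(2::real) ^ (k * m + 6 * m) \<le> 2 powr (real n + e / 4 * real n)"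
        by (simp only: powr_realpow zero_less_numeral)
      then show ?thesis by (simp add: power_add mult.assoc)
    qed
    have en: "0 \<le> e * real n" using e(1) by simp
    have x: "exp (2 * (e / 64) * real n + \<gamma> * (e / 64 * real n + 2 * sqrt \<delta>1 * real n)) \<le> 2 powr (e / 8 * real n)"
    proof -
      have "\<gamma> * (e / 64 * real n + 2 * sqrt \<delta>1 * real n) \<le> 1 / 2 * (e / 64 * real n + 2 * (e / 64) * real n)"
        using \<gamma> \<delta> e by (intro mult_mono add_mono mult_right_mono) auto
      moreover have "1 / 2 * (e / 64 * real n + 2 * (e / 64) * real n) = 3 / 128 * (e * real n)"
        "2 * (e / 64) * real n = 1 / 32 * (e * real n)" "1 / 2 * (e / 8 * real n) = 1 / 16 * (e * real n)"
        by simp_all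
      ultimately have "2 * (e / 64) * real n + \<gamma> * (e / 64 * real n + 2 * sqrt \<delta>1 * real n) \<le> 1 / 2 * (e / 8 * real n)"
        using en by (simp only:)
      also have "\<dots> \<le> ln 2 * (e / 8 * real n)"
        using ln_2_lower e(1) by (intro mult_right_mono) auto
      finally show ?thesis by (simp add: powr_def mult.commute)
    qed
    have "(2 * real n + 3) * step_cost \<gamma> (e / 64) (e / 64) \<delta>1 k n \<le>
      (2 * real n + 3) * (2 * (2 ^ (4 * k) * 2 powr (real n + e / 4 * real n)) * 2 powr (e / 8 * real n))"
      unfolding step_cost_def m_def[symmetric] by (intro mult_mono mult_left_mono p x) auto
    also have "\<dots> = ((2 * real n + 3) * C) * (2 powr (real n + e / 4 * real n) * 2 powr (e / 8 * real n))"
      by (simp add: C_def)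
    also have "\<dots> \<le> 2 powr (5 / 8 * e * real n) * (2 powr (real n + e / 4 * real n) * 2 powr (e / 8 * real n))"
      by (rule mult_right_mono[OF elim]) simp
    also have "\<dots> = 2 powr (real n * (1 + e))"
      unfolding powr_add[symmetric] by (simp add: algebra_simps)
    also have "\<dots> = (2 ^ n) powr (1 + e)"
      by (simp add: powr_powr[symmetric] powr_realpow)
    finally show ?case .
  qed
qed

text \<open>Budget for the deficit \<open>e\<close>: 1/2 for rounding in \<open>n div k\<close>,
  1/256 for the removed levels, 1/4 for the skeleton loss \<open>6 m\<close>, 1/6 for the error
  factors; the total is below 1.\<close>

lemma lower_exponent:
  assumes e: "0 < e" "e \<le> 1" and k: "24 / e \<le> real k" "7 \<le> k" and \<gamma>: "0 < \<gamma>" "\<gamma> < 1 / 2"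
    and \<delta>: "0 \<le> s1" "s1 \<le> e / 128" "\<delta>1 = s1\<^sup>2" "\<delta>2 = (e / 16)\<^sup>2"
  shows "\<forall>\<^sub>F n in sequentially. (2 ^ n) powr (1 - e) \<le>
     2 ^ ((k - 6) * (n div k - top_levels \<delta>2 k n)) * exp (- \<gamma> * (e / 64 * real n + 2 * sqrt \<delta>1 * real n)) *
       exp (- \<gamma> * (2 * sqrt \<delta>2 * real n))"
proof -
  have "\<forall>\<^sub>F n in sequentially. real k \<le> e / 2 * real n"
    using e(1) by real_asymp
  then show ?thesis
  proof eventually_elim
    case (elim n)
    define m where "m = n div k"
    define t where "t = top_levels \<delta>2 k n"
    have d2: "0 < \<delta>2" "\<delta>2 \<le> 1" "\<delta>2 \<le> e / 256"
    proof -
      show "0 < \<delta>2" using e \<delta> by simp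
      have "e * e \<le> e * 1" using e by (intro mult_left_mono) auto
      then show "\<delta>2 \<le> e / 256" using \<delta> by (simp add: power2_eq_square)
      then show "\<delta>2 \<le> 1" using e by simp
    qed
    have tm: "t \<le> m" unfolding t_def m_def by (rule top_levels_le[OF d2(1,2)])
    have ke: "24 \<le> e * real k" using k(1) e(1) by (simp add: pos_divide_le_eq mult.commute)
    have km: "real k * real m \<le> real n"
      using levels_le[of k n] unfolding m_def by (metis of_nat_le_iff of_nat_mult)
    have "24 * real m \<le> e * (real k * real m)" using mult_right_mono[OF ke, of "real m"] by (simp add: mult.assoc)
    also have "\<dots> \<le> e * real n" using km e(1) by (intro mult_left_mono) auto
    finally have m6: "6 * real m \<le> e / 4 * real n" by simp
    have kt: "real k * real t \<le> e / 256 * real n"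
    proof -
      have "real k * real t \<le> real k * (\<delta>2 * real m)"
        using top_levels_bounds(1)[OF d2(1), where k = k and n = n] by (intro mult_left_mono) (auto simp: t_def m_def)
      also have "\<dots> = \<delta>2 * (real k * real m)" by simp
      also have "\<dots> \<le> e / 256 * real n" using km d2 by (intro mult_mono) auto
      finally show ?thesis .
    qed
    have mn: "real n - real k \<le> real k * real m"
    proof -
      have "real n / real k \<le> real m + 1" unfolding m_def by (rule real_le_div_plus_1) (use k in simp)
      then show ?thesis using k(2) by (simp add: pos_divide_le_eq algebra_simps)
    qed
    have ex: "real n - real k - e / 256 * real n - e / 4 * real n \<le> real ((k - 6) * (m - t))"
    proof -
      have "real ((k - 6) * (m - t)) = real k * real m - real k * real t - 6 * real m + 6 * real t"
      proof -
        have k6: "real (k - 6) = real k - 6" using k(2) by (simp add: of_nat_diff)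
        have mt: "real (m - t) = real m - real t" by (rule of_nat_diff[OF tm])
        have "real ((k - 6) * (m - t)) = (real k - 6) * (real m - real t)"
          by (simp only: of_nat_mult k6 mt)
        then show ?thesis by (simp only: algebra_simps)
      qed
      then show ?thesis using mn kt m6 by linarith
    qed
    have x: "2 powr (- (e / 6 * real n)) \<le> exp (- \<gamma> * (e / 64 * real n + 2 * sqrt \<delta>1 * real n)) * exp (- \<gamma> * (2 * sqrt \<delta>2 * real n))"
    proof -
      have s: "sqrt \<delta>1 = s1" "sqrt \<delta>2 = e / 16" using \<delta> e by (auto simp: real_sqrt_unique)
      have "\<gamma> * (e / 64 * real n + 2 * s1 * real n + 2 * (e / 16) * real n) \<le>
         1 / 2 * (e / 64 * real n + 2 * (e / 128) * real n + 2 * (e / 16) * real n)"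
        using \<gamma> \<delta> e by (intro mult_mono add_mono mult_right_mono) auto
      also have "\<dots> \<le> 1 / 2 * (e / 6 * real n)"
        using mult_nonneg_nonneg[of e "real n"] e(1) by simp
      also have "\<dots> \<le> ln 2 * (e / 6 * real n)"
        using ln_2_lower e(1) by (intro mult_right_mono) auto
      finally have "- (ln 2 * (e / 6 * real n)) \<le> - \<gamma> * (e / 64 * real n + 2 * s1 * real n) + - \<gamma> * (2 * (e / 16) * real n)"
        by (simp add: algebra_simps)
      then have "exp (- (ln 2 * (e / 6 * real n))) \<le> exp (- \<gamma> * (e / 64 * real n + 2 * s1 * real n) + - \<gamma> * (2 * (e / 16) * real n))"
        by (simp only: exp_le_cancel_iff)
      then show ?thesis unfolding s exp_add by (simp add: powr_def mult.commute)
    qed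
    have "(2 ^ n) powr (1 - e) = 2 powr (real n * (1 - e))"
      by (simp add: powr_powr[symmetric] powr_realpow)
    also have "\<dots> \<le> 2 powr (real n - real k - e / 256 * real n - e / 4 * real n + - (e / 6 * real n))"
    proof (rule powr_mono)
      show "real n * (1 - e) \<le> real n - real k - e / 256 * real n - e / 4 * real n + - (e / 6 * real n)"
        using elim mult_nonneg_nonneg[of e "real n"] e(1) by (simp add: algebra_simps)
    qed simp
    also have "\<dots> = 2 powr (real n - real k - e / 256 * real n - e / 4 * real n) * 2 powr (- (e / 6 * real n))"
      by (rule powr_add)
    also have "\<dots> \<le> 2 powr real ((k - 6) * (m - t)) * (exp (- \<gamma> * (e / 64 * real n + 2 * sqrt \<delta>1 * real n)) * exp (- \<gamma> * (2 * sqrt \<delta>2 * real n)))"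
      by (intro mult_mono powr_mono ex x) auto
    also have "2 powr real ((k - 6) * (m - t)) = (2::real) ^ ((k - 6) * (m - t))"
      by (rule powr_realpow) simp
    finally show ?case by (simp add: m_def t_def mult.assoc)
  qed
qed

text \<open>A rate x/8 is set aside for the target and the rest absorbs the polynomial factors;
  \<open>exp (- x n / 8)\<close> is at most \<open>N^(- x / 8)\<close> because
  \<open>ln 2 \<le> 1\<close>.\<close>

lemma mass_exponent:
  assumes x: "0 < x"
  shows "\<forall>\<^sub>F n in sequentially. 4 * (real n + 1) * exp (- (x / 4) * real n) +
     C * (real n + 1)\<^sup>2 * exp (- (3 * x / 8) * real n) \<le> (2 ^ n) powr (- (x / 8))"
proof -
  have "(\<lambda>n. 4 * (real n + 1) * exp (- (x / 8) * real n)) \<longlonglongrightarrow> 0"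
    using x by real_asymp
  then have 1: "\<forall>\<^sub>F n in sequentially. 4 * (real n + 1) * exp (- (x / 8) * real n) < 1 / 2"
    by (rule order_tendstoD) simp
  have "(\<lambda>n. C * (real n + 1)\<^sup>2 * exp (- (x / 4) * real n)) \<longlonglongrightarrow> 0"
    using x by real_asymp
  then have 2: "\<forall>\<^sub>F n in sequentially. C * (real n + 1)\<^sup>2 * exp (- (x / 4) * real n) < 1 / 2"
    by (rule order_tendstoD) simp
  from 1 2 show ?thesis
  proof eventually_elim
    case (elim n)
    define E where "E = exp (- (x / 8) * real n)"
    have "4 * (real n + 1) * exp (- (x / 4) * real n) = (4 * (real n + 1) * exp (- (x / 8) * real n)) * E"
      by (simp add: E_def mult.assoc exp_add[symmetric])
    also have "\<dots> \<le> 1 / 2 * E" using elim(1) by (intro mult_right_mono) (auto simp: E_def)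
    finally have a: "4 * (real n + 1) * exp (- (x / 4) * real n) \<le> 1 / 2 * E" .
    have "C * (real n + 1)\<^sup>2 * exp (- (3 * x / 8) * real n) = (C * (real n + 1)\<^sup>2 * exp (- (x / 4) * real n)) * E"
      by (simp add: E_def mult.assoc exp_add[symmetric])
    also have "\<dots> \<le> 1 / 2 * E" using elim(2) by (intro mult_right_mono) (auto simp: E_def)
    finally have b: "C * (real n + 1)\<^sup>2 * exp (- (3 * x / 8) * real n) \<le> 1 / 2 * E" .
    have "E \<le> exp (- (x / 8) * (real n * ln 2))"
    proof -
      have "ln (2::real) \<le> 1" using ln_le_minus_one[of "2::real"] by linarith
      then have "(x / 8 * real n) * ln 2 \<le> (x / 8 * real n) * 1" using x by (intro mult_left_mono) auto
      then have "- (x / 8) * real n \<le> - (x / 8) * (real n * ln 2)" by (simp only: mult_minus_left mult.assoc mult_1_right neg_le_iff_le)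
      then show ?thesis unfolding E_def by (simp only: exp_le_cancel_iff)
    qed
    also have "\<dots> = (2 ^ n) powr (- (x / 8))" by (simp add: powr_def ln_realpow)
    finally show ?case using a b by linarith
  qed
qed

text \<open>Restoring the top levels loses at most \<gamma> 2 sqrt \<delta> n \<le> sqrt \<delta> n
  by \<open>crude\<close>, and comparing with the full variance loses at most sqrt \<delta> n / 8;
  both fit into 2 sqrt \<delta> n.\<close>

lemma total_mass_lower:
  assumes mass: "mass_lower \<gamma> \<delta> k n \<omega>" and crude: "crude \<delta> k n \<omega>"
    and par: "0 < \<delta>" "\<delta> \<le> 1" "0 < \<gamma>" "\<gamma> < 1 / 2"
  shows "4 ^ n * exp (\<gamma>\<^sup>2 * real (k * (n div k)) / 2) * exp (- (2 * sqrt \<delta> * real n)) / 2 \<le>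
    (\<Sum>u\<in>VN n. exp (\<gamma> * pphi k 0 (n div k) \<omega> u))"
proof -
  define m where "m = n div k"
  define t where "t = top_levels \<delta> k n"
  have tm: "t \<le> m" unfolding t_def m_def by (rule top_levels_le[OF par(1,2)])
  have g2: "\<gamma>\<^sup>2 \<le> 1 / 4" using power_mono[of \<gamma> "1 / 2" 2] par by (simp add: power2_eq_square)
  have kt: "real (k * t) \<le> \<delta> * real n"
  proof -
    have "real (k * t) \<le> real k * (\<delta> * real m)"
      using top_levels_bounds(1)[OF par(1), where k = k and n = n] by (auto simp: t_def m_def intro!: mult_left_mono)
    also have "\<dots> = \<delta> * real (k * m)" by simp
    also have "\<dots> \<le> \<delta> * real n"
      unfolding m_def using par(1) by (intro mult_left_mono of_nat_mono levels_le) auto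
    finally show ?thesis .
  qed
  have "\<delta> \<le> sqrt \<delta>"
  proof -
    have "sqrt \<delta> * sqrt \<delta> \<le> sqrt \<delta> * 1" using par by (intro mult_left_mono) auto
    then show ?thesis using par by simp
  qed
  then have dn: "\<delta> * real n \<le> sqrt \<delta> * real n" by (intro mult_right_mono) auto
  have dec: "\<gamma>\<^sup>2 * real (k * m) / 2 - 2 * sqrt \<delta> * real n \<le> \<gamma>\<^sup>2 * real (k * (m - t)) / 2 - \<gamma> * (2 * sqrt \<delta> * real n)"
  proof -
    have "real (k * m) = real (k * (m - t)) + real (k * t)"
      using tm by (simp add: of_nat_diff algebra_simps)
    then have "\<gamma>\<^sup>2 * real (k * m) / 2 = \<gamma>\<^sup>2 * real (k * (m - t)) / 2 + \<gamma>\<^sup>2 * real (k * t) / 2"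
      by (simp add: algebra_simps)
    moreover have "\<gamma>\<^sup>2 * real (k * t) \<le> 1 / 4 * (sqrt \<delta> * real n)"
      using g2 kt dn par(1) by (intro mult_mono) auto
    moreover have "\<gamma> * (2 * sqrt \<delta> * real n) \<le> 1 / 2 * (2 * sqrt \<delta> * real n)"
      using par by (intro mult_right_mono) auto
    moreover have "0 \<le> sqrt \<delta> * real n" using par by simp
    ultimately show ?thesis by linarith
  qed
  have assoc: "p * (x * y) / 2 = p * x / 2 * y" for p x y :: real by simp
  have split: "pphi k 0 m \<omega> u = pphi k 0 (m - t) \<omega> u + pphi k (m - t) m \<omega> u" for u
    by (rule pphi_split) simp_all
  have "4 ^ n * exp (\<gamma>\<^sup>2 * real (k * m) / 2) * exp (- (2 * sqrt \<delta> * real n)) / 2 =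
     4 ^ n * exp (\<gamma>\<^sup>2 * real (k * m) / 2 - 2 * sqrt \<delta> * real n) / 2"
    by (simp only: diff_conv_add_uminus exp_add mult.assoc)
  also have "\<dots> \<le> 4 ^ n * exp (\<gamma>\<^sup>2 * real (k * (m - t)) / 2 - \<gamma> * (2 * sqrt \<delta> * real n)) / 2"
    using dec by (intro divide_right_mono mult_left_mono) (simp_all only: exp_le_cancel_iff, simp_all)
  also have "\<dots> = 4 ^ n * exp (\<gamma>\<^sup>2 * real (k * (m - t)) / 2) / 2 * exp (- (\<gamma> * (2 * sqrt \<delta> * real n)))"
    by (simp only: diff_conv_add_uminus exp_add assoc)
  also have "\<dots> \<le> (\<Sum>u\<in>VN n. exp (\<gamma> * pphi k 0 (m - t) \<omega> u)) * exp (- (\<gamma> * (2 * sqrt \<delta> * real n)))"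
    using mass by (intro mult_right_mono) (auto simp: mass_lower_def m_def t_def)
  also have "\<dots> = (\<Sum>u\<in>VN n. exp (\<gamma> * pphi k 0 (m - t) \<omega> u) * exp (- (\<gamma> * (2 * sqrt \<delta> * real n))))"
    by (simp add: sum_distrib_right)
  also have "\<dots> \<le> (\<Sum>u\<in>VN n. exp (\<gamma> * pphi k 0 m \<omega> u))"
  proof (rule sum_mono)
    fix u assume "u \<in> VN n"
    then have "\<bar>pphi k (m - t) m \<omega> u\<bar> \<le> 2 * sqrt \<delta> * real n"
      using crude tm unfolding crude_def m_def t_def by (metis diff_diff_cancel diff_le_self order_refl)
    then have "- (2 * sqrt \<delta> * real n) \<le> pphi k (m - t) m \<omega> u" by linarith
    then have "\<gamma> * - (2 * sqrt \<delta> * real n) \<le> \<gamma> * pphi k (m - t) m \<omega> u"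
      using par(3) by (intro mult_left_mono) auto
    then have "\<gamma> * pphi k 0 (m - t) \<omega> u + - (\<gamma> * (2 * sqrt \<delta> * real n)) \<le> \<gamma> * pphi k 0 m \<omega> u"
      unfolding split[of u] by (simp add: distrib_left)
    then show "exp (\<gamma> * pphi k 0 (m - t) \<omega> u) * exp (- (\<gamma> * (2 * sqrt \<delta> * real n))) \<le> exp (\<gamma> * pphi k 0 m \<omega> u)"
      by (simp only: exp_add[symmetric] exp_le_cancel_iff)
  qed
  finally show ?thesis by (simp add: m_def)
qed

section \<open>From vertices to pairs under the product measure\<close>

lemma sum_Un_le_add:
  fixes f :: "'a \<Rightarrow> real"
  assumes "finite A" "finite B" "\<And>x. x \<in> A \<union> B \<Longrightarrow> 0 \<le> f x"
  shows "(\<Sum>x\<in>A \<union> B. f x) \<le> (\<Sum>x\<in>A. f x) + (\<Sum>x\<in>B. f x)"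
proof -
  have "0 \<le> (\<Sum>x\<in>A \<inter> B. f x)" by (rule sum_nonneg) (use assms in auto)
  then show ?thesis using sum.union_inter[OF assms(1,2), of f] by linarith
qed

text \<open>A pair outside \<open>G\<close> has an endpoint in \<open>X\<close> or is a close pair;
  the bound is subadditivity of the product measure over these families.\<close>

lemma good_pairs_mass:
  fixes w :: "vtx \<Rightarrow> real"
  assumes V: "finite V" "V \<noteq> {}" and w: "\<And>u. u \<in> V \<Longrightarrow> 0 < w u"
    and sub: "G \<subseteq> V \<times> V" and good: "\<And>u v. u \<in> V \<Longrightarrow> v \<in> V \<Longrightarrow> u \<notin> X \<Longrightarrow> v \<notin> X \<Longrightarrow> v \<notin> N u \<Longrightarrow> (u, v) \<in> G"
    and Xs: "X \<subseteq> V" "\<And>u. N u \<subseteq> V"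
  defines "Z \<equiv> (\<Sum>u\<in>V. w u)"
  shows "1 - (2 * (\<Sum>u\<in>X. w u) / Z + (\<Sum>u\<in>V. \<Sum>v\<in>N u. w u * w v) / Z\<^sup>2) \<le> (\<Sum>p\<in>G. (w (fst p) / Z) * (w (snd p) / Z))"
proof -
  define f where "f p = w (fst p) * w (snd p)" for p
  have Z: "0 < Z" unfolding Z_def by (rule sum_pos) (use V w in auto)
  have f0: "0 \<le> f p" if "p \<in> V \<times> V" for p
    using that w by (auto simp: f_def intro!: mult_nonneg_nonneg less_imp_le)
  have fV: "finite (V \<times> V)" using V(1) by simp
  have un: "(\<Sum>p\<in>P \<union> P'. f p) \<le> (\<Sum>p\<in>P. f p) + (\<Sum>p\<in>P'. f p)"
    if P: "P \<subseteq> V \<times> V" "P' \<subseteq> V \<times> V" for P P'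
    by (rule sum_Un_le_add) (use P f0 finite_subset[OF _ fV] in blast)+
  have N: "(SIGMA u:V. N u) \<subseteq> V \<times> V" by (rule Sigma_mono) (use Xs(2) in auto)
  have X: "X \<times> V \<subseteq> V \<times> V" "V \<times> X \<subseteq> V \<times> V" using Xs(1) by auto
  have cover: "V \<times> V = G \<union> (X \<times> V \<union> (V \<times> X \<union> (SIGMA u:V. N u)))"
  proof
    show "V \<times> V \<subseteq> G \<union> (X \<times> V \<union> (V \<times> X \<union> (SIGMA u:V. N u)))"
    proof (rule subsetI)
      fix p assume "p \<in> V \<times> V"
      then obtain u v where p: "p = (u, v)" "u \<in> V" "v \<in> V" by blast
      then show "p \<in> G \<union> (X \<times> V \<union> (V \<times> X \<union> (SIGMA u:V. N u)))"
        using good[of u v] by blast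
    qed
  qed (use sub N X in blast)
  have "Z\<^sup>2 = (\<Sum>p\<in>V \<times> V. f p)"
    by (simp add: Z_def power2_eq_square sum_product sum.cartesian_product f_def case_prod_unfold)
  also have "\<dots> = (\<Sum>p\<in>G \<union> (X \<times> V \<union> (V \<times> X \<union> (SIGMA u:V. N u))). f p)"
    using cover by (rule arg_cong)
  also have "\<dots> \<le> (\<Sum>p\<in>G. f p) + (\<Sum>p\<in>X \<times> V \<union> (V \<times> X \<union> (SIGMA u:V. N u)). f p)"
    by (rule un[OF sub]) (use N X in blast)
  also have "(\<Sum>p\<in>X \<times> V \<union> (V \<times> X \<union> (SIGMA u:V. N u)). f p) \<le>
      (\<Sum>p\<in>X \<times> V. f p) + (\<Sum>p\<in>V \<times> X \<union> (SIGMA u:V. N u). f p)"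
    by (rule un[OF X(1)]) (use N X in blast)
  also have "(\<Sum>p\<in>V \<times> X \<union> (SIGMA u:V. N u). f p) \<le> (\<Sum>p\<in>V \<times> X. f p) + (\<Sum>p\<in>(SIGMA u:V. N u). f p)"
    by (rule un[OF X(2) N])
  also have "(\<Sum>p\<in>X \<times> V. f p) = (\<Sum>u\<in>X. w u) * Z"
    by (simp add: Z_def sum_product sum.cartesian_product f_def case_prod_unfold)
  also have "(\<Sum>p\<in>V \<times> X. f p) = Z * (\<Sum>u\<in>X. w u)"
    by (simp add: Z_def sum_product sum.cartesian_product f_def case_prod_unfold)
  also have "(\<Sum>p\<in>(SIGMA u:V. N u). f p) = (\<Sum>u\<in>V. \<Sum>v\<in>N u. w u * w v)"
  proof -
    have "finite (N u)" for u by (rule finite_subset[OF Xs(2) V(1)])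
    then show ?thesis by (subst sum.Sigma) (use V(1) in \<open>simp_all add: f_def case_prod_unfold\<close>)
  qed
  finally have "Z\<^sup>2 \<le> (\<Sum>p\<in>G. f p) + (2 * Z * (\<Sum>u\<in>X. w u) + (\<Sum>u\<in>V. \<Sum>v\<in>N u. w u * w v))" by simp
  then have "Z\<^sup>2 / Z\<^sup>2 \<le> ((\<Sum>p\<in>G. f p) + (2 * Z * (\<Sum>u\<in>X. w u) + (\<Sum>u\<in>V. \<Sum>v\<in>N u. w u * w v))) / Z\<^sup>2"
    by (rule divide_right_mono) simp
  then have "1 \<le> (\<Sum>p\<in>G. f p) / Z\<^sup>2 + (2 * (\<Sum>u\<in>X. w u) / Z + (\<Sum>u\<in>V. \<Sum>v\<in>N u. w u * w v) / Z\<^sup>2)"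
    using Z by (simp add: add_divide_distrib power2_eq_square)
  moreover have "(\<Sum>p\<in>G. f p) / Z\<^sup>2 = (\<Sum>p\<in>G. (w (fst p) / Z) * (w (snd p) / Z))"
    by (simp add: sum_divide_distrib f_def power2_eq_square)
  ultimately show ?thesis by linarith
qed

lemma good_pairs_whp:
  assumes \<gamma>: "0 < \<gamma>" "\<gamma> < 1 / 2" and e: "0 < e" "e \<le> 1"
    and k: "7 \<le> k" "24 / e \<le> real k" "128 * ln 72 + ln 6272 + 1 \<le> (e / 64)\<^sup>2 / 256 * real k"
  shows "whp (\<lambda>n \<omega>. 1 - (2 ^ n) powr (- ((e / 16)\<^sup>2 / 8)) \<le>
    (\<Sum>p\<in>{(u, v) \<in> VN n \<times> VN n. (2 ^ n) powr (1 - e) \<le> fpp_dist \<gamma> k n \<omega> u v \<and>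
         fpp_dist \<gamma> k n \<omega> u v \<le> (2 ^ n) powr (1 + e)}.
       lqg_measure \<gamma> k n \<omega> (fst p) * lqg_measure \<gamma> k n \<omega> (snd p)))"
proof -
  define \<delta>2 where "\<delta>2 = (e / 16)\<^sup>2"
  \<comment> \<open>The lower bound on the total mass loses \<open>exp (2 * s1 * n)\<close>, squared
    for the close pairs. These gain \<open>2^(- \<delta>2 * n)\<close> up to a constant, a rate of
    at least \<delta>2 / 2; with 4 s1 = \<delta>2 / 8 a rate 3 \<delta>2 / 8 remains. For the thick
    points \<open>a - 2 * s1 \<ge> \<delta>2 / 4\<close>.\<close>
  define s1 where "s1 = \<delta>2 / 32"
  define \<delta>1 where "\<delta>1 = s1\<^sup>2"
  define a where "a = e / 64"
  have d2: "0 < \<delta>2" "\<delta>2 \<le> e / 256" "\<delta>2 \<le> 1"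
  proof -
    show "0 < \<delta>2" using e by (simp add: \<delta>2_def)
    have "e * e \<le> e * 1" using e by (intro mult_left_mono) auto
    then show "\<delta>2 \<le> e / 256" by (simp add: \<delta>2_def power2_eq_square)
    then show "\<delta>2 \<le> 1" using e by simp
  qed
  have s1: "0 < s1" "s1 \<le> e / 128" "s1 \<le> e / 64" "s1 \<le> 1" using d2 e by (auto simp: s1_def)
  have d1: "0 < \<delta>1" "\<delta>1 \<le> 1" using s1 by (auto simp: \<delta>1_def power_le_one)
  have sq1: "sqrt \<delta>1 = s1" using s1 by (simp add: \<delta>1_def)
  have a: "0 < a" using e by (simp add: a_def)
  have k1: "1 \<le> k" using k by simp
  \<comment> \<open>One factor 4 is from \<open>few_close\<close>, one from squaring the 1/2 in the
    mass bound, and 4^k = 2^(2 k) from the rounding in \<open>top_levels\<close>.\<close>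
  define C :: real where "C = 16 * 4 ^ k"
  have "whp (\<lambda>n \<omega>. (good_skel a \<delta>1 k n \<omega> \<and> crude \<delta>1 k n \<omega>) \<and> (crude \<delta>2 k n \<omega> \<and> smooth_top a k n \<omega>) \<and>
      thin \<gamma> a k n \<omega> \<and> few_close \<gamma> \<delta>2 k n \<omega> \<and> mass_lower \<gamma> \<delta>1 k n \<omega>)"
    by (intro whp_conj whp_good_skel whp_crude whp_smooth_top whp_thin whp_few_close whp_mass_lower)
       (use k k1 a d1 d2 \<gamma> in \<open>simp_all add: a_def\<close>)
  moreover have "\<forall>\<^sub>F n in sequentially. \<forall>\<omega>. (good_skel a \<delta>1 k n \<omega> \<and> crude \<delta>1 k n \<omega>) \<and> (crude \<delta>2 k n \<omega> \<and> smooth_top a k n \<omega>) \<and>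
      thin \<gamma> a k n \<omega> \<and> few_close \<gamma> \<delta>2 k n \<omega> \<and> mass_lower \<gamma> \<delta>1 k n \<omega> \<longrightarrow>
    1 - (2 ^ n) powr (- (\<delta>2 / 8)) \<le>
    (\<Sum>p\<in>{(u, v) \<in> VN n \<times> VN n. (2 ^ n) powr (1 - e) \<le> fpp_dist \<gamma> k n \<omega> u v \<and>
         fpp_dist \<gamma> k n \<omega> u v \<le> (2 ^ n) powr (1 + e)}.
       lqg_measure \<gamma> k n \<omega> (fst p) * lqg_measure \<gamma> k n \<omega> (snd p))"
    using upper_exponent[OF e k(2,1) \<gamma> less_imp_le[OF s1(1)] s1(3) \<delta>1_def]
      lower_exponent[OF e k(2,1) \<gamma> less_imp_le[OF s1(1)] s1(2) \<delta>1_def \<delta>2_def]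
      mass_exponent[OF d2(1), of C] eventually_ge_at_top[of k]
  proof eventually_elim
    case (elim n)
    show ?case
    proof (intro allI impI)
      fix \<omega> assume ev: "(good_skel a \<delta>1 k n \<omega> \<and> crude \<delta>1 k n \<omega>) \<and> (crude \<delta>2 k n \<omega> \<and> smooth_top a k n \<omega>) \<and>
        thin \<gamma> a k n \<omega> \<and> few_close \<gamma> \<delta>2 k n \<omega> \<and> mass_lower \<gamma> \<delta>1 k n \<omega>"
      define m where "m = n div k"
      define t where "t = top_levels \<delta>2 k n"
      define w where "w u = exp (\<gamma> * pphi k 0 m \<omega> u)" for u
      define Z where "Z = (\<Sum>u\<in>VN n. w u)"
      define X where "X = {u \<in> VN n. \<not> thin_point a k n \<omega> u}"
      define N where "N u = {v \<in> VN n. cheb u v < 2 ^ ((m - t) * k)}" for u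
      define G where "G = {(u, v) \<in> VN n \<times> VN n. (2 ^ n) powr (1 - e) \<le> fpp_dist \<gamma> k n \<omega> u v \<and>
         fpp_dist \<gamma> k n \<omega> u v \<le> (2 ^ n) powr (1 + e)}"
      define L where "L = 4 ^ n * exp (\<gamma>\<^sup>2 * real (k * m) / 2)"
      define E where "E = exp (- (2 * s1 * real n))"
      have LE: "0 < L" "0 < E" by (simp_all add: L_def E_def)
      have phi_w: "exp (\<gamma> * phi k n \<omega> u) = w u" for u by (simp add: w_def phi_eq_pphi m_def)
      have Zlow: "L * E / 2 \<le> Z"
        using total_mass_lower[of \<gamma> \<delta>1 k n \<omega>] ev d1 \<gamma>
        unfolding Z_def w_def L_def E_def m_def sq1 by blast
      have Z: "0 < Z" using Zlow LE by (smt (verit) divide_pos_pos mult_pos_pos)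
      have main: "(u, v) \<in> G" if uv: "u \<in> VN n" "v \<in> VN n" "u \<notin> X" "v \<notin> X" "v \<notin> N u" for u v
      proof -
        have thin: "thin_point a k n \<omega> u" "thin_point a k n \<omega> v" using uv by (auto simp: X_def)
        obtain c where c: "c \<le> (2 * real n + 3) * step_cost \<gamma> a a \<delta>1 k n"
          "wreach (VN n) (\<lambda>x. exp (\<gamma> * phi k n \<omega> x)) u v c"
          using thin_points_connected[of a \<delta>1 k n \<omega> a \<gamma> u v] ev a k(1) d1 \<gamma> uv thin elim(4) by blast
        have "fpp_dist \<gamma> k n \<omega> u v \<le> c" by (rule fpp_dist_le[OF c(2)])
        also note c(1)
        also have "(2 * real n + 3) * step_cost \<gamma> a a \<delta>1 k n \<le> (2 ^ n) powr (1 + e)" using elim(1) by (simp only: a_def)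
        finally have up: "fpp_dist \<gamma> k n \<omega> u v \<le> (2 ^ n) powr (1 + e)" .
        have far: "2 ^ ((n div k - top_levels \<delta>2 k n) * k) \<le> cheb u v"
          using uv by (simp add: N_def m_def t_def)
        have "(2 ^ n) powr (1 - e) \<le> fpp_dist \<gamma> k n \<omega> u v"
          using fpp_lower_bound[of a \<delta>1 k n \<omega> \<delta>2 \<gamma>, OF _ _ _ a k(1) d1(1) d2(1) \<gamma>(1) c(2) far] ev elim(2)
          unfolding a_def by (meson order_trans)
        then show ?thesis using up uv by (simp add: G_def)
      qed
      have lqg: "lqg_measure \<gamma> k n \<omega> u = w u / Z" for u
        by (simp add: lqg_measure_def phi_w Z_def)
      have VN_ne: "VN n \<noteq> {}" by (simp add: VN_def)
      have total: "1 - (2 * (\<Sum>u\<in>X. w u) / Z + (\<Sum>u\<in>VN n. \<Sum>v\<in>N u. w u * w v) / Z\<^sup>2) \<le>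
          (\<Sum>p\<in>G. (w (fst p) / Z) * (w (snd p) / Z))"
        unfolding Z_def
      proof (rule good_pairs_mass[where V = "VN n" and X = X and N = N])
        show "finite (VN n)" "VN n \<noteq> {}" "X \<subseteq> VN n" by (simp_all add: VN_ne X_def)
        show "0 < w u" for u by (simp add: w_def)
        show "G \<subseteq> VN n \<times> VN n" by (auto simp: G_def)
        show "N u \<subseteq> VN n" for u by (simp add: N_def)
        show "(u, v) \<in> G" if "u \<in> VN n" "v \<in> VN n" "u \<notin> X" "v \<notin> X" "v \<notin> N u" for u v
          by (rule main[OF that])
      qed
      have thick: "2 * (\<Sum>u\<in>X. w u) / Z \<le> 4 * (real n + 1) * exp (- (\<delta>2 / 4) * real n)"
      proof -
        have "(\<Sum>u\<in>X. w u) \<le> (real n + 1) * (L * exp (- (a * real n)))"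
          using thick_mass[of \<gamma> a k n \<omega>] ev unfolding X_def w_def L_def m_def
          by (simp only: diff_conv_add_uminus exp_add mult.assoc)
        then have "2 * (\<Sum>u\<in>X. w u) / Z \<le> 2 * ((real n + 1) * (L * exp (- (a * real n)))) / (L * E / 2)"
          using Zlow LE Z by (intro frac_le) auto
        also have "\<dots> = 4 * (real n + 1) * (exp (- (a * real n)) / E)"
          using LE by simp
        also have "exp (- (a * real n)) / E = exp (- (a - 2 * s1) * real n)"
          by (simp add: E_def exp_diff[symmetric] algebra_simps)
        also have "4 * (real n + 1) * exp (- (a - 2 * s1) * real n) \<le> 4 * (real n + 1) * exp (- (\<delta>2 / 4) * real n)"
        proof (rule mult_left_mono)
          have "\<delta>2 / 4 \<le> a - 2 * s1" using d2(1,2) e(1) unfolding a_def s1_def by linarith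
          then have "\<delta>2 / 4 * real n \<le> (a - 2 * s1) * real n" by (rule mult_right_mono) simp
          then show "exp (- (a - 2 * s1) * real n) \<le> exp (- (\<delta>2 / 4) * real n)"
            by (simp only: exp_le_cancel_iff mult_minus_left neg_le_iff_le)
        qed simp
        finally show ?thesis .
      qed
      have close: "(\<Sum>u\<in>VN n. \<Sum>v\<in>N u. w u * w v) / Z\<^sup>2 \<le> C * (real n + 1)\<^sup>2 * exp (- (3 * \<delta>2 / 8) * real n)"
      proof -
        define h where "h = (1 / 2 :: real) ^ (k * t)"
        have L2: "L\<^sup>2 = 16 ^ n * exp (\<gamma>\<^sup>2 * real (k * m))"
        proof -
          have "L\<^sup>2 = (4 ^ n * 4 ^ n) * (exp (\<gamma>\<^sup>2 * real (k * m) / 2) * exp (\<gamma>\<^sup>2 * real (k * m) / 2))"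
            unfolding L_def power2_eq_square[of "4 ^ n * _"] by (simp only: mult_ac)
          also have "exp (\<gamma>\<^sup>2 * real (k * m) / 2) * exp (\<gamma>\<^sup>2 * real (k * m) / 2) = exp (\<gamma>\<^sup>2 * real (k * m))"
            by (simp flip: exp_add)
          also have "(4::real) ^ n * 4 ^ n = 16 ^ n" by (simp flip: power_mult_distrib)
          finally show ?thesis .
        qed
        have "(\<Sum>u\<in>VN n. \<Sum>v\<in>N u. w u * w v) \<le> 4 * L\<^sup>2 * (real n + 1)\<^sup>2 * h"
          using ev unfolding few_close_def L2 h_def N_def w_def m_def t_def exp_add[symmetric]
          by (simp add: mult.assoc less_imp_le)
        moreover have "(L * E / 2)\<^sup>2 \<le> Z\<^sup>2" using Zlow LE by (intro power_mono) auto
        ultimately have "(\<Sum>u\<in>VN n. \<Sum>v\<in>N u. w u * w v) / Z\<^sup>2 \<le> (4 * L\<^sup>2 * (real n + 1)\<^sup>2 * h) / (L * E / 2)\<^sup>2"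
          using LE Z by (intro frac_le) (auto simp: h_def)
        also have "\<dots> = 16 * (real n + 1)\<^sup>2 * (h / E\<^sup>2)"
          using LE by (simp add: power_divide power_mult_distrib)
        also have "h / E\<^sup>2 \<le> 4 ^ k * exp (- (3 * \<delta>2 / 8) * real n)"
        proof -
          have "\<delta>2 * real n - 2 * real k \<le> real (k * t)"
            unfolding t_def by (rule top_levels_large[OF d2(1,3) k1])
          then have "- (real (k * t) * ln 2) \<le> (2 * real k - \<delta>2 * real n) * ln 2"
            using mult_right_mono[of "\<delta>2 * real n - 2 * real k" "real (k * t)" "ln 2"] by (simp add: algebra_simps)
          also have "\<dots> \<le> 2 * real k * ln 2 - \<delta>2 * real n * (1 / 2)"
          proof -
            have "\<delta>2 * real n * (1 / 2) \<le> \<delta>2 * real n * ln 2"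
              using ln_2_lower d2(1) by (intro mult_left_mono) auto
            then show ?thesis by (simp add: algebra_simps)
          qed
          finally have hx: "- (real (k * t) * ln 2) + 4 * s1 * real n \<le> 2 * real k * ln 2 + - (3 * \<delta>2 / 8) * real n"
            by (simp add: s1_def algebra_simps)
          have h: "h = exp (- (real (k * t) * ln 2))"
            unfolding h_def by (simp only: exp_minus exp_of_nat_mult) (simp add: power_one_over inverse_eq_divide)
          have E2: "1 / E\<^sup>2 = exp (4 * s1 * real n)"
            by (simp add: E_def exp_minus power_inverse inverse_eq_divide[symmetric] flip: exp_of_nat_mult)
          have K: "(4::real) ^ k = exp (2 * real k * ln 2)"
          proof -
            have "exp (real (2 * k) * ln 2) = (2::real) ^ (2 * k)"
              by (simp only: exp_of_nat_mult) simp
            then show ?thesis by (simp add: power_mult)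
          qed
          have "h / E\<^sup>2 = h * (1 / E\<^sup>2)" by simp
          also have "\<dots> = exp (- (real (k * t) * ln 2) + 4 * s1 * real n)" unfolding h E2 by (rule exp_add[symmetric])
          also have "\<dots> \<le> exp (2 * real k * ln 2 + - (3 * \<delta>2 / 8) * real n)" using hx by (simp only: exp_le_cancel_iff)
          also have "\<dots> = 4 ^ k * exp (- (3 * \<delta>2 / 8) * real n)" unfolding K by (rule exp_add)
          finally show ?thesis .
        qed
        then have "16 * (real n + 1)\<^sup>2 * (h / E\<^sup>2) \<le> 16 * (real n + 1)\<^sup>2 * (4 ^ k * exp (- (3 * \<delta>2 / 8) * real n))"
          by (rule mult_left_mono) simp
        finally show ?thesis by (simp add: C_def mult_ac)
      qed
      show "1 - (2 ^ n) powr (- (\<delta>2 / 8)) \<le>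
        (\<Sum>p\<in>{(u, v) \<in> VN n \<times> VN n. (2 ^ n) powr (1 - e) \<le> fpp_dist \<gamma> k n \<omega> u v \<and>
             fpp_dist \<gamma> k n \<omega> u v \<le> (2 ^ n) powr (1 + e)}.
           lqg_measure \<gamma> k n \<omega> (fst p) * lqg_measure \<gamma> k n \<omega> (snd p))"
        unfolding G_def[symmetric] lqg using total thick close elim(3) by linarith
    qed
  qed
  ultimately show ?thesis unfolding \<delta>2_def[symmetric] by (rule whp_mono)
qed

theorem theorem1p1:
  fixes \<gamma> :: real
  assumes "0 < \<gamma>" and "\<gamma> < 1/2"
  shows "\<forall>\<epsilon>>0. \<exists>K0::real. \<exists>\<rho>>0. \<forall>k::nat. k \<ge> 1 \<and> 2^k \<ge> K0 \<longrightarrow>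
    ((\<lambda>n. measure gauss_space
       {\<omega> \<in> space gauss_space.
          (\<Sum>p\<in>{(u, v) \<in> VN n \<times> VN n.
                 (2^n) powr (1 - \<epsilon>) \<le> fpp_dist \<gamma> k n \<omega> u v \<and>
                 fpp_dist \<gamma> k n \<omega> u v \<le> (2^n) powr (1 + \<epsilon>)}.
             lqg_measure \<gamma> k n \<omega> (fst p) * lqg_measure \<gamma> k n \<omega> (snd p))
          \<ge> 1 - (2^n) powr (- \<rho>)})
     \<longlonglongrightarrow> 1)"
proof (intro allI impI)
  fix \<epsilon> :: real assume \<epsilon>: "0 < \<epsilon>"
  \<comment> \<open>The estimates want an exponent at most 1. Shrinking the window only removes good
    pairs, so the result for \<open>e\<close> implies the one for \<epsilon>.\<close>
  define e where "e = min \<epsilon> 1"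
  have e: "0 < e" "e \<le> 1" "e \<le> \<epsilon>" using \<epsilon> by (auto simp: e_def)
  define \<rho> where "\<rho> = (e / 16)\<^sup>2 / 8"
  \<comment> \<open>\<open>B\<close> is the value of \<open>k\<close> from which the variance gain
    with \<open>a = e / 64\<close> beats the entropy and chaining constants.\<close>
  define B where "B = (128 * ln 72 + ln 6272 + 1) * 256 / (e / 64)\<^sup>2"
  define kmin where "kmin = max 7 (max (nat \<lceil>24 / e\<rceil>) (nat \<lceil>B\<rceil>))"
  show "\<exists>K0::real. \<exists>\<rho>>0. \<forall>k::nat. k \<ge> 1 \<and> 2^k \<ge> K0 \<longrightarrow>
    ((\<lambda>n. measure gauss_space
       {\<omega> \<in> space gauss_space.
          (\<Sum>p\<in>{(u, v) \<in> VN n \<times> VN n.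
                 (2^n) powr (1 - \<epsilon>) \<le> fpp_dist \<gamma> k n \<omega> u v \<and>
                 fpp_dist \<gamma> k n \<omega> u v \<le> (2^n) powr (1 + \<epsilon>)}.
             lqg_measure \<gamma> k n \<omega> (fst p) * lqg_measure \<gamma> k n \<omega> (snd p))
          \<ge> 1 - (2^n) powr (- \<rho>)})
     \<longlonglongrightarrow> 1)"
  proof (rule exI[of _ "2 ^ kmin"], rule exI[of _ \<rho>], intro conjI allI impI)
    show "0 < \<rho>" using e by (simp add: \<rho>_def)
    fix k :: nat assume "1 \<le> k \<and> (2::real) ^ kmin \<le> 2 ^ k"
    then have kk: "kmin \<le> k" by (auto intro: power_le_imp_le_exp[of "2::real"])
    have k: "7 \<le> k" "24 / e \<le> real k" "B \<le> real k"
    proof -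
      show "7 \<le> k" using kk by (simp add: kmin_def)
      have "nat \<lceil>24 / e\<rceil> \<le> k" "nat \<lceil>B\<rceil> \<le> k" using kk by (simp_all add: kmin_def)
      then show "24 / e \<le> real k" "B \<le> real k" by linarith+
    qed
    have kB: "128 * ln 72 + ln 6272 + 1 \<le> (e / 64)\<^sup>2 / 256 * real k"
    proof -
      have "(e / 64)\<^sup>2 / 256 * B \<le> (e / 64)\<^sup>2 / 256 * real k" using k(3) by (intro mult_left_mono) auto
      then show ?thesis using e(1) by (simp add: B_def)
    qed
    define S where "S r n \<omega> = (\<Sum>p\<in>{(u, v) \<in> VN n \<times> VN n. (2 ^ n) powr (1 - r) \<le> fpp_dist \<gamma> k n \<omega> u v \<and>
         fpp_dist \<gamma> k n \<omega> u v \<le> (2 ^ n) powr (1 + r)}.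
       lqg_measure \<gamma> k n \<omega> (fst p) * lqg_measure \<gamma> k n \<omega> (snd p))" for r :: real and n :: nat and \<omega>
    have "S e n \<omega> \<le> S \<epsilon> n \<omega>" for n \<omega>
      unfolding S_def
    proof (rule sum_mono2)
      have le: "(2 ^ n) powr (1 - \<epsilon>) \<le> ((2::real) ^ n) powr (1 - e)" "(2 ^ n) powr (1 + e) \<le> ((2::real) ^ n) powr (1 + \<epsilon>)"
        using e(3) by (auto intro!: powr_mono)
      show "{(u, v) \<in> VN n \<times> VN n. (2 ^ n) powr (1 - e) \<le> fpp_dist \<gamma> k n \<omega> u v \<and> fpp_dist \<gamma> k n \<omega> u v \<le> (2 ^ n) powr (1 + e)}
        \<subseteq> {(u, v) \<in> VN n \<times> VN n. (2 ^ n) powr (1 - \<epsilon>) \<le> fpp_dist \<gamma> k n \<omega> u v \<and> fpp_dist \<gamma> k n \<omega> u v \<le> (2 ^ n) powr (1 + \<epsilon>)}"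
        using le by fastforce
      show "finite {(u, v) \<in> VN n \<times> VN n. (2 ^ n) powr (1 - \<epsilon>) \<le> fpp_dist \<gamma> k n \<omega> u v \<and> fpp_dist \<gamma> k n \<omega> u v \<le> (2 ^ n) powr (1 + \<epsilon>)}"
        by (rule finite_subset[of _ "VN n \<times> VN n"]) auto
    qed (auto simp: lqg_measure_def intro!: mult_nonneg_nonneg divide_nonneg_nonneg sum_nonneg)
    moreover have "whp (\<lambda>n \<omega>. 1 - (2 ^ n) powr (- \<rho>) \<le> S e n \<omega>)"
      unfolding S_def \<rho>_def by (rule good_pairs_whp[OF assms e(1,2) k(1,2) kB])
    ultimately have "whp (\<lambda>n \<omega>. 1 - (2 ^ n) powr (- \<rho>) \<le> S \<epsilon> n \<omega>)"
      by (elim whp_mono) (auto intro!: always_eventually intro: order_trans)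
    moreover have "{\<omega>. 1 - (2 ^ n) powr (- \<rho>) \<le> S \<epsilon> n \<omega>} \<in> sets gauss_space" for n
      unfolding S_def by (rule good_pairs_event_measurable)
    ultimately have "(\<lambda>n. measure gauss_space {\<omega>. 1 - (2 ^ n) powr (- \<rho>) \<le> S \<epsilon> n \<omega>}) \<longlonglongrightarrow> 1"
      by (rule whp_prob_tendsto_1)
    then show "(\<lambda>n. measure gauss_space
       {\<omega> \<in> space gauss_space.
          (\<Sum>p\<in>{(u, v) \<in> VN n \<times> VN n.
                 (2^n) powr (1 - \<epsilon>) \<le> fpp_dist \<gamma> k n \<omega> u v \<and>
                 fpp_dist \<gamma> k n \<omega> u v \<le> (2^n) powr (1 + \<epsilon>)}.
             lqg_measure \<gamma> k n \<omega> (fst p) * lqg_measure \<gamma> k n \<omega> (snd p))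
          \<ge> 1 - (2^n) powr (- \<rho>)})
     \<longlonglongrightarrow> 1"
      by (simp only: S_def space_gauss UNIV_I simp_thms)
  qed
qed

end
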